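(* Let $a,b\ge2$ be integers with $a\not\sim b$, and let $\mu,\nu$ be Borel probability measures on $[0,1]$ of intermediate dimension such that $\mu$ is $T_a$-ergodic and $\nu$ is $T_b$-ergodic. Then $f\mu\perp\nu$ for every $f\in\mathrm{diff}^2(\mathbb{R})$.
   Context: For an integer $m\ge2$, $T_m:[0,1]\to[0,1]$ is $T_m(x)=mx\bmod 1$; $T_m$-ergodic means $T_m$-invariant and ergodic. For integers, $a\sim b$ means that $a,b$ are powers of a common integer, i.e. $a=c^k$, $b=c^m$ for some $c,k,m\in\mathbb{N}=\{1,2,\dots\}$; otherwise $a\not\sim b$. A measure $\mu$ has intermediate dimension if the local dimension $D(\mu,x)=\lim_{r\to0}\log\mu(B_r(x))/\log r$ exists and satisfies $0<D(\mu,x)<1$ for $\mu$-a.e. $x$. $\mathrm{diff}^2(\mathbb{R})$ is the set of diffeomorphisms of $\mathbb{R}$ of class $C^2$. $f\mu(A)=\mu(f^{-1}A)$, and $\perp$ denotes mutual singularity of measures. *)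

theory Defs
  imports "HOL-Probability.Probability"
begin

definition times_mod1 :: "int \<Rightarrow> real \<Rightarrow> real" where
  "times_mod1 m x = frac (of_int m * x)"

definition power_equiv :: "int \<Rightarrow> int \<Rightarrow> bool" where
  "power_equiv a b \<longleftrightarrow> (\<exists>c::int. \<exists>k m::nat. 1 \<le> k \<and> 1 \<le> m \<and> a = c ^ k \<and> b = c ^ m)"

definition borel_prob_on_unit_interval :: "real measure \<Rightarrow> bool" where
  "borel_prob_on_unit_interval M \<longleftrightarrow>
     sets M = sets (restrict_space borel {0..1}) \<and> prob_space M"

definition invariant_measure :: "'a measure \<Rightarrow> ('a \<Rightarrow> 'a) \<Rightarrow> bool" where
  "invariant_measure M T \<longleftrightarrow> T \<in> measurable M M \<and> distr M M T = M"

definition ergodic_measure :: "'a measure \<Rightarrow> ('a \<Rightarrow> 'a) \<Rightarrow> bool" where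
  "ergodic_measure M T \<longleftrightarrow>
     invariant_measure M T \<and>
     (\<forall>A\<in>sets M. T -` A \<inter> space M = A \<longrightarrow>
        emeasure M A = 0 \<or> emeasure M (space M - A) = 0)"

text \<open>
  Balls are those of the metric subspace \<open>space M\<close>; whether they are open or closed does not
  affect the limit. If some ball about \<open>x\<close> is null, the limit is \<open>0\<close> here (as \<open>ln 0 = 0\<close>) and
  \<open>\<infinity>\<close> by the usual convention; such \<open>x\<close> form a null set, and neither value lies
  strictly between \<open>0\<close> and \<open>1\<close>.
\<close>
definition has_local_dimension :: "'a::metric_space measure \<Rightarrow> 'a \<Rightarrow> real \<Rightarrow> bool" where
  "has_local_dimension M x D \<longleftrightarrow>
     ((\<lambda>r. ln (measure M (ball x r \<inter> space M)) / ln r) \<longlongrightarrow> D) (at_right 0)"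

definition intermediate_dimension :: "'a::metric_space measure \<Rightarrow> bool" where
  "intermediate_dimension M \<longleftrightarrow>
     (AE x in M. \<exists>D. has_local_dimension M x D \<and> 0 < D \<and> D < 1)"

definition C2_differentiable :: "(real \<Rightarrow> real) \<Rightarrow> bool" where
  "C2_differentiable f \<longleftrightarrow>
     (\<exists>f'. (\<forall>x. (f has_real_derivative f' x) (at x)) \<and> f' C1_differentiable_on UNIV)"

definition diff2 :: "(real \<Rightarrow> real) set" where
  "diff2 = {f. bij f \<and> C2_differentiable f \<and> C2_differentiable (inv f)}"

definition mutually_singular :: "'a measure \<Rightarrow> 'a measure \<Rightarrow> bool" where
  "mutually_singular M N \<longleftrightarrow>
     sets M = sets N \<and> (\<exists>A\<in>sets M. emeasure M A = 0 \<and> emeasure N (space N - A) = 0)"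

text \<open>
  A measure on a subset of the line, regarded as a Borel measure on the whole line by pushing it
  forward under the inclusion.
\<close>
definition extend_to_real :: "real measure \<Rightarrow> real measure" where
  "extend_to_real M = distr M borel (\<lambda>x. x)"

end

theory Submission
  imports Defs "HOL-Computational_Algebra.Nth_Powers" "HOL-Real_Asymp.Real_Asymp"
begin

text \<open>
  Write \<open>g\<close> for the inverse of \<open>f\<close>. The core is that, for every integer \<open>\<xi> \<noteq> 0\<close>, the averages over
  \<open>n < N\<close> of \<open>\<integral> e(\<xi> a^n g(x)) d\<nu>(x)\<close> tend to \<open>0\<close>, i.e. the averages of \<open>T_a^n (g \<nu>)\<close> tend to Lebesgue
  measure. Since \<open>T_b^m \<nu> = \<nu>\<close>, one may replace \<open>g\<close> by \<open>g \<circ> T_b^(K - k)\<close> with \<open>b^k \<approx> a^n\<close>: on a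
  \<open>b\<close>-adic cell of level \<open>K\<close> this map is affine up to a small error, so the integral is controlled by the
  Fourier transforms of the conditional measures given the first \<open>K\<close> digits, at frequencies
  \<open>\<xi> b^t g'(y)\<close> with \<open>t = frac (n log_b a)\<close>. Such a measure depends essentially on the last few digits and
  \<open>g'(y)\<close> on a block of \<open>l\<close> digits, where \<open>b^l \<approx> \<xi>\<close>; the entropy of \<open>\<nu>\<close> shows that the two are nearly
  independent up to \<open>o(l)\<close> of information. After decoupling them by Gibbs' inequality, the equidistribution of
  \<open>t\<close> (irrationality of \<open>log_b a\<close>) averages the Fourier transform over all scales, and positive dimension
  of \<open>\<nu>\<close> makes the average a negative power of \<open>b^l\<close>. Replacing \<open>\<xi>\<close> by \<open>\<xi> a^j\<close> only shifts \<open>n\<close>, so the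
  averages vanish in the limit.

  On the other side \<open>\<mu>\<close> has dimension less than \<open>1\<close>, hence is concentrated near few points, and the
  \<open>T_a\<close>-invariance of \<open>\<mu>\<close> gives the same for \<open>T_a^n \<mu>\<close>. A positive trigonometric polynomial with small
  mean that is large near these points separates \<open>f \<mu>\<close> from \<open>\<nu>\<close>.
\<close>

section \<open>Exponential sums and irrational rotations\<close>

text \<open>The obstacle: the frequency \<open>w * g' y\<close> and the conditional measure tested
  at it are read off the same digits, so the rotation cannot be averaged with this pair held fixed.
  Decoupling has a price per time step. With a suitable step, the blocks of \<open>J\<close> times
  fill all but O(\<open>J\<close>) of the \<open>K\<close> digits; the true law has entropy at least
  \<open>h * K\<close>, while comparing it with independent blocks and uniform remaining digits
  costs at most \<open>(h + \<epsilon>) * J * l + O(J)\<close>. So a step loses O(1) +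
  \<open>\<epsilon> * l\<close>, against an amplification exponent
  \<open>\<beta> = \<kappa> * l\<close> of \<open>phi\<close>. Hence the blocks must be long, and
  \<open>phi\<close> must be exponentially small in \<open>l\<close> on average, not merely small.
  The same smallness of entropy gaps carries the cell bounds of \<nu> over to its conditional
  measures. The order of choices is \<delta>, \<kappa>, \<epsilon>, \<open>l\<close>, then \<xi>
  comparable to \<open>b ^ l\<close>, then a finite grid of frequencies, then \<open>L\<close>, then
  \<open>J\<close>. The grid is finite so that one \<open>L\<close> serves all its frequencies in
  the martingale convergence of the conditional transforms.\<close>

definition ee :: "real \<Rightarrow> complex" where "ee t = cis (2 * pi * t)"

lemma norm_ee [simp]: "norm (ee t) = 1"
  by (simp add: ee_def)

lemma ee_add: "ee (s + t) = ee s * ee t"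
  by (simp add: ee_def cis_mult algebra_simps)

lemma ee_minus: "ee (- t) = cnj (ee t)"
  by (simp add: ee_def cis_cnj)

lemma ee_0 [simp]: "ee 0 = 1"
  by (simp add: ee_def)

lemma ee_of_int [simp]: "ee (of_int k) = 1"
  by (simp add: ee_def)

lemma ee_add_int: "ee (t + of_int k) = ee t"
  by (simp add: ee_add)

lemma ee_pow: "ee (real n * t) = ee t ^ n"
  by (simp add: ee_def Complex.DeMoivre algebra_simps)

lemma continuous_ee: "continuous_on UNIV ee"
  unfolding ee_def by (intro continuous_intros)

lemma borel_measurable_ee [measurable]: "ee \<in> borel_measurable borel"
  by (intro borel_measurable_continuous_onI continuous_ee)

lemma norm_cis_diff_le: "norm (cis s - cis t) \<le> \<bar>s - t\<bar>"
proof -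
  have "(norm (cis s - cis t))\<^sup>2 = (cos s - cos t)\<^sup>2 + (sin s - sin t)\<^sup>2"
    by (simp add: cmod_power2)
  also have "\<dots> = 2 - 2 * cos (s - t)"
    using sin_cos_squared_add[of s] sin_cos_squared_add[of t]
    by (simp add: cos_diff power2_eq_square algebra_simps)
  also have "\<dots> = (2 * sin ((s - t) / 2))\<^sup>2"
  proof -
    have "2 * ((s - t) / 2) = s - t" by simp
    then have "cos (s - t) = 1 - 2 * (sin ((s - t) / 2))\<^sup>2"
      using cos_double_sin[of "(s - t) / 2"] by metis
    then show ?thesis by (simp add: power_mult_distrib)
  qed
  finally have "sqrt ((norm (cis s - cis t))\<^sup>2) = sqrt ((2 * sin ((s - t) / 2))\<^sup>2)"
    by (rule arg_cong)
  then have "norm (cis s - cis t) = \<bar>2 * sin ((s - t) / 2)\<bar>"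
    by (simp only: real_sqrt_abs abs_norm_cancel)
  also have "\<dots> \<le> \<bar>s - t\<bar>"
    using abs_sin_x_le_abs_x[of "(s - t) / 2"] by (simp add: abs_mult)
  finally show ?thesis .
qed

lemma norm_ee_diff_le: "norm (ee s - ee t) \<le> 2 * pi * \<bar>s - t\<bar>"
  using norm_cis_diff_le[of "2 * pi * s" "2 * pi * t"]
  by (simp add: ee_def abs_mult flip: right_diff_distrib)

lemma sin_ge_half:
  fixes x :: real assumes "0 \<le> x" "x \<le> 1" shows "x / 2 \<le> sin x"
proof -
  have d: "((\<lambda>x. sin x - x / 2) has_real_derivative (cos y - 1/2)) (at y)" for y
    by (auto intro!: derivative_eq_intros)
  have "cos y \<ge> 1/2" if "0 \<le> y" "y \<le> x" for y :: real
  proof -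
    have "y \<le> pi / 3" using that assms pi_gt3 by simp
    then have "cos (pi/3) \<le> cos y"
      using that by (intro cos_monotone_0_pi_le) auto
    then show ?thesis by (simp add: cos_60)
  qed
  then have "sin 0 - 0 / 2 \<le> sin x - x / 2"
    using d assms by (intro DERIV_nonneg_imp_nondecreasing[of 0 x "\<lambda>x. sin x - x/2"]) (auto, force)
  then show ?thesis by simp
qed

text \<open>A geometric series whose ratio has distance \<open>2 * |sin (pi * \<theta> * u)|\<close>
  from 1. The bounds on \<theta> and \<open>u\<close> keep \<open>pi * \<theta> * u\<close> in
  [-1, 1], where the sine is at least half its argument in absolute value, so the ratio cannot
  return to 1.\<close>

lemma norm_sum_ee_le:
  assumes "0 < \<theta>" "\<theta> \<le> 1/7" "\<bar>u\<bar> \<le> 1" "u \<noteq> 0"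
  shows "norm (\<Sum>i<M. ee (real i * \<theta> * u)) \<le> 1 / (\<theta> * \<bar>u\<bar>)"
proof -
  define s where "s = 2 * pi * (\<theta> * u)"
  have pos: "0 < \<theta> * \<bar>u\<bar>" using assms by simp
  have lt: "pi * (\<theta> * \<bar>u\<bar>) \<le> 1"
  proof -
    have "\<theta> * \<bar>u\<bar> \<le> 1/7 * 1" using assms by (intro mult_mono) auto
    then have "pi * (\<theta> * \<bar>u\<bar>) \<le> 4 * (1/7)"
      using pi_less_4 pos by (intro mult_mono) auto
    then show ?thesis by simp
  qed
  have sb: "\<theta> * \<bar>u\<bar> \<le> \<bar>sin (s/2)\<bar>"
  proof -
    have "\<theta> * \<bar>u\<bar> \<le> pi * (\<theta> * \<bar>u\<bar>) / 2" using mult_right_mono[of 2 pi "\<theta> * \<bar>u\<bar>"] pi_gt3 pos by simp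
    also have "\<dots> \<le> sin (pi * (\<theta> * \<bar>u\<bar>))" using lt pos by (intro sin_ge_half) auto
    also have "\<dots> \<le> \<bar>sin (s/2)\<bar>"
      by (cases "u \<ge> 0") (auto simp: s_def abs_if)
    finally show ?thesis .
  qed
  have "(norm (cis s - 1))\<^sup>2 = (cos s - 1)\<^sup>2 + (sin s)\<^sup>2"
    by (simp add: cmod_power2)
  also have "\<dots> = 2 - 2 * cos s"
    using sin_cos_squared_add[of s] by (simp add: power2_eq_square algebra_simps)
  also have "\<dots> = (2 * sin (s / 2))\<^sup>2"
    using cos_double_sin[of "s / 2"] by (simp add: power2_eq_square)
  finally have "sqrt ((norm (cis s - 1))\<^sup>2) = sqrt ((2 * sin (s / 2))\<^sup>2)"
    by (rule arg_cong)
  then have n: "norm (cis s - 1) = 2 * \<bar>sin (s / 2)\<bar>"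
    by (simp only: real_sqrt_abs abs_norm_cancel abs_mult abs_numeral)
  have ne: "ee (\<theta> * u) \<noteq> 1" using n sb pos by (auto simp: ee_def s_def)
  have "(\<Sum>i<M. ee (real i * \<theta> * u)) = (\<Sum>i<M. ee (\<theta> * u) ^ i)"
    by (simp add: ee_pow[symmetric] mult.assoc)
  also have "\<dots> = (ee (\<theta> * u) ^ M - 1) / (ee (\<theta> * u) - 1)"
    using ne by (rule geometric_sum)
  finally have "norm (\<Sum>i<M. ee (real i * \<theta> * u)) = norm (ee (\<theta> * u) ^ M - 1) / norm (ee (\<theta> * u) - 1)"
    by (simp add: norm_divide)
  also have "\<dots> \<le> 2 / norm (ee (\<theta> * u) - 1)"
    using norm_triangle_ineq4[of "ee (\<theta> * u) ^ M" 1] by (intro divide_right_mono) (auto simp: norm_power)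
  also have "\<dots> = 1 / \<bar>sin (s/2)\<bar>" using n by (simp add: ee_def s_def)
  also have "\<dots> \<le> 1 / (\<theta> * \<bar>u\<bar>)" using sb pos by (intro frac_le) linarith+
  finally show ?thesis .
qed

text \<open>
  If \<open>\<delta>\<close> is a return time displacement slightly larger than \<open>w\<close>, then the translates of \<open>A\<close> along
  \<open>i * d\<close>, \<open>i < p\<close>, are disjoint; this bounds the frequency of visits by \<open>1 / p\<close>.
\<close>
lemma irrational_rotation_visits:
  assumes irr: "\<theta> \<notin> \<rat>" and lam: "0 < w" "w \<le> 1/4"
  obtains J0 where "\<And>J s A. J \<ge> J0 \<Longrightarrow> (\<And>t t'. t \<in> A \<Longrightarrow> t' \<in> A \<Longrightarrow> \<bar>t - t'\<bar> < w) \<Longrightarrow>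
     real (card {j. j < J \<and> frac (s + real j * \<theta>) \<in> A}) \<le> 8 * w * real J"
proof -
  \<comment> \<open>A displacement strictly between \<open>w\<close> and \<open>3/2 * w\<close>
    separates consecutive translates of \<open>A\<close>, yet is so small that
    \<open>p \<le> 1 / (2 * w)\<close> multiples of it stay below 3/4.\<close>
  have "0 \<le> 5/4 * w" "5/4 * w \<le> 1" "0 < w / 4" using lam by auto
  from Kronecker_approx_1_explicit[OF irr this]
  obtain d :: nat where d: "\<bar>frac (real d * \<theta>) - 5/4 * w\<bar> < w / 4" by blast
  define \<delta> where "\<delta> = frac (real d * \<theta>)"
  have \<delta>: "w < \<delta>" "\<delta> < 3/2 * w" using d unfolding \<delta>_def by linarith+
  define p where "p = nat \<lfloor>1 / (2 * w)\<rfloor>"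
  have p1: "real p \<le> 1 / (2 * w)" using lam by (simp add: p_def)
  have p2: "1 / (2 * w) - 1 < real p" unfolding p_def by linarith
  have p3: "1 / (4 * w) \<le> real p"
  proof -
    have "1 \<le> 1 / (4 * w)" using lam by simp
    moreover have "1 / (2 * w) = 1 / (4 * w) + 1 / (4 * w)" by (simp add: field_simps)
    ultimately show ?thesis using p2 by linarith
  qed
  have "0 < 1 / (4 * w)" using lam by simp
  then have p0: "0 < real p" using p3 by linarith
  define J0 where "J0 = nat \<lceil>real p * real d / (4 * w)\<rceil>"
  show ?thesis
  proof (rule that[of J0])
    fix J :: nat and s and A :: "real set"
    assume J: "J \<ge> J0" and A: "\<And>t t'. t \<in> A \<Longrightarrow> t' \<in> A \<Longrightarrow> \<bar>t - t'\<bar> < w"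
    define V where "V = {j. j < J \<and> frac (s + real j * \<theta>) \<in> A}"
    define f where "f = (\<lambda>(i, j). j + i * d)"
    \<comment> \<open>A collision would place some \<open>x\<close> in [\<open>w\<close>, 3/4] at
      distance less than \<open>w \<le> 1/4\<close> from an integer: 0 is excluded by
      \<open>w \<le> x\<close>, every positive integer by \<open>x \<le> 3/4\<close>.\<close>
    have key: False if "i < i'" "i' < p" "frac (s + real j * \<theta>) \<in> A" "frac (s + real j' * \<theta>) \<in> A"
        "j + i * d = j' + i' * d" for i i' j j'
    proof -
      define x where "x = real (i' - i) * \<delta>"
      have "1 * w \<le> x" unfolding x_def using that \<delta> lam by (intro mult_mono) auto
      moreover have "x \<le> 3/4"
      proof -
        have "x \<le> real p * (3/2 * w)" unfolding x_def using that \<delta> lam by (intro mult_mono) auto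
        also have "\<dots> \<le> 1 / (2 * w) * (3/2 * w)" using p1 lam by (intro mult_right_mono) auto
        also have "\<dots> = 3/4" using lam by simp
        finally show ?thesis .
      qed
      moreover have j: "real j = real j' + real (i' - i) * real d"
      proof -
        have "j = j' + (i' - i) * d" using that by (simp add: diff_mult_distrib)
        then show ?thesis by simp
      qed
      moreover have "\<exists>k::int. frac (s + real j * \<theta>) - frac (s + real j' * \<theta>) = x + of_int k"
      proof -
        have "frac (s + real j * \<theta>) - frac (s + real j' * \<theta>) =
          real (i' - i) * real d * \<theta> - of_int (\<lfloor>s + real j * \<theta>\<rfloor> - \<lfloor>s + real j' * \<theta>\<rfloor>)"
          by (simp add: frac_def j algebra_simps)
        also have "real (i' - i) * real d * \<theta> = real (i' - i) * (\<delta> + of_int \<lfloor>real d * \<theta>\<rfloor>)"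
          by (simp add: \<delta>_def frac_def algebra_simps)
        also have "\<dots> = x + of_int (int (i' - i) * \<lfloor>real d * \<theta>\<rfloor>)"
          by (simp add: x_def algebra_simps)
        finally show ?thesis
          by (intro exI[of _ "int (i' - i) * \<lfloor>real d * \<theta>\<rfloor> - (\<lfloor>s + real j * \<theta>\<rfloor> - \<lfloor>s + real j' * \<theta>\<rfloor>)"]) simp
      qed
      then obtain k :: int where k: "frac (s + real j * \<theta>) - frac (s + real j' * \<theta>) = x + of_int k" by blast
      moreover have "\<bar>frac (s + real j * \<theta>) - frac (s + real j' * \<theta>)\<bar> < w" using A that by blast
      ultimately have b: "\<bar>x + of_int k\<bar> < w" "w \<le> x" "x \<le> 3/4" by auto
      have "k < 0"
      proof (rule ccontr)
        assume "\<not> k < 0"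
        then have "0 \<le> real_of_int k" by simp
        then show False using b lam by linarith
      qed
      then have "real_of_int k \<le> -1" by simp
      then show False using b lam by linarith
    qed
    have inj: "inj_on f ({..<p} \<times> V)"
    proof (rule inj_onI, clarsimp simp: f_def)
      fix i j i' j' assume h: "i < p" "j \<in> V" "i' < p" "j' \<in> V" "j + i * d = j' + i' * d"
      show "i = i' \<and> j = j'"
      proof (cases i i' rule: linorder_cases)
        case less then show ?thesis using key[of i i' j j'] h by (auto simp: V_def)
      next
        case greater then show ?thesis using key[of i' i j' j] h by (auto simp: V_def)
      qed (use h in auto)
    qed
    have img: "f ` ({..<p} \<times> V) \<subseteq> {..< J + p * d}"
    proof (clarsimp simp: f_def V_def)
      fix i j assume "i < p" "j < J"
      then have "i * d \<le> p * d" by simp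
      then show "j + i * d < J + p * d" using \<open>j < J\<close> by linarith
    qed
    have "p * card V = card (f ` ({..<p} \<times> V))" using inj by (simp add: card_image card_cartesian_product)
    also have "\<dots> \<le> J + p * d" using card_mono[OF _ img] by simp
    finally have c: "real p * real (card V) \<le> real J + real p * real d"
      by (simp flip: of_nat_mult of_nat_add)
    have "real (card V) \<le> real J / real p + real d"
      using c p0 by (simp add: field_simps)
    also have "real J / real p \<le> 4 * w * real J"
    proof -
      have "1 \<le> 4 * w * real p" using p3 lam by (simp add: field_simps)
      then have "real J * 1 \<le> real J * (4 * w * real p)" by (intro mult_left_mono) auto
      then show ?thesis using p0 by (simp add: field_simps)
    qed
    also have "real d \<le> 4 * w * real J"
    proof -
      have "real p \<ge> 1" using p0 by (cases p) auto
      have "real p * real d / (4 * w) \<le> real J" using J unfolding J0_def by linarith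
      then have "real p * real d \<le> 4 * w * real J" using lam by (simp add: field_simps)
      moreover have "1 * real d \<le> real p * real d" using \<open>real p \<ge> 1\<close> by (intro mult_right_mono) auto
      ultimately show ?thesis by linarith
    qed
    finally show "real (card {j. j < J \<and> frac (s + real j * \<theta>) \<in> A}) \<le> 8 * w * real J"
      by (simp add: V_def)
  qed
qed

text \<open>At each prime the multiplicities satisfy \<open>q * v(a) = p * v(b)\<close>, so
  coprimality makes \<open>p\<close> divide every \<open>v(a)\<close>, and \<open>a\<close> is a
  \<open>p\<close>-th power.\<close>

lemma power_eq_coprime_imp_power:
  fixes a b p q :: nat
  assumes "a ^ q = b ^ p" "coprime p q" "0 < p" "0 < q" "0 < a" "0 < b"
  shows "\<exists>c. a = c ^ p \<and> b = c ^ q"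
proof -
  have "is_nth_power p (a ^ q)" using assms(1) by simp
  have mult: "q * multiplicity r a = p * multiplicity r b" if "prime r" for r
  proof -
    have "multiplicity r (a ^ q) = multiplicity r (b ^ p)" using assms(1) by simp
    moreover have "prime_elem r" using that by simp
    ultimately show ?thesis using assms(5,6) by (simp add: prime_elem_multiplicity_power_distrib)
  qed
  have "p dvd multiplicity r a" if "prime r" for r
  proof -
    have "p dvd q * multiplicity r a" using mult[OF that] by simp
    then show ?thesis using assms(2) by (simp add: coprime_dvd_mult_right_iff)
  qed
  then have "is_nth_power p a"
    using assms by (simp add: is_nth_power_conv_multiplicity_nat)
  then obtain c where c: "a = c ^ p" by (auto elim: is_nth_powerE)
  have "(c ^ q) ^ p = b ^ p" using assms(1) c by (simp add: mult.commute flip: power_mult)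
  then have "c ^ q = b" using assms(3) by (simp add: power_eq_iff_eq_base)
  then show ?thesis using c by auto
qed

lemma log_irrational:
  fixes a b :: nat
  assumes "2 \<le> a" "2 \<le> b" "\<not> power_equiv (int a) (int b)"
  shows "log (real b) (real a) \<notin> \<rat>"
proof
  assume "log (real b) (real a) \<in> \<rat>"
  then obtain p q :: nat where pq: "q \<noteq> 0" "\<bar>log (real b) (real a)\<bar> = real p / real q" "coprime p q"
    by (rule Rats_abs_nat_div_natE)
  have "log (real b) (real a) > 0" using assms by simp
  with pq have pq': "log (real b) (real a) = real p / real q" by simp
  then have p0: "p > 0" using \<open>log (real b) (real a) > 0\<close> by (cases p) auto
  have "real b powr log (real b) (real a) = real a" using assms by simp
  then have "real b powr (real p / real q) = real a" using pq' by simp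
  moreover have "(real b powr (real p / real q)) powr real q = real b powr real p"
    using pq(1) by (simp add: powr_powr)
  ultimately have "real a powr real q = real b powr real p" by simp
  then have "real a ^ q = real b ^ p" using assms by (simp add: powr_realpow)
  then have "a ^ q = b ^ p" by (simp flip: of_nat_power)
  then obtain c where "a = c ^ p" "b = c ^ q"
    using power_eq_coprime_imp_power[of a q b p] pq p0 assms by auto
  then have "power_equiv (int a) (int b)" unfolding power_equiv_def using p0 pq(1)
    by (intro exI[of _ "int c"] exI[of _ p] exI[of _ q]) auto
  then show False using assms by simp
qed

section \<open>Digits and invariant measures\<close>

text \<open>The first \<open>K\<close> base-\<open>b\<close> digits of the fractional part, packed
  into one integer with the leading digit first. Hence \<open>div b ^ e\<close> drops the last
  \<open>e\<close> digits and \<open>mod b ^ L\<close> keeps the last \<open>L\<close>.\<close>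

definition dig :: "nat \<Rightarrow> nat \<Rightarrow> real \<Rightarrow> nat" where
  "dig b K x = nat \<lfloor>real b ^ K * frac x\<rfloor>"

lemma frac_nat_mult_frac: "frac (real n * frac y) = frac (real n * y)"
proof -
  have "real n * y = real n * frac y + of_int (int n * \<lfloor>y\<rfloor>)"
    by (simp add: frac_def algebra_simps)
  then show ?thesis by (simp add: frac_def)
qed

lemma borel_measurable_frac [measurable]: "(frac :: real \<Rightarrow> real) \<in> borel_measurable borel"
  unfolding frac_def[abs_def] by measurable

lemma frac_pow_mult_frac: "frac (real b ^ n * frac y) = frac (real b ^ n * y)"
  using frac_nat_mult_frac[of "b ^ n" y] by simp

lemma frac_frac [simp]: "frac (frac (y::real)) = frac y"
  using frac_nat_mult_frac[of 1 y] by simp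

lemma dig_frac [simp]: "dig b K (frac x) = dig b K x"
  by (simp add: dig_def)

lemma of_nat_dig: "real (dig b K x) = of_int \<lfloor>real b ^ K * frac x\<rfloor>"
  by (simp add: dig_def)

lemma pow_frac_eq: "real b ^ K * frac x = real (dig b K x) + frac (real b ^ K * x)"
  using frac_pow_mult_frac[of b K x] by (simp add: of_nat_dig frac_def)

lemma frac_eq_dig:
  assumes "0 < b"
  shows "frac x = (real (dig b K x) + frac (real b ^ K * x)) / real b ^ K"
  using pow_frac_eq[of b K x] assms by (simp add: field_simps)

lemma dig_less: assumes "0 < b" shows "dig b K x < b ^ K"
proof -
  have "real (dig b K x) \<le> real b ^ K * frac x"
    using pow_frac_eq[of b K x] frac_ge_0[of "real b ^ K * x"] by linarith
  also have "\<dots> < real b ^ K * 1" using assms frac_lt_1[of x] by (intro mult_strict_left_mono) auto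
  finally show ?thesis by (simp flip: of_nat_power)
qed

lemma dig_add: "dig b (m + k) x = dig b m x * b ^ k + dig b k (real b ^ m * x)"
proof -
  have "real b ^ (m + k) * frac x = real b ^ k * (real b ^ m * frac x)"
    by (simp add: power_add algebra_simps)
  also have "\<dots> = real (dig b m x * b ^ k) + real b ^ k * frac (real b ^ m * x)"
    by (subst pow_frac_eq) (simp add: algebra_simps)
  finally have eq: "real b ^ (m + k) * frac x = of_int (int (dig b m x * b ^ k)) + real b ^ k * frac (real b ^ m * x)" by simp
  have "\<lfloor>real b ^ (m + k) * frac x\<rfloor> = int (dig b m x * b ^ k) + \<lfloor>real b ^ k * frac (real b ^ m * x)\<rfloor>"
    unfolding eq by linarith
  moreover have "0 \<le> \<lfloor>real b ^ k * frac (real b ^ m * x)\<rfloor>" by simp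
  ultimately show ?thesis
    unfolding dig_def[of b "m + k"] dig_def[of b k] by (simp only: nat_add_distrib nat_int of_nat_0_le_iff)
qed

lemma dig_add_div: "0 < b \<Longrightarrow> dig b (m + k) x div b ^ k = dig b m x"
  by (simp add: dig_add dig_less)

lemma dig_add_mod: "0 < b \<Longrightarrow> dig b (m + k) x mod b ^ k = dig b k (real b ^ m * x)"
  by (simp add: dig_add dig_less)

lemma dig_block:
  assumes "0 < b" "e + l \<le> K"
  shows "dig b K x div b ^ e mod b ^ l = dig b l (real b ^ (K - e - l) * x)"
proof -
  have "dig b K x div b ^ e = dig b (K - e) x" using dig_add_div[of b "K - e" e x] assms by simp
  also have "\<dots> mod b ^ l = dig b l (real b ^ (K - e - l) * x)"
    using dig_add_mod[of b "K - e - l" l x] assms by simp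
  finally show ?thesis .
qed

lemma measurable_dig [measurable]: "dig b K \<in> measurable borel (count_space UNIV)"
  unfolding dig_def by measurable

section \<open>Stationary digit sequences: invariance, cell masses, entropy\<close>

locale digit_system = prob_space N for N :: "real measure" +
  fixes b :: nat
  assumes sets_N [measurable_cong]: "sets N = sets borel"
    and b2: "2 \<le> b"
    and AE_unit: "AE x in N. frac x = x"
    and invariant: "distr N borel (\<lambda>x. frac (real b * x)) = N"
begin

lemma space_N [simp]: "space N = UNIV"
  using sets_eq_imp_space_eq[OF sets_N] by simp

lemma b_pos [simp]: "0 < b" "b \<noteq> 0" "Suc 0 < b" using b2 by auto

lemma integrable_bounded:
  fixes F :: "real \<Rightarrow> 'c::{banach, second_countable_topology}"
  assumes "F \<in> borel_measurable borel" "\<And>x. norm (F x) \<le> C"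
  shows "integrable N F"
  using assms by (intro integrable_const_bound[of _ C]) (auto cong: measurable_cong_sets[OF sets_N refl])

lemma invariant_pow: "distr N borel (\<lambda>x. frac (real b ^ m * x)) = N"
proof (induction m)
  case 0
  \<comment> \<open>Already for exponent 0 the map is \<open>frac\<close>, which is the identity
    only almost everywhere.\<close>
  have "distr N borel frac = distr N N (\<lambda>x. x)"
    using AE_unit by (intro distr_cong_AE) (auto simp: sets_N)
  then show ?case by (simp add: distr_id)
next
  case (Suc m)
  have "distr N borel (\<lambda>x. frac (real b ^ Suc m * x)) =
    distr N borel ((\<lambda>x. frac (real b * x)) \<circ> (\<lambda>x. frac (real b ^ m * x)))"
    by (simp add: o_def frac_nat_mult_frac mult.assoc)
  also have "\<dots> = distr (distr N borel (\<lambda>x. frac (real b ^ m * x))) borel (\<lambda>x. frac (real b * x))"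
    by (rule distr_distr[symmetric]) measurable
  also have "\<dots> = N" by (simp only: Suc.IH invariant)
  finally show ?case .
qed

lemma integral_shift:
  fixes F :: "real \<Rightarrow> 'c::{banach, second_countable_topology}"
  assumes [measurable]: "F \<in> borel_measurable borel"
  shows "(\<integral>x. F (frac (real b ^ m * x)) \<partial>N) = (\<integral>x. F x \<partial>N)"
proof -
  have "(\<integral>x. F x \<partial>N) = (\<integral>x. F x \<partial>distr N borel (\<lambda>x. frac (real b ^ m * x)))"
    by (simp only: invariant_pow)
  also have "\<dots> = (\<integral>x. F (frac (real b ^ m * x)) \<partial>N)"
    by (rule integral_distr) measurable
  finally show ?thesis ..
qed

definition pr :: "nat \<Rightarrow> nat \<Rightarrow> real" where
  "pr K i = measure N {x. dig b K x = i}"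

lemma pr_nonneg [simp]: "0 \<le> pr K i" by (simp add: pr_def)

lemma pr_le_1 [simp]: "pr K i \<le> 1" by (simp add: pr_def)

lemma integrable_dig:
  fixes h :: "nat \<Rightarrow> real"
  shows "integrable N (\<lambda>x. h (dig b K x))"
proof (rule integrable_bounded)
  show "norm (h (dig b K x)) \<le> (\<Sum>i<b^K. \<bar>h i\<bar>)" for x
    using member_le_sum[of "dig b K x" "{..<b^K}" "\<lambda>i. \<bar>h i\<bar>"] by (simp add: dig_less)
qed measurable

lemma integral_dig:
  fixes h :: "nat \<Rightarrow> real"
  shows "(\<integral>x. h (dig b K x) \<partial>N) = (\<Sum>i<b^K. pr K i * h i)"
proof -
  have eq: "h (dig b K x) = (\<Sum>i<b^K. indicator {x. dig b K x = i} x * h i)" for x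
  proof -
    have "(\<Sum>i<b^K. indicator {x. dig b K x = i} x * h i) = (\<Sum>i<b^K. if i = dig b K x then h i else 0)"
      by (intro sum.cong) (auto simp: indicator_def)
    then show ?thesis by (simp add: dig_less)
  qed
  have "(\<integral>x. h (dig b K x) \<partial>N) = (\<integral>x. (\<Sum>i<b^K. indicator {x. dig b K x = i} x * h i) \<partial>N)"
    using eq by simp
  also have "\<dots> = (\<Sum>i<b^K. (\<integral>x. indicator {x. dig b K x = i} x * h i \<partial>N))"
    by (intro Bochner_Integration.integral_sum integrable_bounded[where C = "\<bar>h _\<bar>"])
      (auto simp: indicator_def)
  also have "\<dots> = (\<Sum>i<b^K. pr K i * h i)" by (simp add: pr_def)
  finally show ?thesis .
qed

lemma integrable_dig_shift:
  fixes h :: "nat \<Rightarrow> real"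
  shows "integrable N (\<lambda>x. h (dig b l (real b ^ m * x)))"
proof (rule integrable_bounded)
  show "norm (h (dig b l (real b ^ m * x))) \<le> (\<Sum>i<b^l. \<bar>h i\<bar>)" for x
    using member_le_sum[of "dig b l (real b ^ m * x)" "{..<b^l}" "\<lambda>i. \<bar>h i\<bar>"] by (simp add: dig_less)
qed measurable

lemma integral_dig_shift:
  fixes h :: "nat \<Rightarrow> real"
  shows "(\<integral>x. h (dig b l (real b ^ m * x)) \<partial>N) = (\<Sum>i<b^l. pr l i * h i)"
proof -
  have "(\<integral>x. h (dig b l (real b ^ m * x)) \<partial>N) = (\<integral>x. h (dig b l (frac (real b ^ m * x))) \<partial>N)" by simp
  also have "\<dots> = (\<integral>x. h (dig b l x) \<partial>N)"
    by (rule integral_shift[of "\<lambda>x. h (dig b l x)"]) measurable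
  finally show ?thesis by (simp add: integral_dig)
qed

lemma sum_pr: "(\<Sum>i<b^K. pr K i) = 1"
  using integral_dig[of "\<lambda>_. 1" K] prob_space by simp

lemma AE_pr_pos: "AE x in N. 0 < pr l (dig b l (real b ^ m * x))"
proof -
  have "(\<integral>x. (if pr l (dig b l (real b ^ m * x)) = 0 then 1 else 0 :: real) \<partial>N) =
      (\<Sum>i<b^l. pr l i * (if pr l i = 0 then 1 else 0))"
    by (rule integral_dig_shift)
  also have "\<dots> = 0" by (intro sum.neutral) auto
  finally have "AE x in N. (if pr l (dig b l (real b ^ m * x)) = 0 then 1 else 0 :: real) = 0"
    by (subst (asm) integral_nonneg_eq_0_iff_AE) (auto intro!: integrable_dig_shift)
  then show ?thesis by (auto split: if_splits simp: less_le)
qed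

lemma AE_pr_pos_0: "AE x in N. 0 < pr K (dig b K x)"
  using AE_pr_pos[of K 0] by simp

definition ent :: "nat \<Rightarrow> real" where
  "ent K = - (\<Sum>i<b^K. pr K i * ln (pr K i))"

lemma integral_ln_pr: "(\<integral>x. ln (pr l (dig b l (real b ^ m * x))) \<partial>N) = - ent l"
  using integral_dig_shift[of "\<lambda>i. ln (pr l i)" l m] by (simp add: ent_def)

lemma integral_ln_pr_0: "(\<integral>x. ln (pr l (dig b l x)) \<partial>N) = - ent l"
  using integral_ln_pr[of l 0] by simp

lemma ent_nonneg: "0 \<le> ent K"
proof -
  have "pr K i * ln (pr K i) \<le> 0" for i
  proof (cases "pr K i = 0")
    case False
    then have "0 < pr K i" using pr_nonneg[of K i] by linarith
    then show ?thesis by (intro mult_nonneg_nonpos) auto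
  qed simp
  then show ?thesis unfolding ent_def by (simp add: sum_nonpos)
qed

text \<open>Relative entropy of \<open>pr K\<close> with respect to the weights
  \<open>R * exp (- X)\<close> is nonnegative, since these have total mass at most 1. Allowing
  unnormalised weights means that only their total has to be estimated, not computed.\<close>

lemma gibbs:
  assumes R: "\<And>i. 0 \<le> R i" "\<And>i. 0 < pr K i \<Longrightarrow> 0 < R i" and S: "(\<Sum>i<b^K. R i) \<le> exp X"
  shows "(\<integral>x. ln (R (dig b K x)) \<partial>N) \<le> X - ent K"
proof -
  have "pr K i * (ln (R i) - X) - pr K i * ln (pr K i) \<le> R i * exp (- X) - pr K i" for i
  proof (cases "pr K i = 0")
    case True then show ?thesis using R(1)[of i] by simp
  next
    case False
    then have p: "0 < pr K i" using pr_nonneg[of K i] by linarith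
    have r: "0 < R i" using R(2)[OF p] .
    have "ln (R i) - X - ln (pr K i) = ln (R i * exp (- X) / pr K i)"
      using p r by (simp add: ln_mult ln_div)
    also have "\<dots> \<le> R i * exp (- X) / pr K i - 1"
      using p r by (intro ln_le_minus_one) auto
    finally have "pr K i * (ln (R i) - X - ln (pr K i)) \<le> pr K i * (R i * exp (- X) / pr K i - 1)"
      using p by (intro mult_left_mono) auto
    then show ?thesis using p by (simp add: algebra_simps)
  qed
  then have "(\<Sum>i<b^K. pr K i * (ln (R i) - X) - pr K i * ln (pr K i)) \<le> (\<Sum>i<b^K. R i * exp (- X) - pr K i)"
    by (intro sum_mono)
  also have "\<dots> = (\<Sum>i<b^K. R i) * exp (- X) - 1"
    by (simp add: sum_subtractf sum_pr sum_distrib_right)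
  also have "\<dots> \<le> exp X * exp (- X) - 1" using S by (intro diff_right_mono mult_right_mono) auto
  also have "\<dots> = 0" by (simp flip: exp_add)
  finally have "(\<Sum>i<b^K. pr K i * ln (R i)) - (\<Sum>i<b^K. pr K i) * X + ent K \<le> 0"
    by (simp add: ent_def sum_subtractf sum.distrib algebra_simps sum_distrib_left)
  then show ?thesis using integral_dig[of "\<lambda>i. ln (R i)" K] by (simp add: sum_pr)
qed

end

section \<open>Summation over digit strings\<close>

lemma sum_mixed_radix:
  fixes F :: "nat \<Rightarrow> nat \<Rightarrow> 'a::comm_monoid_add"
  assumes "0 < b"
  shows "(\<Sum>i<b^(m+n). F (i div b^n) (i mod b^n)) = (\<Sum>i<b^m. \<Sum>j<b^n. F i j)"
proof -
  have "(\<Sum>i<b^m. \<Sum>j<b^n. F i j) = (\<Sum>(i,j)\<in>{..<b^m}\<times>{..<b^n}. F i j)"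
    by (simp add: sum.cartesian_product)
  also have "\<dots> = (\<Sum>i<b^(m+n). F (i div b^n) (i mod b^n))"
  proof (rule sum.reindex_bij_witness[of _ "\<lambda>i. (i div b^n, i mod b^n)" "\<lambda>(i,j). i * b^n + j"], goal_cases)
    case (2 p)
    then obtain i j where p: "p = (i, j)" "i < b^m" "j < b^n" by auto
    have "i * b^n + j < (i + 1) * b^n" using p by simp
    also have "\<dots> \<le> b^m * b^n" using p by (intro mult_right_mono) auto
    finally show ?case by (simp add: p power_add)
  next
    case (4 i)
    then have "i div b^n < b^m" using assms by (simp add: less_mult_imp_div_less power_add)
    then show ?case using assms by simp
  qed (use assms in \<open>auto simp: div_mult_mod_eq\<close>)
  finally show ?thesis ..
qed

lemma sum_mixed_radix_product:
  fixes f g :: "nat \<Rightarrow> 'a::comm_semiring_1"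
  assumes "0 < b"
  shows "(\<Sum>i<b^(m+n). f (i div b^n) * g (i mod b^n)) = (\<Sum>i<b^m. f i) * (\<Sum>i<b^n. g i)"
  using sum_mixed_radix[OF assms, where F = "\<lambda>i j. f i * g j" and m = m and n = n] by (simp only: sum_product)

lemma mod_power_div_mod:
  fixes i b :: nat
  assumes "0 < b" "f + l \<le> e"
  shows "(i mod b ^ e) div b ^ f mod b ^ l = i div b ^ f mod b ^ l"
proof -
  have e: "b ^ e = b ^ f * b ^ (e - f)" using assms by (simp flip: power_add)
  have "(i mod b ^ e) div b ^ f = i div b ^ f mod b ^ (e - f)"
    unfolding e mod_mult2_eq using assms by simp
  moreover have "b ^ l dvd b ^ (e - f)" using assms by (intro le_imp_power_dvd) auto
  ultimately show ?thesis by (simp add: mod_mod_cancel)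
qed

text \<open>The positions \<open>e j\<close> count from the least significant end, so the last block
  is the leading one and the induction splits it off. Digits outside the blocks are free and
  contribute a factor \<open>b\<close> each. The first conjunct guarantees that
  \<open>K - J * l\<close> is not a truncated difference.\<close>

lemma sum_prod_blocks:
  fixes u :: "nat \<Rightarrow> nat \<Rightarrow> real"
  assumes b: "0 < b" and e: "\<And>j. Suc j < J \<Longrightarrow> e j + l \<le> e (Suc j)" and K: "\<And>j. j < J \<Longrightarrow> e j + l \<le> K"
  shows "J * l \<le> K \<and> (\<Sum>i<b^K. \<Prod>j<J. u j (i div b ^ e j mod b ^ l)) = real b ^ (K - J * l) * (\<Prod>j<J. \<Sum>c<b^l. u j c)"
  using e K
proof (induction J arbitrary: K)
  case 0 then show ?case by simp
next
  case (Suc J)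
  let ?e = "e J"
  have lt: "e j + l \<le> ?e" if "j < J" for j
    using that
  proof (induction "J - Suc j" arbitrary: j)
    case 0 then have "Suc j = J" by simp
    then show ?case using Suc.prems(1)[of j] by auto
  next
    case (Suc n)
    then have "e (Suc j) + l \<le> e J" by (intro Suc.hyps(1)) auto
    moreover have "e j + l \<le> e (Suc j)" using Suc.prems \<open>Suc n = _\<close> by (intro \<open>\<And>j. Suc j < Suc J \<Longrightarrow> e j + l \<le> e (Suc j)\<close>) auto
    ultimately show ?case by simp
  qed
  have IH: "J * l \<le> ?e" "(\<Sum>i<b^?e. \<Prod>j<J. u j (i div b ^ e j mod b ^ l)) = real b ^ (?e - J * l) * (\<Prod>j<J. \<Sum>c<b^l. u j c)"
    using Suc.IH[of ?e] Suc.prems(1) lt by auto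
  have K: "?e + l \<le> K" using Suc.prems(2)[of J] by simp
  have "(\<Sum>i<b^K. \<Prod>j<Suc J. u j (i div b ^ e j mod b ^ l)) =
     (\<Sum>i<b^((K - ?e) + ?e). u J (i div b ^ ?e mod b ^ l) * (\<Prod>j<J. u j ((i mod b ^ ?e) div b ^ e j mod b ^ l)))"
    using K lt b by (intro sum.cong) (auto simp: mod_power_div_mod mult.commute intro!: prod.cong)
  also have "\<dots> = (\<Sum>i<b^(K - ?e). u J (i mod b ^ l)) * (\<Sum>i<b^?e. \<Prod>j<J. u j (i div b ^ e j mod b ^ l))"
    by (rule sum_mixed_radix_product[OF b, where f = "\<lambda>i. u J (i mod b ^ l)"])
  also have "(\<Sum>i<b^(K - ?e). u J (i mod b ^ l)) = (\<Sum>i<b^((K - ?e - l) + l). 1 * u J (i mod b ^ l))"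
    using K by simp
  also have "\<dots> = (\<Sum>i<b^(K - ?e - l). 1) * (\<Sum>c<b^l. u J c)"
    by (rule sum_mixed_radix_product[OF b])
  finally have "(\<Sum>i<b^K. \<Prod>j<Suc J. u j (i div b ^ e j mod b ^ l)) =
     (real b ^ (K - ?e - l) * real b ^ (?e - J * l)) * (\<Prod>j<Suc J. \<Sum>c<b^l. u j c)"
    by (simp add: IH(2) mult_ac)
  also have "real b ^ (K - ?e - l) * real b ^ (?e - J * l) = real b ^ (K - Suc J * l)"
    using K IH(1) by (simp flip: power_add)
  finally show ?case using K IH(1) by simp
qed

section \<open>Entropy\<close>

context digit_system
begin

lemma pr_shift: "measure N {x. dig b l (real b ^ m * x) = c} = pr l c"
proof (cases "c < b ^ l")
  case True
  have "measure N {x. dig b l (real b ^ m * x) = c} = (\<integral>x. indicator {x. dig b l (real b ^ m * x) = c} x \<partial>N)"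
    by simp
  also have "\<dots> = (\<integral>x. (\<lambda>i. if i = c then 1 else 0) (dig b l (real b ^ m * x)) \<partial>N)"
    by (intro Bochner_Integration.integral_cong) (auto simp: indicator_def)
  also have "\<dots> = (\<Sum>i<b^l. pr l i * (if i = c then 1 else 0))"
    by (rule integral_dig_shift)
  also have "\<dots> = (\<Sum>i<b^l. if i = c then pr l i else 0)" by (intro sum.cong) auto
  also have "\<dots> = pr l c" using True by simp
  finally show ?thesis .
next
  case False
  then have "dig b l y \<noteq> c" for y using dig_less[of b l y] b_pos by auto
  then show ?thesis by (simp add: pr_def)
qed

lemma pr_block_le:
  assumes "e + l \<le> K"
  shows "pr K i \<le> pr l (i div b ^ e mod b ^ l)"
proof -
  have "pr K i \<le> measure N {x. dig b l (real b ^ (K - e - l) * x) = i div b ^ e mod b ^ l}"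
    unfolding pr_def using dig_block[OF _ assms, of b]
    by (intro finite_measure_mono) (auto simp: sets_N)
  then show ?thesis by (simp only: pr_shift)
qed

lemma pr_pos_block: "e + l \<le> K \<Longrightarrow> 0 < pr K i \<Longrightarrow> 0 < pr l (i div b ^ e mod b ^ l)"
  using pr_block_le less_le_trans by blast

text \<open>Gibbs' inequality against the law that makes the first \<open>m\<close> and the last
  \<open>n\<close> digits independent; by invariance the latter have entropy
  \<open>ent n\<close>.\<close>

lemma ent_subadd: "ent (m + n) \<le> ent m + ent n"
proof -
  let ?R = "\<lambda>i. pr m (i div b ^ n) * pr n (i mod b ^ n)"
  have pos: "0 < ?R i" if "0 < pr (m + n) i" for i
  proof -
    have "i < b ^ (m + n)"
    proof (rule ccontr)
      assume "\<not> i < b ^ (m + n)"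
      then have "{x. dig b (m + n) x = i} = {}" using dig_less[of b "m + n"] b_pos by auto
      then show False using that by (simp add: pr_def)
    qed
    then have "i div b ^ n mod b ^ m = i div b ^ n" by (simp add: less_mult_imp_div_less power_add)
    then show ?thesis using pr_pos_block[of n m "m + n" i] pr_pos_block[of 0 n "m + n" i] that by simp
  qed
  have "(\<Sum>i<b^(m+n). ?R i) = 1"
    by (simp add: sum_mixed_radix_product sum_pr)
  then have "(\<integral>x. ln (?R (dig b (m + n) x)) \<partial>N) \<le> 0 - ent (m + n)"
    using pos by (intro gibbs) auto
  moreover have "(\<integral>x. ln (?R (dig b (m + n) x)) \<partial>N) =
      (\<integral>x. ln (pr m (dig b m x)) + ln (pr n (dig b n (real b ^ m * x))) \<partial>N)"
    using AE_pr_pos[of m 0] AE_pr_pos[of n m]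
    by (intro integral_cong_AE) (auto simp: dig_add_div dig_add_mod ln_mult)
  moreover have "\<dots> = - ent m - ent n"
    using integrable_dig[of "\<lambda>i. ln (pr m i)" m] integrable_dig_shift[of "\<lambda>i. ln (pr n i)" n m]
    by (simp add: integral_ln_pr integral_ln_pr_0)
  ultimately show ?thesis by simp
qed

lemma ent_mult_le: "ent (Suc r * l) \<le> real (Suc r) * ent l"
proof (induction r)
  case (Suc r)
  have "ent (Suc (Suc r) * l) \<le> ent l + ent (Suc r * l)" using ent_subadd[of l "Suc r * l"] by simp
  then show ?case using Suc by (simp add: algebra_simps)
qed simp

text \<open>\<open>h\<close> is the infimum of \<open>ent n / n\<close>. Multiples of one
  near-minimiser \<open>l0\<close> inherit its ratio by subadditivity, and they already provide
  arbitrarily long blocks with a good rate.\<close>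

lemma ent_rate:
  obtains h where "0 \<le> h" "\<And>n. h * real n \<le> ent n"
    "\<And>\<epsilon>. 0 < \<epsilon> \<Longrightarrow> \<exists>l0>0. \<forall>r>0. ent (r * l0) \<le> (h + \<epsilon>) * real (r * l0)"
proof -
  define S where "S = (\<lambda>n. ent n / real n) ` {0<..}"
  define h where "h = Inf S"
  have bdd: "bdd_below S" by (auto simp: S_def ent_nonneg intro!: bdd_belowI[of _ 0])
  have ne: "S \<noteq> {}" by (auto simp: S_def)
  have h0: "0 \<le> h" unfolding h_def using ne by (intro cInf_greatest) (auto simp: S_def ent_nonneg)
  have le: "h * real n \<le> ent n" for n
  proof (cases "n = 0")
    case False
    then have "h \<le> ent n / real n" unfolding h_def using bdd by (intro cInf_lower) (auto simp: S_def)
    then show ?thesis using False by (simp add: field_simps)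
  qed (simp add: ent_nonneg)
  have "\<exists>l0>0. \<forall>r>0. ent (r * l0) \<le> (h + \<epsilon>) * real (r * l0)" if "0 < \<epsilon>" for \<epsilon>
  proof -
    have "\<exists>s\<in>S. s < h + \<epsilon>" using cInf_lessD[OF ne, of "h + \<epsilon>"] that unfolding h_def by auto
    then obtain l0 where l0: "l0 > 0" "ent l0 / real l0 < h + \<epsilon>" by (auto simp: S_def)
    then have l0': "ent l0 \<le> (h + \<epsilon>) * real l0" by (simp add: field_simps)
    have "ent (r * l0) \<le> (h + \<epsilon>) * real (r * l0)" if "r > 0" for r
    proof -
      obtain s where r: "r = Suc s" using gr0_implies_Suc[OF \<open>r > 0\<close>] by blast
      have "ent (r * l0) \<le> real r * ent l0" unfolding r by (rule ent_mult_le)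
      also have "\<dots> \<le> real r * ((h + \<epsilon>) * real l0)" using l0' by (intro mult_left_mono) auto
      finally show ?thesis by (simp add: algebra_simps)
    qed
    then show ?thesis using l0 by blast
  qed
  then show thesis using that h0 le by blast
qed

text \<open>If every increment from \<open>L1\<close> on were smaller, summing them along
  \<open>L1 + j * l\<close> would push the entropy below \<open>h * n\<close>. The freedom to exceed
  \<open>L1\<close> is needed because \<open>L\<close> must also be long enough for
  \<open>conditional_fourier_approx\<close>.\<close>

lemma ent_increment:
  assumes h: "\<And>n. h * real n \<le> ent n" and "0 < l" "0 < \<epsilon>"
  obtains L where "L1 \<le> L" "(h - \<epsilon>) * real l \<le> ent (L + l) - ent L"
proof (rule ccontr)
  assume "\<not> thesis"
  then have less: "ent (L + l) - ent L < (h - \<epsilon>) * real l" if "L1 \<le> L" for L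
    using that \<open>\<not> thesis\<close> \<open>\<And>L. \<lbrakk>L1 \<le> L; (h - \<epsilon>) * real l \<le> ent (L + l) - ent L\<rbrakk> \<Longrightarrow> thesis\<close> by force
  have up: "ent (L1 + j * l) \<le> ent L1 + real j * ((h - \<epsilon>) * real l)" for j
  proof (induction j)
    case (Suc j)
    have "ent (L1 + Suc j * l) = ent ((L1 + j * l) + l)" by (simp add: algebra_simps)
    then show ?case using less[of "L1 + j * l"] Suc by (simp add: algebra_simps)
  qed simp
  obtain j :: nat where j: "real j * (\<epsilon> * real l) > ent L1 - h * real L1"
    using assms by (metis ex_less_of_nat_mult mult_pos_pos of_nat_0_less_iff)
  have "h * real (L1 + j * l) \<le> ent (L1 + j * l)" by (rule h)
  also note up
  finally show False using j by (simp add: algebra_simps)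
qed

text \<open>Let \<open>D\<close> be the pointwise mutual information of the first \<open>L\<close>
  and the next \<open>l\<close> digits. Its mean is at most \<open>2 * \<epsilon> * l\<close> by the
  entropy bounds and the mean of \<open>exp (- D)\<close> is at most 1, so
  \<open>max 0 D \<le> D + exp (- D)\<close> controls its positive part, and Markov's inequality
  applies. Where \<open>D < - ln \<tau>\<close> and the next block has mass at most
  \<open>\<tau> ^ 3\<close>, one factor \<tau> pays for the dependence and the conditional mass is
  at most \<open>\<tau>\<^sup>2\<close>.\<close>

lemma exceptional_blocks:
  assumes \<tau>: "0 < \<tau>" "\<tau> < 1"
    and up: "ent l \<le> (h + \<epsilon>) * real l" and low: "(h - \<epsilon>) * real l \<le> ent (L + l) - ent L"
  shows "measure N {x. \<tau>\<^sup>2 * pr L (dig b L x) < pr (L + l) (dig b (L + l) x)} \<le>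
    measure N {x. \<tau> ^ 3 < pr l (dig b l x)} + (2 * \<epsilon> * real l + 1) / (- ln \<tau>)"
proof -
  define D where "D i = ln (pr (L + l) i) - ln (pr L (i div b ^ l)) - ln (pr l (i mod b ^ l))" for i
  let ?d = "\<lambda>x. dig b (L + l) x"
  have intD: "(\<integral>x. D (?d x) \<partial>N) = ent L + ent l - ent (L + l)"
    using integrable_dig[of "\<lambda>i. ln (pr (L + l) i)" "L + l"] integrable_dig[of "\<lambda>i. ln (pr L i)" L]
      integrable_dig_shift[of "\<lambda>i. ln (pr l i)" l L]
    by (simp add: D_def dig_add_div dig_add_mod integral_ln_pr integral_ln_pr_0)
  have "(\<integral>x. exp (- D (?d x)) \<partial>N) = (\<Sum>i<b^(L+l). pr (L + l) i * exp (- D i))"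
    by (rule integral_dig[of "\<lambda>i. exp (- D i)"])
  also have "\<dots> \<le> (\<Sum>i<b^(L+l). pr L (i div b ^ l) * pr l (i mod b ^ l))"
  proof (rule sum_mono)
    fix i assume "i \<in> {..<b^(L+l)}"
    then have mod: "i div b ^ l mod b ^ L = i div b ^ l" by (simp add: less_mult_imp_div_less power_add)
    show "pr (L + l) i * exp (- D i) \<le> pr L (i div b ^ l) * pr l (i mod b ^ l)"
    proof (cases "pr (L + l) i = 0")
      case False
      then have p: "0 < pr (L + l) i" using pr_nonneg[of "L + l" i] by linarith
      then have "0 < pr L (i div b ^ l)" "0 < pr l (i mod b ^ l)"
        using pr_pos_block[of l L "L + l" i] pr_pos_block[of 0 l "L + l" i] mod by auto
      then show ?thesis using p by (simp add: D_def exp_diff exp_add exp_minus field_simps)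
    qed simp
  qed
  also have "\<dots> = 1" by (simp add: sum_mixed_radix_product sum_pr)
  finally have intE: "(\<integral>x. exp (- D (?d x)) \<partial>N) \<le> 1" .
  have "(\<integral>x. max 0 (D (?d x)) \<partial>N) \<le> (\<integral>x. D (?d x) + exp (- D (?d x)) \<partial>N)"
  proof (rule integral_mono)
    show "integrable N (\<lambda>x. max 0 (D (?d x)))" by (rule integrable_dig[of "\<lambda>i. max 0 (D i)"])
    show "integrable N (\<lambda>x. D (?d x) + exp (- D (?d x)))" by (rule integrable_dig[of "\<lambda>i. D i + exp (- D i)"])
    show "max 0 (D (?d x)) \<le> D (?d x) + exp (- D (?d x))" for x
      using exp_ge_add_one_self[of "- D (?d x)"] exp_gt_zero[of "- D (?d x)"] by linarith
  qed
  also have "\<dots> = (\<integral>x. D (?d x) \<partial>N) + (\<integral>x. exp (- D (?d x)) \<partial>N)"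
    by (intro Bochner_Integration.integral_add integrable_dig integrable_dig[of "\<lambda>i. exp (- D i)"])
  also have "\<dots> \<le> 2 * \<epsilon> * real l + 1" using intD intE up low by (simp add: algebra_simps)
  finally have intM: "(\<integral>x. max 0 (D (?d x)) \<partial>N) \<le> 2 * \<epsilon> * real l + 1" .
  have "ln \<tau> < 0" using \<tau> by simp
  have "measure N {x \<in> space N. - ln \<tau> \<le> max 0 (D (?d x))} \<le> (\<integral>x. max 0 (D (?d x)) \<partial>N) / (- ln \<tau>)"
    using \<open>ln \<tau> < 0\<close> integrable_dig[of "\<lambda>i. max 0 (D i)" "L + l"] by (intro integral_Markov_inequality_measure[where A = "{}"]) auto
  also have "\<dots> \<le> (2 * \<epsilon> * real l + 1) / (- ln \<tau>)" using intM \<open>ln \<tau> < 0\<close> by (intro divide_right_mono) auto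
  finally have mark: "measure N {x. - ln \<tau> \<le> max 0 (D (?d x))} \<le> (2 * \<epsilon> * real l + 1) / (- ln \<tau>)" by simp
  have shift: "measure N {x. \<tau> ^ 3 < pr l (dig b l (real b ^ L * x))} = measure N {x. \<tau> ^ 3 < pr l (dig b l x)}"
  proof -
    have "measure N {x. \<tau> ^ 3 < pr l (dig b l (real b ^ m * x))} = (\<integral>x. (\<lambda>i. if \<tau> ^ 3 < pr l i then 1 else 0) (dig b l (real b ^ m * x)) \<partial>N)" for m
    proof -
      have [measurable]: "{x. \<tau> ^ 3 < pr l (dig b l (real b ^ m * x))} \<in> sets N" by measurable
      have "measure N {x. \<tau> ^ 3 < pr l (dig b l (real b ^ m * x))} = (\<integral>x. indicator {x. \<tau> ^ 3 < pr l (dig b l (real b ^ m * x))} x \<partial>N)"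
        by simp
      also have "\<dots> = (\<integral>x. (\<lambda>i. if \<tau> ^ 3 < pr l i then 1 else 0) (dig b l (real b ^ m * x)) \<partial>N)"
        by (intro Bochner_Integration.integral_cong) (auto simp: indicator_def)
      finally show ?thesis .
    qed
    from this[of L] this[of 0] show ?thesis
      using integral_dig_shift[of "\<lambda>i. if \<tau> ^ 3 < pr l i then 1 else 0" l L] integral_dig[of "\<lambda>i. if \<tau> ^ 3 < pr l i then 1 else 0" l] by simp
  qed
  have "measure N {x. \<tau>\<^sup>2 * pr L (dig b L x) < pr (L + l) (?d x)} \<le>
    measure N ({x. \<tau> ^ 3 < pr l (dig b l (real b ^ L * x))} \<union> {x. - ln \<tau> \<le> max 0 (D (?d x))})"
  proof (rule finite_measure_mono_AE)
    show "AE x in N. x \<in> {x. \<tau>\<^sup>2 * pr L (dig b L x) < pr (L + l) (?d x)} \<longrightarrow> x \<in> {x. \<tau> ^ 3 < pr l (dig b l (real b ^ L * x))} \<union> {x. - ln \<tau> \<le> max 0 (D (?d x))}"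
      using AE_pr_pos[of L 0] AE_pr_pos[of "L + l" 0] AE_pr_pos[of l L]
    proof eventually_elim
      case (elim x)
      show ?case
      proof (clarsimp simp: not_less)
        assume a: "\<tau>\<^sup>2 * pr L (dig b L x) < pr (L + l) (?d x)" "\<not> - ln \<tau> \<le> max 0 (D (?d x))"
        show "\<tau> ^ 3 < pr l (dig b l (real b ^ L * x))"
        proof (rule ccontr)
          assume "\<not> \<tau> ^ 3 < pr l (dig b l (real b ^ L * x))"
          then have "ln (pr l (dig b l (real b ^ L * x))) \<le> ln (\<tau> ^ 3)" using elim \<tau> by simp
          moreover have "ln (\<tau>\<^sup>2 * pr L (dig b L x)) < ln (pr (L + l) (?d x))"
            using elim \<tau> a(1) by (intro ln_less_cancel_iff[THEN iffD2]) auto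
          moreover have "ln (\<tau>\<^sup>2 * pr L (dig b L x)) = 2 * ln \<tau> + ln (pr L (dig b L x))"
            using elim \<tau> by (simp add: ln_mult ln_realpow)
          moreover have "ln (\<tau> ^ 3) = 3 * ln \<tau>" using \<tau> by (simp add: ln_realpow)
          ultimately have "- ln \<tau> < D (?d x)" by (simp add: D_def dig_add_div dig_add_mod)
          then show False using a(2) by simp
        qed
      qed
    qed
  qed measurable
  also have "\<dots> \<le> measure N {x. \<tau> ^ 3 < pr l (dig b l (real b ^ L * x))} + measure N {x. - ln \<tau> \<le> max 0 (D (?d x))}"
    by (intro measure_Un_le) measurable
  finally show ?thesis using mark shift by linarith
qed

text \<open>
  Gibbs' inequality against the law under which the blocks are independent of each other and of the
  last \<open>L\<close> digits; the entropy deficit pays for the decoupling.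
\<close>
lemma decoupling:
  assumes e: "\<And>j. Suc j < J \<Longrightarrow> e j + l \<le> e (Suc j)" and e0: "\<And>j. j < J \<Longrightarrow> L \<le> e j"
    and K: "\<And>j. j < J \<Longrightarrow> e j + l \<le> K" "L \<le> K"
    and X: "\<And>z. z < b ^ L \<Longrightarrow> (\<Sum>j<J. \<Sum>c<b^l. pr l c * (exp (\<phi> j c z) - 1)) \<le> X"
  shows "(\<Sum>j<J. \<integral>x. \<phi> j (dig b K x div b ^ e j mod b ^ l) (dig b K x mod b ^ L) \<partial>N) \<le>
    X + real J * ent l + (real K - real J * real l) * ln (real b) - ent K"
proof -
  let ?B = "\<lambda>j i. i div b ^ e j mod b ^ l"
  \<comment> \<open>Comparison weights: block \<open>j\<close> has law \<open>pr l\<close> tilted by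
    \<open>exp (\<phi> j)\<close>, and every digit outside the blocks is uniform. The uniform digits
    cost \<open>ln b\<close> each and produce the term \<open>(K - J * l) * ln b\<close>.\<close>
  define R where "R i = (\<Prod>j<J. pr l (?B j i) * exp (\<phi> j (?B j i) (i mod b ^ L))) / real b ^ (K - J * l)" for i
  have pos: "0 < R i" if "0 < pr K i" for i
    using that K unfolding R_def by (auto intro!: divide_pos_pos prod_pos mult_pos_pos pr_pos_block[of _ l K i])
  have nn: "0 \<le> R i" for i unfolding R_def by (intro divide_nonneg_nonneg prod_nonneg mult_nonneg_nonneg) auto
  have JK: "J * l \<le> K - L"
    using sum_prod_blocks[where J = J and e = "\<lambda>j. e j - L" and K = "K - L" and l = l and b = b] e e0 K
    by (fastforce simp: le_diff_conv2)
  \<comment> \<open>Once the suffix \<open>z\<close> is fixed the factors depend on separate blocks,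
    all clear of the suffix because \<open>L \<le> e j\<close>, so the sum factorises. Then
    \<open>1 + t \<le> exp t\<close> turns the product into the exponential of the sum bounded by
    \<open>X\<close>.\<close>
  have inner: "(\<Sum>i<b^(K-L). \<Prod>j<J. pr l (i div b ^ (e j - L) mod b ^ l) * exp (\<phi> j (i div b ^ (e j - L) mod b ^ l) z)) \<le>
      real b ^ (K - L - J * l) * exp X" if "z < b ^ L" for z
  proof -
    have "(\<Sum>i<b^(K-L). \<Prod>j<J. pr l (i div b ^ (e j - L) mod b ^ l) * exp (\<phi> j (i div b ^ (e j - L) mod b ^ l) z)) =
      real b ^ (K - L - J * l) * (\<Prod>j<J. \<Sum>c<b^l. pr l c * exp (\<phi> j c z))"
      using e e0 K by (intro sum_prod_blocks[THEN conjunct2]) (fastforce simp: le_diff_conv2)+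
    also have "\<dots> \<le> real b ^ (K - L - J * l) * (\<Prod>j<J. exp (\<Sum>c<b^l. pr l c * (exp (\<phi> j c z) - 1)))"
    proof (intro mult_left_mono prod_mono conjI)
      fix j
      show "0 \<le> (\<Sum>c<b^l. pr l c * exp (\<phi> j c z))" by (intro sum_nonneg) auto
      have "(\<Sum>c<b^l. pr l c * exp (\<phi> j c z)) = 1 + (\<Sum>c<b^l. pr l c * (exp (\<phi> j c z) - 1))"
        by (simp add: algebra_simps sum_subtractf sum_pr)
      also have "\<dots> \<le> exp (\<Sum>c<b^l. pr l c * (exp (\<phi> j c z) - 1))" by (rule exp_ge_add_one_self)
      finally show "(\<Sum>c<b^l. pr l c * exp (\<phi> j c z)) \<le> exp (\<Sum>c<b^l. pr l c * (exp (\<phi> j c z) - 1))" .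
    qed auto
    also have "\<dots> \<le> real b ^ (K - L - J * l) * exp X"
      using X[OF that] by (simp flip: exp_sum)
    finally show ?thesis .
  qed
  have "(\<Sum>i<b^K. R i) = (\<Sum>i<b^((K-L)+L). (\<lambda>q z. \<Prod>j<J. pr l (q div b ^ (e j - L) mod b ^ l) * exp (\<phi> j (q div b ^ (e j - L) mod b ^ l) z)) (i div b ^ L) (i mod b ^ L)) / real b ^ (K - J * l)"
    unfolding R_def sum_divide_distrib[symmetric] using K(2) e0
    by (intro arg_cong2[where f = "(/)"] sum.cong prod.cong refl) (auto simp flip: div_mult2_eq power_add)
  also have "\<dots> = (\<Sum>q<b^(K-L). \<Sum>z<b^L. \<Prod>j<J. pr l (q div b ^ (e j - L) mod b ^ l) * exp (\<phi> j (q div b ^ (e j - L) mod b ^ l) z)) / real b ^ (K - J * l)"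
    by (subst sum_mixed_radix) auto
  also have "\<dots> = (\<Sum>z<b^L. \<Sum>q<b^(K-L). \<Prod>j<J. pr l (q div b ^ (e j - L) mod b ^ l) * exp (\<phi> j (q div b ^ (e j - L) mod b ^ l) z)) / real b ^ (K - J * l)"
    by (subst sum.swap) simp
  also have "\<dots> \<le> (\<Sum>z<b^L. real b ^ (K - L - J * l) * exp X) / real b ^ (K - J * l)"
    by (intro divide_right_mono sum_mono inner) auto
  also have "\<dots> = exp X"
  proof -
    have "real b ^ L * real b ^ (K - L - J * l) = real b ^ (K - J * l)"
      using JK K(2) by (simp flip: power_add)
    then show ?thesis by (simp add: field_simps)
  qed
  finally have g: "(\<integral>x. ln (R (dig b K x)) \<partial>N) \<le> X - ent K"
    using pos nn by (intro gibbs) auto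
  have JK': "J * l \<le> K" using JK by simp
  let ?P = "\<lambda>j x. ln (pr l (dig b l (real b ^ (K - e j - l) * x)))"
  let ?F = "\<lambda>j x. \<phi> j (dig b K x div b ^ e j mod b ^ l) (dig b K x mod b ^ L)"
  have "(\<integral>x. ln (R (dig b K x)) \<partial>N) = (\<integral>x. (\<Sum>j<J. ?P j x) + (\<Sum>j<J. ?F j x) - real (K - J * l) * ln (real b) \<partial>N)"
  proof (rule integral_cong_AE)
    show "AE x in N. ln (R (dig b K x)) = (\<Sum>j<J. ?P j x) + (\<Sum>j<J. ?F j x) - real (K - J * l) * ln (real b)"
      using AE_pr_pos_0[of K]
    proof eventually_elim
      case (elim x)
      have p: "0 < pr l (?B j (dig b K x))" if "j < J" for j
        using pr_pos_block[OF K(1)[OF that] elim] .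
      have "ln (R (dig b K x)) = (\<Sum>j<J. ln (pr l (?B j (dig b K x)) * exp (?F j x))) - real (K - J * l) * ln (real b)"
      proof -
        let ?f = "\<lambda>j. pr l (?B j (dig b K x)) * exp (?F j x)"
        have f: "0 < ?f j" if "j < J" for j using p[OF that] by simp
        have "ln (prod ?f {..<J}) = (\<Sum>j<J. ln (?f j))"
        proof (rule ln_prod)
          show "?f j \<noteq> 0" if "j \<in> {..<J}" for j using f[THEN less_imp_neq, THEN not_sym] that by (simp only: lessThan_iff not_False_eq_True)
        qed simp
        moreover have "ln (prod ?f {..<J} / real b ^ (K - J * l)) = ln (prod ?f {..<J}) - ln (real b ^ (K - J * l))"
          by (rule ln_divide_pos) (use f in \<open>auto intro!: prod_pos\<close>)
        ultimately show ?thesis unfolding R_def by (simp only: ln_realpow of_nat_0_less_iff b_pos)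
      qed
      also have "(\<Sum>j<J. ln (pr l (?B j (dig b K x)) * exp (?F j x))) = (\<Sum>j<J. ?P j x + ?F j x)"
      proof (rule sum.cong[OF refl])
        fix j assume "j \<in> {..<J}"
        then have j: "j < J" by simp
        have "ln (pr l (?B j (dig b K x)) * exp (?F j x)) = ln (pr l (?B j (dig b K x))) + ?F j x"
          using p[OF j] by (simp only: ln_mult_pos exp_gt_zero ln_exp)
        then show "ln (pr l (?B j (dig b K x)) * exp (?F j x)) = ?P j x + ?F j x"
          by (simp only: dig_block[OF b_pos(1) K(1)[OF j]])
      qed
      finally show ?case by (simp add: sum.distrib)
    qed
  qed measurable
  also have "\<dots> = (\<Sum>j<J. \<integral>x. ?P j x \<partial>N) + (\<Sum>j<J. \<integral>x. ?F j x \<partial>N) - real (K - J * l) * ln (real b)"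
  proof -
    have i: "integrable N (?P j)" "integrable N (?F j)" for j
      using integrable_dig_shift[of "\<lambda>i. ln (pr l i)"] integrable_dig[of "\<lambda>i. \<phi> j (i div b ^ e j mod b ^ l) (i mod b ^ L)"] by auto
    show ?thesis using i prob_space by (simp add: Bochner_Integration.integral_sum)
  qed
  also have "(\<Sum>j<J. \<integral>x. ?P j x \<partial>N) = - (real J * ent l)" by (simp add: integral_ln_pr)
  finally show ?thesis using g JK' by (simp add: of_nat_diff)
qed

end

section \<open>Fourier transforms of conditional measures\<close>

text \<open>The variance identity for the values \<open>a i / p i\<close> under the weights
  \<open>p i\<close>. Domination by \<open>p i\<close> makes \<open>a i\<close> vanish where
  \<open>p i = 0\<close>, in agreement with division by 0.\<close>

lemma sum_norm_square_deviation:
  fixes a :: "'i \<Rightarrow> complex" and p :: "'i \<Rightarrow> real" and A :: complex and P :: real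
  assumes "finite S" and p: "\<And>i. i \<in> S \<Longrightarrow> 0 \<le> p i" and a: "\<And>i. i \<in> S \<Longrightarrow> norm (a i) \<le> p i"
  defines "P \<equiv> \<Sum>i\<in>S. p i" and "A \<equiv> \<Sum>i\<in>S. a i"
  shows "(\<Sum>i\<in>S. (norm (a i - p i * (A / P)))\<^sup>2 / p i) = (\<Sum>i\<in>S. (norm (a i))\<^sup>2 / p i) - (norm A)\<^sup>2 / P"
proof -
  define m where "m = A / complex_of_real P"
  have tm: "(norm (a i - p i * m))\<^sup>2 / p i = (norm (a i))\<^sup>2 / p i - 2 * Re (a i * cnj m) + p i * (norm m)\<^sup>2" if "i \<in> S" for i
  proof (cases "p i = 0")
    case True then show ?thesis using a[OF that] by simp
  next
    case False
    then have pp: "p i > 0" using p[OF that] by simp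
    have "(norm (a i - p i * m))\<^sup>2 = (norm (a i))\<^sup>2 - 2 * p i * Re (a i * cnj m) + (p i)\<^sup>2 * (norm m)\<^sup>2"
      unfolding cmod_power2 by (simp add: power2_eq_square algebra_simps)
    then show ?thesis using pp by (simp add: field_simps power2_eq_square)
  qed
  have "(\<Sum>i\<in>S. (norm (a i - p i * m))\<^sup>2 / p i) =
      (\<Sum>i\<in>S. (norm (a i))\<^sup>2 / p i) - 2 * (\<Sum>i\<in>S. Re (a i * cnj m)) + P * (norm m)\<^sup>2"
    by (simp add: tm sum.distrib sum_subtractf sum_distrib_left sum_distrib_right P_def)
  also have "(\<Sum>i\<in>S. Re (a i * cnj m)) = Re (A * cnj m)"
    by (simp only: Re_sum[symmetric] sum_distrib_right A_def)
  also have "P * (norm m)\<^sup>2 = (norm A)\<^sup>2 / P"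
    by (cases "P = 0") (simp_all add: m_def norm_divide power2_eq_square)
  also have "Re (A * cnj m) = (norm A)\<^sup>2 / P"
    by (simp add: m_def complex_mult_cnj cmod_power2 complex_cnj_divide times_divide_eq_right
        flip: of_real_power of_real_add of_real_divide)
  finally show ?thesis by (simp add: m_def)
qed

lemma harm_le_ln: "n \<ge> 1 \<Longrightarrow> harm n \<le> 1 + ln (real n)"
proof -
  assume "n \<ge> 1"
  then obtain k where k: "n = Suc k" by (cases n) auto
  have "harm (Suc k) - ln (real (Suc k)) \<le> harm (Suc 0) - ln (real (Suc 0))"
    by (rule decseqD[OF decseq_harm_diff_ln]) simp
  then show ?thesis by (simp add: k harm_def)
qed

lemma sum_inverse_distance_le:
  fixes c n :: nat
  assumes "c < n"
  shows "(\<Sum>c' | c' < n \<and> c' + 1 < c. 1 / (real c - real c' - 1)) \<le> harm n"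
    and "(\<Sum>c' | c' < n \<and> c + 1 < c'. 1 / (real c' - real c - 1)) \<le> harm n"
proof -
  have "(\<Sum>c' | c' < n \<and> c' + 1 < c. 1 / (real c - real c' - 1)) = (\<Sum>k\<in>(\<lambda>c'. c - c' - 1) ` {c'. c' < n \<and> c' + 1 < c}. 1 / real k)"
    by (subst sum.reindex) (auto simp: inj_on_def of_nat_diff intro!: sum.cong)
  also have "\<dots> \<le> (\<Sum>k\<in>{1..n}. 1 / real k)"
    using assms by (intro sum_mono2) auto
  finally show "(\<Sum>c' | c' < n \<and> c' + 1 < c. 1 / (real c - real c' - 1)) \<le> harm n"
    by (simp add: harm_def inverse_eq_divide)
  have "(\<Sum>c' | c' < n \<and> c + 1 < c'. 1 / (real c' - real c - 1)) = (\<Sum>k\<in>(\<lambda>c'. c' - c - 1) ` {c'. c' < n \<and> c + 1 < c'}. 1 / real k)"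
    by (subst sum.reindex) (auto simp: inj_on_def of_nat_diff intro!: sum.cong)
  also have "\<dots> \<le> (\<Sum>k\<in>{1..n}. 1 / real k)"
    using assms by (intro sum_mono2) auto
  finally show "(\<Sum>c' | c' < n \<and> c + 1 < c'. 1 / (real c' - real c - 1)) \<le> harm n"
    by (simp add: harm_def inverse_eq_divide)
qed

lemma sum_kernel_le:
  fixes c n :: nat and M T :: real
  assumes "c < n" "0 \<le> M" "0 \<le> T"
  shows "(\<Sum>c'<n. if c \<le> c' + 1 \<and> c' \<le> c + 1 then M else T / (\<bar>real c - real c'\<bar> - 1)) \<le> 3 * M + 2 * T * harm n"
proof -
  let ?W = "\<lambda>c'. if c \<le> c' + 1 \<and> c' \<le> c + 1 then M else T / (\<bar>real c - real c'\<bar> - 1)"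
  let ?A = "{c'. c' < n \<and> c \<le> c' + 1 \<and> c' \<le> c + 1}" and ?B = "{c'. c' < n \<and> c' + 1 < c}" and ?C = "{c'. c' < n \<and> c + 1 < c'}"
  have "(\<Sum>c'<n. ?W c') = (\<Sum>c'\<in>?A \<union> ?B \<union> ?C. ?W c')"
    by (intro sum.cong) auto
  also have "\<dots> = (\<Sum>c'\<in>?A. ?W c') + (\<Sum>c'\<in>?B. ?W c') + (\<Sum>c'\<in>?C. ?W c')"
    by (subst sum.union_disjoint; (subst sum.union_disjoint)?) auto
  also have "(\<Sum>c'\<in>?A. ?W c') \<le> 3 * M"
  proof -
    have "?A \<subseteq> {c - 1, c, c + 1}" by auto
    then have "card ?A \<le> card {c - 1, c, c + 1}" by (intro card_mono) auto
    also have "\<dots> \<le> 3" by (simp add: card_insert_if)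
    finally have "real (card ?A) \<le> 3" by simp
    then have "real (card ?A) * M \<le> 3 * M" using assms by (intro mult_right_mono) auto
    then show ?thesis by simp
  qed
  also have "(\<Sum>c'\<in>?B. ?W c') = T * (\<Sum>c'\<in>?B. 1 / (real c - real c' - 1))"
    unfolding sum_distrib_left by (intro sum.cong) auto
  also have "\<dots> \<le> T * harm n" using assms sum_inverse_distance_le by (intro mult_left_mono) auto
  also have "(\<Sum>c'\<in>?C. ?W c') = T * (\<Sum>c'\<in>?C. 1 / (real c' - real c - 1))"
    unfolding sum_distrib_left by (intro sum.cong) auto
  also have "\<dots> \<le> T * harm n" using assms sum_inverse_distance_le by (intro mult_left_mono) auto
  finally show ?thesis by simp
qed

lemma pred_dig [measurable]: "Measurable.pred borel (\<lambda>x. P (dig b K x))"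
  by (rule measurable_compose[OF measurable_dig]) simp

lemma measurable_if_dig [measurable (raw)]:
  fixes F :: "real \<Rightarrow> 'c::{banach, second_countable_topology}"
  assumes "F \<in> borel_measurable borel"
  shows "(\<lambda>x. if P (dig b K x) then F x else 0) \<in> borel_measurable borel"
  using assms pred_dig[of P b K] by (intro measurable_If) (auto simp: pred_def)

lemma measurable_if_dig2 [measurable (raw)]:
  fixes F :: "real \<Rightarrow> 'c::{banach, second_countable_topology}"
  assumes "F \<in> borel_measurable borel"
  shows "(\<lambda>x. if P (dig b K x) \<and> P' (dig b K' x) then F x else 0) \<in> borel_measurable borel"
  using assms pred_dig[of P b K] pred_dig[of P' b K'] by (intro measurable_If) (auto simp: pred_def sets.sets_Collect_conj)

section \<open>Conditional transforms given past digits, as a martingale in the length of the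
  past\<close>

context digit_system
begin

text \<open>Up to the factor \<open>pr K i\<close>, this is the Fourier transform of the law of the
  future point \<open>frac (b ^ K * x)\<close> conditioned on the first \<open>K\<close> digits.
  Leaving it unnormalised makes null cells contribute 0 and lets cells be added.\<close>

definition cell_ft :: "nat \<Rightarrow> nat \<Rightarrow> real \<Rightarrow> complex" where
  "cell_ft K i \<omega> = (\<integral>x. (if dig b K x = i then ee (\<omega> * frac (real b ^ K * x)) else 0) \<partial>N)"

lemma integrable_cell_ft: "integrable N (\<lambda>x. if dig b K x = i then ee (\<omega> * frac (real b ^ K * x)) else 0)"
  by (rule integrable_bounded[where C = 1], rule measurable_if_dig) auto

lemma integral_if_dig: "(\<integral>x. (if dig b K x = i then C else 0) \<partial>N) = C * pr K i" for C :: real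
proof -
  have "(\<integral>x. (if dig b K x = i then C else 0) \<partial>N) = (\<integral>x. C * indicator {x. dig b K x = i} x \<partial>N)"
    by (intro Bochner_Integration.integral_cong) (auto simp: indicator_def)
  then show ?thesis by (simp add: pr_def)
qed

lemma norm_integral_if_dig_le:
  fixes F :: "real \<Rightarrow> complex"
  assumes [measurable]: "F \<in> borel_measurable borel" and "\<And>x. dig b K x = i \<Longrightarrow> norm (F x) \<le> C"
  shows "norm (\<integral>x. (if dig b K x = i then F x else 0) \<partial>N) \<le> C * pr K i"
proof (cases "\<exists>x. dig b K x = i")
  case True
  then have C: "0 \<le> C" using assms(2) norm_ge_zero order_trans by blast
  have "norm (\<integral>x. (if dig b K x = i then F x else 0) \<partial>N) \<le> (\<integral>x. norm (if dig b K x = i then F x else 0) \<partial>N)"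
    by (rule integral_norm_bound)
  also have "\<dots> \<le> (\<integral>x. (if dig b K x = i then C else 0) \<partial>N)"
    by (intro integral_mono integrable_bounded[where C = C]) (use C assms(2) in auto)
  finally show ?thesis by (simp add: integral_if_dig)
next
  case False then show ?thesis by (simp add: pr_def)
qed

lemma norm_cell_ft_le: "norm (cell_ft K i \<omega>) \<le> pr K i"
  using norm_integral_if_dig_le[of "\<lambda>x. ee (\<omega> * frac (real b ^ K * x))" K i 1] by (simp add: cell_ft_def)

lemma norm_cell_ft_diff_le: "norm (cell_ft K i \<omega> - cell_ft K i \<omega>') \<le> 2 * pi * \<bar>\<omega> - \<omega>'\<bar> * pr K i"
proof -
  let ?F = "\<lambda>\<omega> x. ee (\<omega> * frac (real b ^ K * x))"
  have "cell_ft K i \<omega> - cell_ft K i \<omega>' = (\<integral>x. (if dig b K x = i then ?F \<omega> x else 0) - (if dig b K x = i then ?F \<omega>' x else 0) \<partial>N)"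
    unfolding cell_ft_def by (intro Bochner_Integration.integral_diff[symmetric] integrable_cell_ft)
  also have "\<dots> = (\<integral>x. (if dig b K x = i then ?F \<omega> x - ?F \<omega>' x else 0) \<partial>N)"
    by (intro Bochner_Integration.integral_cong) auto
  also have "norm \<dots> \<le> 2 * pi * \<bar>\<omega> - \<omega>'\<bar> * pr K i"
  proof (rule norm_integral_if_dig_le)
    fix x
    have "norm (?F \<omega> x - ?F \<omega>' x) \<le> 2 * pi * \<bar>\<omega> * frac (real b ^ K * x) - \<omega>' * frac (real b ^ K * x)\<bar>"
      by (rule norm_ee_diff_le)
    also have "\<bar>\<omega> * frac (real b ^ K * x) - \<omega>' * frac (real b ^ K * x)\<bar> = \<bar>\<omega> - \<omega>'\<bar> * frac (real b ^ K * x)"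
      by (simp add: abs_mult flip: left_diff_distrib)
    also have "\<dots> \<le> \<bar>\<omega> - \<omega>'\<bar>" using frac_lt_1[of "real b ^ K * x"] by (intro mult_left_le) auto
    finally show "norm (?F \<omega> x - ?F \<omega>' x) \<le> 2 * pi * \<bar>\<omega> - \<omega>'\<bar>" by simp
  qed measurable
  finally show ?thesis .
qed

lemma norm_cell_ft_minus: "norm (cell_ft K i (- \<omega>)) = norm (cell_ft K i \<omega>)"
proof -
  have "cell_ft K i (- \<omega>) = (\<integral>x. cnj (if dig b K x = i then ee (\<omega> * frac (real b ^ K * x)) else 0) \<partial>N)"
    unfolding cell_ft_def by (intro Bochner_Integration.integral_cong) (auto simp: ee_minus)
  then show ?thesis by (simp add: cell_ft_def)
qed

lemma norm_cell_ft_abs: "norm (cell_ft K i \<bar>\<omega>\<bar>) = norm (cell_ft K i \<omega>)"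
  by (simp add: abs_if norm_cell_ft_minus)

lemma dig_suffix: "L \<le> K \<Longrightarrow> dig b K x mod b ^ L = dig b L (real b ^ (K - L) * x)"
  using dig_add_mod[of b "K - L" L x] by simp

text \<open>By invariance \<open>x\<close> may be shifted by \<open>K - L\<close> digits, after
  which its first \<open>L\<close> digits are the last \<open>L\<close> of the original
  \<open>K\<close>; the sum runs over the digits before them. Lengthening the past thus means
  prepending digits, and a short past is a suffix.\<close>

lemma suffix_sum:
  fixes F :: "real \<Rightarrow> 'c::{banach, second_countable_topology}"
  assumes "L \<le> K" "z < b ^ L" and [measurable]: "F \<in> borel_measurable borel" and bd: "\<And>x. norm (F x) \<le> C"
  shows "(\<integral>x. (if dig b L x = z then F x else 0) \<partial>N) =
    (\<Sum>i<b^(K-L). \<integral>x. (if dig b K x = i * b ^ L + z then F (frac (real b ^ (K - L) * x)) else 0) \<partial>N)"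
proof -
  let ?G = "\<lambda>x. if dig b L x = z then F x else 0"
  have "(\<integral>x. ?G x \<partial>N) = (\<integral>x. ?G (frac (real b ^ (K - L) * x)) \<partial>N)"
    by (rule integral_shift[symmetric]) measurable
  also have "\<dots> = (\<integral>x. (\<Sum>i<b^(K-L). if dig b K x = i * b ^ L + z then F (frac (real b ^ (K - L) * x)) else 0) \<partial>N)"
  proof (rule Bochner_Integration.integral_cong[OF refl])
    fix x
    have iff: "dig b K x = i * b ^ L + z \<longleftrightarrow> dig b L (real b ^ (K - L) * x) = z \<and> i = dig b (K - L) x" for i
    proof
      assume h: "dig b K x = i * b ^ L + z"
      have "dig b K x mod b ^ L = z" "dig b K x div b ^ L = i" using h assms(2) by simp_all
      then show "dig b L (real b ^ (K - L) * x) = z \<and> i = dig b (K - L) x"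
        using dig_add_div[of b "K - L" L x] dig_add_mod[of b "K - L" L x] assms(1) by simp
    qed (use dig_add[of b "K - L" L x] assms(1) in auto)
    have "(\<Sum>i<b^(K-L). if dig b K x = i * b ^ L + z then F (frac (real b ^ (K - L) * x)) else 0) =
       (\<Sum>i<b^(K-L). if i = dig b (K - L) x then (if dig b L (real b ^ (K - L) * x) = z then F (frac (real b ^ (K - L) * x)) else 0) else 0)"
      by (intro sum.cong) (auto simp: iff)
    also have "\<dots> = ?G (frac (real b ^ (K - L) * x))"
      by (simp add: dig_less)
    finally show "?G (frac (real b ^ (K - L) * x)) = (\<Sum>i<b^(K-L). if dig b K x = i * b ^ L + z then F (frac (real b ^ (K - L) * x)) else 0)" ..
  qed
  also have "\<dots> = (\<Sum>i<b^(K-L). \<integral>x. (if dig b K x = i * b ^ L + z then F (frac (real b ^ (K - L) * x)) else 0) \<partial>N)"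
  proof (intro Bochner_Integration.integral_sum integrable_bounded[where C = C])
    have "0 \<le> C" using bd[of 0] norm_ge_zero order_trans by blast
    then show "norm (if dig b K x = i * b ^ L + z then F (frac (real b ^ (K - L) * x)) else 0) \<le> C" for i x
      using bd by simp
  qed measurable
  finally show ?thesis .
qed

lemma pr_suffix_sum:
  assumes "L \<le> K" "z < b ^ L"
  shows "pr L z = (\<Sum>i<b^(K-L). pr K (i * b ^ L + z))"
  using suffix_sum[OF assms, of "\<lambda>_. 1::real" 1] integral_if_dig[of _ _ 1] by simp

lemma cell_ft_suffix_sum:
  assumes "L \<le> K" "z < b ^ L"
  shows "cell_ft L z \<omega> = (\<Sum>i<b^(K-L). cell_ft K (i * b ^ L + z) \<omega>)"
proof -
  have "frac (real b ^ L * frac (real b ^ (K - L) * x)) = frac (real b ^ K * x)" for x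
    using assms by (simp add: frac_pow_mult_frac mult.assoc[symmetric] flip: power_add)
  then show ?thesis
    unfolding cell_ft_def by (subst suffix_sum[OF assms, of "\<lambda>x. ee (\<omega> * frac (real b ^ L * x))" 1]) (simp_all cong: if_cong)
qed

text \<open>Measures, weighted by the mass of the cell, how far the conditional transform given
  \<open>K\<close> past digits is from the one given only the most recent \<open>L\<close>.\<close>

definition deviation :: "nat \<Rightarrow> nat \<Rightarrow> real \<Rightarrow> nat \<Rightarrow> real" where
  "deviation L K \<omega> i = norm (cell_ft K i \<omega> - pr K i * (cell_ft L (i mod b^L) \<omega> / pr L (i mod b^L)))"

text \<open>Quotients by \<open>pr K i = 0\<close> are \<open>0\<close>, which is the correct contribution of a null cell.\<close>
definition energy :: "nat \<Rightarrow> real \<Rightarrow> real" where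
  "energy K \<omega> = (\<Sum>i<b^K. (norm (cell_ft K i \<omega>))\<^sup>2 / pr K i)"

text \<open>Pythagoras for a martingale: at fixed \<omega> the conditional transform given
  \<open>L\<close> digits is the average of those given \<open>K\<close> digits with the same
  suffix, and \<open>energy\<close> is the second moment.\<close>

lemma energy_diff:
  assumes "L \<le> K"
  shows "(\<Sum>i<b^K. (deviation L K \<omega> i)\<^sup>2 / pr K i) = energy K \<omega> - energy L \<omega>"
proof -
  have reidx: "(\<Sum>i<b^K. f i) = (\<Sum>z<b^L. \<Sum>i<b^(K-L). f (i * b^L + z))" for f :: "nat \<Rightarrow> real"
  proof -
    have "(\<Sum>i<b^K. f i) = (\<Sum>i<b^((K-L)+L). f (i div b^L * b^L + i mod b^L))"
      using assms by (simp add: div_mult_mod_eq)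
    also have "\<dots> = (\<Sum>i<b^(K-L). \<Sum>z<b^L. f (i * b^L + z))"
      by (rule sum_mixed_radix) simp
    also have "\<dots> = (\<Sum>z<b^L. \<Sum>i<b^(K-L). f (i * b^L + z))"
      by (rule sum.swap)
    finally show ?thesis .
  qed
  have "(\<Sum>i<b^K. (deviation L K \<omega> i)\<^sup>2 / pr K i) =
    (\<Sum>z<b^L. \<Sum>i<b^(K-L). (norm (cell_ft K (i * b^L + z) \<omega> - pr K (i * b^L + z) * (cell_ft L z \<omega> / pr L z)))\<^sup>2 / pr K (i * b^L + z))"
    unfolding reidx deviation_def by (intro sum.cong refl) simp
  also have "\<dots> = (\<Sum>z<b^L. (\<Sum>i<b^(K-L). (norm (cell_ft K (i * b^L + z) \<omega>))\<^sup>2 / pr K (i * b^L + z)) - (norm (cell_ft L z \<omega>))\<^sup>2 / pr L z)"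
  proof (intro sum.cong refl)
    fix z assume "z \<in> {..<b^L}"
    then have z: "z < b ^ L" by simp
    show "(\<Sum>i<b^(K-L). (norm (cell_ft K (i * b^L + z) \<omega> - pr K (i * b^L + z) * (cell_ft L z \<omega> / pr L z)))\<^sup>2 / pr K (i * b^L + z)) =
      (\<Sum>i<b^(K-L). (norm (cell_ft K (i * b^L + z) \<omega>))\<^sup>2 / pr K (i * b^L + z)) - (norm (cell_ft L z \<omega>))\<^sup>2 / pr L z"
      unfolding cell_ft_suffix_sum[OF assms z] pr_suffix_sum[OF assms z]
      by (rule sum_norm_square_deviation) (auto simp: norm_cell_ft_le)
  qed
  also have "\<dots> = energy K \<omega> - energy L \<omega>"
    unfolding energy_def by (simp only: sum_subtractf reidx)
  finally show ?thesis .
qed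

lemma energy_mono: "L \<le> K \<Longrightarrow> energy L \<omega> \<le> energy K \<omega>"
proof -
  assume "L \<le> K"
  have "0 \<le> (\<Sum>i<b^K. (deviation L K \<omega> i)\<^sup>2 / pr K i)"
    by (intro sum_nonneg divide_nonneg_nonneg) auto
  then show ?thesis using energy_diff[OF \<open>L \<le> K\<close>, of \<omega>] by simp
qed

lemma energy_le_1: "energy K \<omega> \<le> 1"
proof -
  have "energy K \<omega> \<le> (\<Sum>i<b^K. pr K i)"
    unfolding energy_def
  proof (rule sum_mono)
    fix i
    have "(norm (cell_ft K i \<omega>))\<^sup>2 \<le> (pr K i)\<^sup>2" using norm_cell_ft_le by (intro power_mono) auto
    then show "(norm (cell_ft K i \<omega>))\<^sup>2 / pr K i \<le> pr K i"
      by (cases "pr K i = 0") (auto simp: power2_eq_square divide_le_eq less_le)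
  qed
  then show ?thesis by (simp add: sum_pr)
qed

text \<open>Passes from a second moment to a first moment by
  \<open>t \<le> s * p + t\<^sup>2 / (p * s)\<close>, with \<open>s\<close> left free.\<close>

lemma norm_deviation_le:
  assumes "L \<le> K" "0 < s"
  shows "(\<Sum>i<b^K. deviation L K \<omega> i) \<le> s + (energy K \<omega> - energy L \<omega>) / s"
proof -
  let ?d = "deviation L K \<omega>"
  have "(\<Sum>i<b^K. ?d i) \<le> (\<Sum>i<b^K. s * pr K i + ((?d i)\<^sup>2 / pr K i) / s)"
  proof (rule sum_mono)
    fix i
    show "?d i \<le> s * pr K i + ((?d i)\<^sup>2 / pr K i) / s"
    proof (cases "pr K i = 0")
      case True then show ?thesis using norm_cell_ft_le[of K i \<omega>] by (simp add: deviation_def)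
    next
      case False
      then have p: "0 < pr K i" using pr_nonneg[of K i] by linarith
      have "0 \<le> (s * pr K i - ?d i)\<^sup>2" by simp
      then have "?d i * (s * pr K i) * 2 \<le> (s * pr K i)\<^sup>2 + (?d i)\<^sup>2"
        by (simp add: power2_diff algebra_simps)
      moreover have "0 \<le> ?d i * (s * pr K i)" using p assms by (simp add: deviation_def)
      ultimately have "?d i * (s * pr K i) \<le> (s * pr K i)\<^sup>2 + (?d i)\<^sup>2" by linarith
      then have "?d i \<le> ((s * pr K i)\<^sup>2 + (?d i)\<^sup>2) / (s * pr K i)"
        using p assms by (simp add: le_divide_eq)
      also have "\<dots> = s * pr K i + ((?d i)\<^sup>2 / pr K i) / s"
        using p assms by (simp add: add_divide_distrib power2_eq_square)
      finally show ?thesis .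
    qed
  qed
  also have "\<dots> = s + (energy K \<omega> - energy L \<omega>) / s"
    by (simp only: sum.distrib sum_distrib_left[symmetric] sum_divide_distrib[symmetric] sum_pr energy_diff[OF assms(1)] mult_1_right)
  finally show ?thesis .
qed

text \<open>\<open>energy\<close> increases with the length of the past and is at most 1, hence
  Cauchy, so its growth beyond \<open>L1\<close> is small for all \<open>K\<close> at once.
  Uniformity in \<open>K\<close> is essential, as \<open>K\<close> will grow with the number of
  times averaged while \<open>L\<close> stays fixed.\<close>

lemma conditional_fourier_approx:
  assumes "finite \<Gamma>" "0 < \<eta>"
  obtains L1 where "\<And>L K \<omega>. L1 \<le> L \<Longrightarrow> L \<le> K \<Longrightarrow> \<omega> \<in> \<Gamma> \<Longrightarrow>
    (\<Sum>i<b^K. deviation L K \<omega> i) \<le> \<eta>"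
proof -
  have conv: "Cauchy (\<lambda>K. energy K \<omega>)" for \<omega>
  proof -
    have "incseq (\<lambda>K. energy K \<omega>)" by (auto simp: incseq_def energy_mono)
    then obtain l where "(\<lambda>K. energy K \<omega>) \<longlonglongrightarrow> l"
      by (rule incseq_convergent[of _ 1]) (use energy_le_1 in auto)
    then show ?thesis by (rule LIMSEQ_imp_Cauchy)
  qed
  have "0 < (\<eta>/2)\<^sup>2" using assms by simp
  then have "\<forall>\<omega>\<in>\<Gamma>. \<exists>L1. \<forall>L\<ge>L1. \<forall>K\<ge>L1. dist (energy L \<omega>) (energy K \<omega>) < (\<eta>/2)\<^sup>2"
    using conv unfolding Cauchy_def by blast
  from bchoice[OF this] obtain L1 where
    L1: "\<And>\<omega> L K. \<omega> \<in> \<Gamma> \<Longrightarrow> L1 \<omega> \<le> L \<Longrightarrow> L1 \<omega> \<le> K \<Longrightarrow> dist (energy L \<omega>) (energy K \<omega>) < (\<eta>/2)\<^sup>2"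
    by blast
  show thesis
  proof (rule that[of "Max (insert 0 (L1 ` \<Gamma>))"])
    fix L K \<omega> assume h: "Max (insert 0 (L1 ` \<Gamma>)) \<le> L" "L \<le> K" "\<omega> \<in> \<Gamma>"
    then have "L1 \<omega> \<le> L" using assms(1) by auto
    then have "energy K \<omega> - energy L \<omega> \<le> (\<eta>/2)\<^sup>2"
      using L1[OF h(3), of L K] h by (simp add: dist_real_def)
    then have "(energy K \<omega> - energy L \<omega>) / (\<eta>/2) \<le> (\<eta>/2)\<^sup>2 / (\<eta>/2)" using assms by (intro divide_right_mono) auto
    also have "\<dots> = \<eta>/2" using assms by (simp add: power2_eq_square)
    finally show "(\<Sum>i<b^K. deviation L K \<omega> i) \<le> \<eta>"
      using norm_deviation_le[OF h(2), of "\<eta>/2" \<omega>] assms by linarith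
  qed
qed

text \<open>Conditionally on the first \<open>L\<close> digits, the following \<open>l\<close>
  digits have mass at most \<open>\<tau>\<^sup>2\<close>: a Frostman-type bound at scale
  \<open>b ^ - l\<close> for the conditional measure.\<close>

definition good :: "real \<Rightarrow> nat \<Rightarrow> nat \<Rightarrow> nat \<Rightarrow> bool" where
  "good \<tau> L l i \<longleftrightarrow> pr (L + l) i \<le> \<tau>\<^sup>2 * pr L (i div b ^ l)"

definition good_ft :: "real \<Rightarrow> nat \<Rightarrow> nat \<Rightarrow> nat \<Rightarrow> real \<Rightarrow> complex" where
  "good_ft \<tau> L l z \<omega> = (\<integral>x. (if dig b L x = z \<and> good \<tau> L l (dig b (L + l) x) then ee (\<omega> * frac (real b ^ L * x)) else 0) \<partial>N)"

lemma integrable_good_ft: "integrable N (\<lambda>x. if dig b L x = z \<and> good \<tau> L l (dig b (L + l) x) then ee (\<omega> * frac (real b ^ L * x)) else 0)"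
  by (rule integrable_bounded[where C = 1], rule measurable_if_dig2) auto

lemma norm_good_ft_le: "norm (good_ft \<tau> L l z \<omega>) \<le> pr L z"
proof -
  have "good_ft \<tau> L l z \<omega> = (\<integral>x. (if dig b L x = z then (if good \<tau> L l (dig b (L + l) x) then ee (\<omega> * frac (real b ^ L * x)) else 0) else 0) \<partial>N)"
    unfolding good_ft_def by (intro Bochner_Integration.integral_cong) auto
  also have "norm \<dots> \<le> 1 * pr L z"
    by (rule norm_integral_if_dig_le, rule measurable_if_dig) auto
  finally show ?thesis by simp
qed

lemma norm_cell_ft_le_good_ft: "norm (cell_ft L z \<omega>) \<le> norm (good_ft \<tau> L l z \<omega>) + measure N {x. dig b L x = z \<and> \<not> good \<tau> L l (dig b (L + l) x)}"
proof -
  define E where "E = {x. dig b L x = z \<and> \<not> good \<tau> L l (dig b (L + l) x)}"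
  have [measurable]: "E \<in> sets N" unfolding E_def by measurable
  have "cell_ft L z \<omega> - good_ft \<tau> L l z \<omega> = (\<integral>x. (if dig b L x = z then ee (\<omega> * frac (real b ^ L * x)) else 0) -
      (if dig b L x = z \<and> good \<tau> L l (dig b (L + l) x) then ee (\<omega> * frac (real b ^ L * x)) else 0) \<partial>N)"
    unfolding cell_ft_def good_ft_def by (intro Bochner_Integration.integral_diff[symmetric] integrable_cell_ft integrable_good_ft)
  also have "\<dots> = (\<integral>x. (if x \<in> E then ee (\<omega> * frac (real b ^ L * x)) else 0) \<partial>N)"
    by (intro Bochner_Integration.integral_cong refl) (auto simp: E_def)
  also have "norm \<dots> \<le> (\<integral>x. norm (if x \<in> E then ee (\<omega> * frac (real b ^ L * x)) else 0) \<partial>N)"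
    by (rule integral_norm_bound)
  also have "\<dots> = (\<integral>x. indicator E x \<partial>N)"
    by (intro Bochner_Integration.integral_cong) (simp_all add: indicator_def)
  also have "\<dots> = measure N E" by simp
  finally show ?thesis using norm_triangle_sub[of "cell_ft L z \<omega>" "good_ft \<tau> L l z \<omega>"] unfolding E_def by linarith
qed

text \<open>Expanding the squares gives a double integral of geometric sums in
  \<open>\<theta> * (v x - v y)\<close>. These are at most \<open>M\<close>, and of size
  \<open>b ^ l / \<theta>\<close> over the gap when \<open>v x\<close> and \<open>v y\<close> lie in
  distant level-\<open>l\<close> cells. On the good set each such cell carries mass at most
  \<open>\<tau>\<^sup>2 * pr L z\<close>, and summing over gaps costs a harmonic number, hence the
  logarithmic factor.\<close>

lemma good_ft_energy:
  assumes \<theta>: "0 < \<theta>" "\<theta> \<le> 1/7" and z: "z < b ^ L"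
  shows "(\<Sum>i<M. (norm (good_ft \<tau> L l z (real i * \<theta>)))\<^sup>2) \<le>
    \<tau>\<^sup>2 * (pr L z)\<^sup>2 * (3 * real M + 2 * real b ^ l / \<theta> * (1 + real l * ln (real b)))"
proof -
  define A where "A = {x. dig b L x = z \<and> good \<tau> L l (dig b (L + l) x)}"
  have [measurable]: "A \<in> sets borel" "A \<in> sets N" unfolding A_def by measurable
  define v where "v x = frac (real b ^ L * x)" for x
  have [measurable]: "v \<in> borel_measurable borel" unfolding v_def by measurable
  define F where "F i x = indicator A x * ee (real i * \<theta> * v x)" for i x
  define Q where "Q i = good_ft \<tau> L l z (real i * \<theta>)" for i
  have [measurable]: "F i \<in> borel_measurable borel" for i unfolding F_def by measurable
  have F1: "norm (F i x) \<le> 1" for i x by (simp add: F_def indicator_def norm_mult)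
  have intF: "integrable N (F i)" for i using F1 by (intro integrable_bounded) measurable
  have QF: "Q i = (\<integral>x. F i x \<partial>N)" for i
    unfolding Q_def good_ft_def F_def A_def v_def by (intro Bochner_Integration.integral_cong) (auto simp: indicator_def)
  define c where "c x = dig b l (real b ^ L * x)" for x
  \<comment> \<open>In equal or adjacent cells two points may be arbitrarily close, so only the
    trivial bound \<open>M\<close> is available there. Otherwise the distance of the points is at
    least the index difference minus 1, in units of \<open>b ^ - l\<close>.\<close>
  define W where "W k k' = (if k \<le> k' + 1 \<and> k' \<le> k + 1 then real M else (real b ^ l / \<theta>) / (\<bar>real k - real k'\<bar> - 1))" for k k' :: nat
  define S where "S = 3 * real M + 2 * real b ^ l / \<theta> * (1 + real l * ln (real b))"
  have Wnn: "0 \<le> W k k'" for k k' using \<theta> by (auto simp: W_def intro!: divide_nonneg_nonneg)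
  have W: "norm (\<Sum>i<M. ee (real i * \<theta> * (v x - v y))) \<le> W (c x) (c y)" for x y
  proof (cases "c x \<le> c y + 1 \<and> c y \<le> c x + 1")
    case True
    then show ?thesis using norm_sum[of "\<lambda>i. ee (real i * \<theta> * (v x - v y))" "{..<M}"] by (simp add: W_def)
  next
    case False
    have vc: "real (c x) / real b ^ l \<le> v x \<and> v x < (real (c x) + 1) / real b ^ l" for x
    proof -
      have "v x = (real (c x) + frac (real b ^ l * (real b ^ L * x))) / real b ^ l"
        unfolding v_def c_def by (rule frac_eq_dig) simp
      then show ?thesis
        using frac_ge_0[of "real b ^ l * (real b ^ L * x)"] frac_lt_1[of "real b ^ l * (real b ^ L * x)"]
        by (auto intro!: divide_right_mono divide_strict_right_mono)
    qed
    have far: "1 < \<bar>real (c x) - real (c y)\<bar>" using False by auto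
    have dist: "(\<bar>real (c x) - real (c y)\<bar> - 1) / real b ^ l \<le> \<bar>v x - v y\<bar>"
    proof -
      have "real (c x) - real (c y) - 1 \<le> real b ^ l * (v x - v y)" "real (c y) - real (c x) - 1 \<le> real b ^ l * (v y - v x)"
        using vc[of x] vc[of y] by (simp_all add: field_simps)
      moreover have "real b ^ l * (v x - v y) \<le> real b ^ l * \<bar>v x - v y\<bar>" "real b ^ l * (v y - v x) \<le> real b ^ l * \<bar>v x - v y\<bar>"
        by (intro mult_left_mono; simp)+
      ultimately have "\<bar>real (c x) - real (c y)\<bar> - 1 \<le> real b ^ l * \<bar>v x - v y\<bar>" by linarith
      then show ?thesis by (simp add: field_simps)
    qed
    have pos: "0 < (\<bar>real (c x) - real (c y)\<bar> - 1) / real b ^ l" using far by simp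
    have "\<bar>v x - v y\<bar> \<le> 1" unfolding v_def using frac_ge_0[of "real b ^ L * x"] frac_lt_1[of "real b ^ L * x"] frac_ge_0[of "real b ^ L * y"] frac_lt_1[of "real b ^ L * y"] by linarith
    moreover have "v x - v y \<noteq> 0" using dist pos by auto
    ultimately have "norm (\<Sum>i<M. ee (real i * \<theta> * (v x - v y))) \<le> 1 / (\<theta> * \<bar>v x - v y\<bar>)"
      by (intro norm_sum_ee_le \<theta>)
    also have "\<dots> \<le> 1 / (\<theta> * ((\<bar>real (c x) - real (c y)\<bar> - 1) / real b ^ l))"
      using dist pos \<theta> by (intro frac_le mult_left_mono mult_pos_pos) auto
    also have "\<dots> = W (c x) (c y)" unfolding W_def using False by auto
    finally show ?thesis .
  qed
  have inner: "(\<integral>y. indicator A y * W k (c y) \<partial>N) \<le> \<tau>\<^sup>2 * pr L z * S" if "k < b ^ l" for k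
  proof -
    let ?h = "\<lambda>i. if i div b ^ l = z \<and> good \<tau> L l i then W k (i mod b ^ l) else 0"
    have "(\<integral>y. indicator A y * W k (c y) \<partial>N) = (\<integral>y. ?h (dig b (L + l) y) \<partial>N)"
      by (intro Bochner_Integration.integral_cong) (auto simp: A_def c_def dig_add_div dig_add_mod indicator_def)
    also have "\<dots> = (\<Sum>i<b^(L+l). pr (L + l) i * ?h i)" by (rule integral_dig)
    also have "\<dots> \<le> (\<Sum>i<b^(L+l). (if i div b ^ l = z then 1 else 0) * (\<tau>\<^sup>2 * pr L z * W k (i mod b ^ l)))"
      using Wnn by (intro sum_mono) (auto simp: good_def intro!: mult_right_mono mult_nonneg_nonneg)
    also have "\<dots> = (\<Sum>i<b^L. if i = z then 1 else 0) * (\<Sum>i<b^l. \<tau>\<^sup>2 * pr L z * W k i)"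
      by (rule sum_mixed_radix_product) simp
    also have "(\<Sum>i<b^L. if i = z then 1 else 0 :: real) = 1" using z by simp
    also have "1 * (\<Sum>i<b^l. \<tau>\<^sup>2 * pr L z * W k i) = \<tau>\<^sup>2 * pr L z * (\<Sum>i<b^l. W k i)"
      by (simp add: sum_distrib_left)
    also have "\<dots> \<le> \<tau>\<^sup>2 * pr L z * S"
    proof (intro mult_left_mono)
      have "(\<Sum>i<b^l. W k i) \<le> 3 * real M + 2 * (real b ^ l / \<theta>) * harm (b ^ l)"
        unfolding W_def using that \<theta> by (intro sum_kernel_le) auto
      also have "harm (b ^ l) \<le> 1 + ln (real (b ^ l))" by (rule harm_le_ln) (use b2 in simp)
      then have "3 * real M + 2 * (real b ^ l / \<theta>) * harm (b ^ l) \<le> S"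
        unfolding S_def using \<theta> by (auto simp: ln_realpow intro!: divide_right_mono mult_left_mono)
      finally show "(\<Sum>i<b^l. W k i) \<le> S" .
    qed auto
    finally show ?thesis .
  qed
  define H where "H x = (\<Sum>i<M. F i x * cnj (Q i))" for x
  have H: "norm (H x) \<le> indicator A x * (\<tau>\<^sup>2 * pr L z * S)" for x
  proof -
    have "H x = (\<Sum>i<M. \<integral>y. F i x * cnj (F i y) \<partial>N)"
      unfolding H_def QF using intF by simp
    also have "\<dots> = (\<integral>y. (\<Sum>i<M. F i x * cnj (F i y)) \<partial>N)"
      using intF by (intro Bochner_Integration.integral_sum[symmetric]) auto
    also have "\<dots> = (\<integral>y. indicator A x * indicator A y * (\<Sum>i<M. ee (real i * \<theta> * (v x - v y))) \<partial>N)"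
    proof (rule Bochner_Integration.integral_cong[OF refl])
      fix y
      have "F i x * cnj (F i y) = indicator A x * indicator A y * ee (real i * \<theta> * (v x - v y))" for i
      proof -
        have "ee (real i * \<theta> * (v x - v y)) = ee (real i * \<theta> * v x) * cnj (ee (real i * \<theta> * v y))"
          by (simp add: right_diff_distrib ee_add[of _ "- _", simplified] ee_minus)
        then show ?thesis by (simp add: F_def indicator_def)
      qed
      then show "(\<Sum>i<M. F i x * cnj (F i y)) = indicator A x * indicator A y * (\<Sum>i<M. ee (real i * \<theta> * (v x - v y)))"
        by (simp add: sum_distrib_left)
    qed
    also have "norm \<dots> \<le> (\<integral>y. norm (indicator A x * indicator A y * (\<Sum>i<M. ee (real i * \<theta> * (v x - v y)))) \<partial>N)"
      by (rule integral_norm_bound)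
    also have "\<dots> \<le> (\<integral>y. indicator A x * (indicator A y * W (c x) (c y)) \<partial>N)"
    proof (rule integral_mono)
      show "integrable N (\<lambda>y. norm (indicator A x * indicator A y * (\<Sum>i<M. ee (real i * \<theta> * (v x - v y)))))"
      proof (rule integrable_bounded[where C = "real M"])
        fix y
        have "norm (\<Sum>i<M. ee (real i * \<theta> * (v x - v y))) \<le> real M"
          using norm_sum[of "\<lambda>i. ee (real i * \<theta> * (v x - v y))" "{..<M}"] by simp
        then show "norm (norm (indicator A x * indicator A y * (\<Sum>i<M. ee (real i * \<theta> * (v x - v y))))) \<le> real M"
          by (simp add: norm_mult indicator_def)
      qed measurable
      let ?h = "\<lambda>i. indicator A x * ((if i div b ^ l = z \<and> good \<tau> L l i then 1 else 0) * W (c x) (i mod b ^ l))"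
      have "(\<lambda>y. indicator A x * (indicator A y * W (c x) (c y))) = (\<lambda>y. ?h (dig b (L + l) y))"
        by (auto simp: A_def c_def dig_add_div dig_add_mod indicator_def)
      then show "integrable N (\<lambda>y. indicator A x * (indicator A y * W (c x) (c y)))"
        using integrable_dig[of ?h "L + l"] by simp
      show "norm (indicator A x * indicator A y * (\<Sum>i<M. ee (real i * \<theta> * (v x - v y)))) \<le> indicator A x * (indicator A y * W (c x) (c y))" for y
        using W[of x y] by (simp add: norm_mult indicator_def)
    qed
    also have "\<dots> = indicator A x * (\<integral>y. indicator A y * W (c x) (c y) \<partial>N)" by simp
    also have "\<dots> \<le> indicator A x * (\<tau>\<^sup>2 * pr L z * S)"
      using inner[of "c x"] dig_less[of b l] by (intro mult_left_mono) (auto simp: c_def)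
    finally show ?thesis .
  qed
  have "complex_of_real (\<Sum>i<M. (norm (Q i))\<^sup>2) = (\<Sum>i<M. Q i * cnj (Q i))"
    by (simp add: complex_norm_square del: of_real_power)
  also have "\<dots> = (\<Sum>i<M. \<integral>x. F i x * cnj (Q i) \<partial>N)" using intF by (simp add: QF[symmetric])
  also have "\<dots> = (\<integral>x. H x \<partial>N)"
    unfolding H_def using intF by (intro Bochner_Integration.integral_sum[symmetric]) auto
  finally have "\<bar>\<Sum>i<M. (norm (Q i))\<^sup>2\<bar> = norm (\<integral>x. H x \<partial>N)" by (metis norm_of_real)
  also have "\<dots> \<le> (\<integral>x. norm (H x) \<partial>N)" by (rule integral_norm_bound)
  also have "\<dots> \<le> (\<integral>x. indicator A x * (\<tau>\<^sup>2 * pr L z * S) \<partial>N)"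
    using intF H unfolding H_def by (intro integral_mono) (auto intro!: integrable_norm Bochner_Integration.integrable_sum integrable_real_indicator simp: emeasure_eq_measure)
  also have "\<dots> = measure N A * (\<tau>\<^sup>2 * pr L z * S)" by simp
  also have "\<dots> \<le> pr L z * (\<tau>\<^sup>2 * pr L z * S)"
  proof (rule mult_right_mono)
    show "measure N A \<le> pr L z" unfolding pr_def by (intro finite_measure_mono) (auto simp: A_def sets_N)
    have "0 \<le> S" unfolding S_def using \<theta> b2 by (auto intro!: add_nonneg_nonneg mult_nonneg_nonneg divide_nonneg_nonneg)
    then show "0 \<le> \<tau>\<^sup>2 * pr L z * S" by simp
  qed
  finally have "(\<Sum>i<M. (norm (Q i))\<^sup>2) \<le> pr L z * (\<tau>\<^sup>2 * pr L z * S)" by linarith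
  then show ?thesis by (simp add: Q_def S_def power2_eq_square algebra_simps)
qed

text \<open>On a cell the shifted point is \<open>y + h\<close>, where \<open>y\<close> is read off
  the last \<open>k\<close> of the \<open>K\<close> digits and \<open>h\<close> is
  \<open>b ^ - k\<close> times the future point. The linear term is therefore a conditional
  transform, and the remainder is of order \<open>b ^ (- 2 * k)\<close>. Any
  \<open>K \<ge> k\<close> is admissible, so many times can share one level.\<close>

lemma affine_cells:
  assumes g: "\<And>y h. 0 \<le> y \<Longrightarrow> 0 \<le> h \<Longrightarrow> y + h \<le> 1 \<Longrightarrow> \<bar>g (y + h) - g y - g' y * h\<bar> \<le> C * h\<^sup>2"
    and [measurable]: "g \<in> borel_measurable borel" and "k \<le> K" "0 \<le> C"
  shows "norm (\<integral>x. ee (A * g x) \<partial>N) \<le> (\<Sum>i<b^K. norm (cell_ft K i (A / real b ^ k * g' (real (i mod b ^ k) / real b ^ k))))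
     + 2 * pi * \<bar>A\<bar> * C / real b ^ (2 * k)"
proof -
  let ?m = "K - k"
  let ?y = "\<lambda>i. real (i mod b ^ k) / real b ^ k"
  let ?F = "\<lambda>x. ee (A * g (frac (real b ^ ?m * x)))"
  let ?B = "2 * pi * \<bar>A\<bar> * C / real b ^ (2 * k)"
  have "(\<integral>x. ee (A * g x) \<partial>N) = (\<integral>x. ?F x \<partial>N)"
    by (rule integral_shift[symmetric]) measurable
  also have "\<dots> = (\<integral>x. (\<Sum>i<b^K. if dig b K x = i then ?F x else 0) \<partial>N)"
    by (intro Bochner_Integration.integral_cong) (auto simp: dig_less)
  also have "\<dots> = (\<Sum>i<b^K. \<integral>x. (if dig b K x = i then ?F x else 0) \<partial>N)"
    by (intro Bochner_Integration.integral_sum integrable_bounded[where C = 1]) auto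
  finally have eq: "(\<integral>x. ee (A * g x) \<partial>N) = (\<Sum>i<b^K. \<integral>x. (if dig b K x = i then ?F x else 0) \<partial>N)" .
  have "norm (\<integral>x. ee (A * g x) \<partial>N) \<le> (\<Sum>i<b^K. norm (cell_ft K i (A / real b ^ k * g' (?y i))) + ?B * pr K i)"
    unfolding eq
  proof (rule order_trans[OF norm_sum], rule sum_mono)
    fix i
    let ?w = "A / real b ^ k * g' (?y i)"
    let ?G = "\<lambda>x. ee (A * g (?y i)) * ee (?w * frac (real b ^ K * x))"
    have d: "(\<integral>x. (if dig b K x = i then ?F x else 0) \<partial>N) - ee (A * g (?y i)) * cell_ft K i ?w =
      (\<integral>x. (if dig b K x = i then ?F x - ?G x else 0) \<partial>N)"
    proof -
      have 1: "ee (A * g (?y i)) * cell_ft K i ?w = (\<integral>x. ee (A * g (?y i)) * (if dig b K x = i then ee (?w * frac (real b ^ K * x)) else 0) \<partial>N)"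
        unfolding cell_ft_def using integrable_cell_ft by (intro integral_mult_right_zero[symmetric])
      have 2: "integrable N (\<lambda>x. if dig b K x = i then ?F x else 0)"
        by (rule integrable_bounded[where C = 1], rule measurable_if_dig) auto
      have "(\<integral>x. (if dig b K x = i then ?F x else 0) \<partial>N) -
          (\<integral>x. ee (A * g (?y i)) * (if dig b K x = i then ee (?w * frac (real b ^ K * x)) else 0) \<partial>N) =
          (\<integral>x. (if dig b K x = i then ?F x else 0) - ee (A * g (?y i)) * (if dig b K x = i then ee (?w * frac (real b ^ K * x)) else 0) \<partial>N)"
        by (intro Bochner_Integration.integral_diff[symmetric] integrable_mult_right integrable_cell_ft 2)
      also have "\<dots> = (\<integral>x. (if dig b K x = i then ?F x - ?G x else 0) \<partial>N)"
        by (intro Bochner_Integration.integral_cong) auto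
      finally show ?thesis unfolding 1 .
    qed
    have "norm (\<integral>x. (if dig b K x = i then ?F x - ?G x else 0) \<partial>N) \<le> ?B * pr K i"
    proof (rule norm_integral_if_dig_le)
      fix x assume x: "dig b K x = i"
      have dk: "dig b k (real b ^ ?m * x) = i mod b ^ k"
        using dig_suffix[OF \<open>k \<le> K\<close>, of x] x by simp
      have "real b ^ k * real b ^ ?m = real b ^ K" using \<open>k \<le> K\<close> by (simp flip: power_add)
      then have "real b ^ k * (real b ^ ?m * x) = real b ^ K * x" by (simp only: mult.assoc[symmetric])
      then have fr: "frac (real b ^ ?m * x) = ?y i + frac (real b ^ K * x) / real b ^ k"
        using frac_eq_dig[of b "real b ^ ?m * x" k] by (simp only: dk add_divide_distrib b_pos)
      define h where "h = frac (real b ^ K * x) / real b ^ k"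
      have h: "0 \<le> h" "h \<le> 1 / real b ^ k" unfolding h_def
        using frac_lt_1[of "real b ^ K * x"] by (simp_all add: divide_right_mono)
      have "?y i + h \<le> 1" using fr frac_lt_1[of "real b ^ ?m * x"] h_def by linarith
      then have "\<bar>g (?y i + h) - g (?y i) - g' (?y i) * h\<bar> \<le> C * h\<^sup>2" using h by (intro g) auto
      also have "\<dots> \<le> C * (1 / real b ^ k)\<^sup>2" using h \<open>0 \<le> C\<close> by (intro mult_left_mono power_mono) auto
      finally have gb: "\<bar>g (?y i + h) - g (?y i) - g' (?y i) * h\<bar> \<le> C / real b ^ (2 * k)"
        by (simp add: power_divide power_mult[symmetric] mult.commute)
      have "?G x = ee (A * g (?y i) + ?w * frac (real b ^ K * x))" by (simp only: ee_add)
      then have "norm (?F x - ?G x) \<le> 2 * pi * \<bar>A * g (?y i + h) - (A * g (?y i) + ?w * frac (real b ^ K * x))\<bar>"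
        unfolding fr h_def using norm_ee_diff_le by metis
      also have "A * g (?y i + h) - (A * g (?y i) + ?w * frac (real b ^ K * x)) = A * (g (?y i + h) - g (?y i) - g' (?y i) * h)"
        by (simp add: h_def algebra_simps)
      also have "2 * pi * \<bar>A * (g (?y i + h) - g (?y i) - g' (?y i) * h)\<bar> \<le> 2 * pi * (\<bar>A\<bar> * (C / real b ^ (2 * k)))"
        unfolding abs_mult using gb by (intro mult_left_mono) auto
      finally show "norm (?F x - ?G x) \<le> ?B" by simp
    qed measurable
    moreover have "norm (ee (A * g (?y i)) * cell_ft K i ?w) = norm (cell_ft K i ?w)" by (simp add: norm_mult)
    ultimately show "norm (\<integral>x. (if dig b K x = i then ?F x else 0) \<partial>N) \<le> norm (cell_ft K i ?w) + ?B * pr K i"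
      using d norm_triangle_sub[of "\<integral>x. (if dig b K x = i then ?F x else 0) \<partial>N" "ee (A * g (?y i)) * cell_ft K i ?w"] by simp
  qed
  also have "\<dots> = (\<Sum>i<b^K. norm (cell_ft K i (A / real b ^ k * g' (?y i)))) + ?B"
    by (simp only: sum.distrib sum_distrib_left[symmetric] sum_pr mult_1_right)
  finally show ?thesis .
qed

end

section \<open>Equidistribution\<close>

text \<open>Starting points filling a window of length \<open>q\<close> cover every residue class,
  so a whole initial segment is a union of progressions up to fewer than \<open>N0 + q\<close>
  terms, which are bounded trivially.\<close>

lemma cesaro_of_progressions:
  fixes c :: "nat \<Rightarrow> complex"
  assumes c: "\<And>n. norm (c n) \<le> 1"
    and prog: "\<And>\<delta>. 0 < \<delta> \<Longrightarrow> \<exists>N0 q J0. 0 < q \<and> (\<forall>J\<ge>J0. \<forall>n0\<in>{N0..<N0+q}. norm (\<Sum>j<J. c (n0 + j * q)) \<le> \<delta> * real J)"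
  shows "(\<lambda>n. (\<Sum>i<n. c i) / of_nat n) \<longlonglongrightarrow> 0"
proof (rule LIMSEQ_I)
  fix r :: real assume "0 < r"
  then have "0 < r / 2" by simp
  from prog[OF this] obtain N0 q J0 where q: "0 < q" and
    J0: "\<And>J n0. J0 \<le> J \<Longrightarrow> n0 \<in> {N0..<N0+q} \<Longrightarrow> norm (\<Sum>j<J. c (n0 + j * q)) \<le> r/2 * real J"
    by blast
  define N1 where "N1 = N0 + q * J0 + 1 + nat \<lceil>4 * (real N0 + real q) / r\<rceil>"
  show "\<exists>no. \<forall>n\<ge>no. norm ((\<Sum>i<n. c i) / of_nat n - 0) < r"
  proof (intro exI[of _ N1] allI impI)
    fix N assume N: "N1 \<le> N"
    define J where "J = (N - N0) div q"
    have "N0 + q * J0 \<le> N" using N unfolding N1_def by linarith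
    then have J: "J0 \<le> J" unfolding J_def using q by (simp add: less_eq_div_iff_mult_less_eq mult.commute)
    have le: "N0 + J * q \<le> N" "N < N0 + J * q + q"
    proof -
      have "J * q \<le> N - N0" unfolding J_def by simp
      then show "N0 + J * q \<le> N" using \<open>N0 + q * J0 \<le> N\<close> by linarith
      have "N - N0 < J * q + q" unfolding J_def using q
        by (metis add.commute div_mult_mod_eq mod_less_divisor nat_add_left_cancel_less)
      then show "N < N0 + J * q + q" by linarith
    qed
    have bd: "norm (\<Sum>i\<in>S. c i) \<le> real (card S)" for S
      using norm_sum[of c S] sum_mono[of S "\<lambda>i. norm (c i)" "\<lambda>_. 1"] c by fastforce
    have split: "(\<Sum>i<N. c i) = (\<Sum>i<N0. c i) + (\<Sum>i\<in>{N0..<N0+J*q}. c i) + (\<Sum>i\<in>{N0+J*q..<N}. c i)"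
    proof -
      have "{..<N} = ({..<N0} \<union> {N0..<N0+J*q}) \<union> {N0+J*q..<N}" using le by auto
      then have "(\<Sum>i<N. c i) = sum c (({..<N0} \<union> {N0..<N0+J*q}) \<union> {N0+J*q..<N})" by simp
      also have "\<dots> = sum c ({..<N0} \<union> {N0..<N0+J*q}) + (\<Sum>i\<in>{N0+J*q..<N}. c i)"
        by (rule sum.union_disjoint) auto
      also have "sum c ({..<N0} \<union> {N0..<N0+J*q}) = (\<Sum>i<N0. c i) + (\<Sum>i\<in>{N0..<N0+J*q}. c i)"
        by (rule sum.union_disjoint) auto
      finally show ?thesis .
    qed
    have "(\<Sum>i\<in>{N0..<N0+J*q}. c i) = (\<Sum>i<J*q. c (N0 + i))"
      using sum.shift_bounds_nat_ivl[of c 0 N0 "J * q"] by (simp add: atLeast0LessThan add.commute)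
    also have "\<dots> = (\<Sum>j<J. \<Sum>i\<in>{j*q..<j*q+q}. c (N0 + i))"
      by (rule sum.nat_group[symmetric])
    also have "\<dots> = (\<Sum>j<J. \<Sum>i<q. c (N0 + i + j * q))"
    proof (rule sum.cong[OF refl])
      fix j
      show "(\<Sum>i\<in>{j*q..<j*q+q}. c (N0 + i)) = (\<Sum>i<q. c (N0 + i + j * q))"
        using sum.shift_bounds_nat_ivl[of "\<lambda>i. c (N0 + i)" 0 "j * q" q] by (simp add: atLeast0LessThan add_ac)
    qed
    also have "\<dots> = (\<Sum>i<q. \<Sum>j<J. c (N0 + i + j * q))" by (rule sum.swap)
    finally have "norm (\<Sum>i\<in>{N0..<N0+J*q}. c i) \<le> (\<Sum>i<q. norm (\<Sum>j<J. c (N0 + i + j * q)))"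
      by (simp add: norm_sum)
    also have "\<dots> \<le> (\<Sum>i<q. r/2 * real J)"
      using J0[OF J] by (intro sum_mono) auto
    also have "\<dots> = r/2 * real (J * q)" by simp
    also have "\<dots> \<le> r/2 * real N" using le \<open>0 < r\<close> by (intro mult_left_mono of_nat_mono) auto
    finally have mid: "norm (\<Sum>i\<in>{N0..<N0+J*q}. c i) \<le> r/2 * real N" .
    have "norm (\<Sum>i<N. c i) \<le> norm (\<Sum>i<N0. c i) + norm (\<Sum>i\<in>{N0..<N0+J*q}. c i) + norm (\<Sum>i\<in>{N0+J*q..<N}. c i)"
      unfolding split using norm_triangle_ineq[of "(\<Sum>i<N0. c i) + (\<Sum>i\<in>{N0..<N0+J*q}. c i)" "\<Sum>i\<in>{N0+J*q..<N}. c i"]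
        norm_triangle_ineq[of "\<Sum>i<N0. c i" "\<Sum>i\<in>{N0..<N0+J*q}. c i"] by linarith
    also have "\<dots> \<le> real N0 + r/2 * real N + real q"
    proof -
      have "norm (\<Sum>i\<in>{N0+J*q..<N}. c i) \<le> real (N - (N0 + J * q))" using bd[of "{N0+J*q..<N}"] by simp
      also have "\<dots> \<le> real q" using le by (intro of_nat_mono) linarith
      finally show ?thesis using bd[of "{..<N0}"] mid by simp
    qed
    also have "\<dots> < r * real N"
    proof -
      have "4 * (real N0 + real q) / r \<le> real N" using N unfolding N1_def by linarith
      then have "4 * (real N0 + real q) \<le> r * real N" using \<open>0 < r\<close> by (simp add: field_simps)
      moreover have "0 < real q" "0 \<le> real N0" using q by simp_all
      moreover have "X + r / 2 * real N + Y < r * real N" if "4 * (X + Y) \<le> r * real N" "0 < Y" "0 \<le> X" for X Y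
      proof -
        have "X + Y < (r * real N) / 2" using that by argo
        then show ?thesis by (simp add: field_simps)
      qed
      ultimately show ?thesis by blast
    qed
    finally have "norm (\<Sum>i<N. c i) < r * real N" .
    moreover have "0 < real N" using N unfolding N1_def by linarith
    ultimately show "norm ((\<Sum>i<N. c i) / of_nat N - 0) < r"
      by (simp add: norm_divide divide_less_eq)
  qed
qed

text \<open>Here \<open>g\<close> stands for the inverse diffeomorphism. The assumption
  \<open>dim\<close> is positive dimension in integrated form: off a set of mass \<delta>,
  level-\<open>l\<close> cells are exponentially small. The exponent 3 matches
  \<open>exceptional_blocks\<close>.\<close>

locale smooth_image = digit_system N b for N b +
  fixes a :: nat and g g' :: "real \<Rightarrow> real" and C c1 c2 :: real
  assumes a2: "2 \<le> a" and irr: "log (real b) (real a) \<notin> \<rat>"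
    and meas_g [measurable]: "g \<in> borel_measurable borel"
    and taylor: "\<And>y h. 0 \<le> y \<Longrightarrow> 0 \<le> h \<Longrightarrow> y + h \<le> 1 \<Longrightarrow> \<bar>g (y + h) - g y - g' y * h\<bar> \<le> C * h\<^sup>2"
    and lip: "\<And>y y'. 0 \<le> y \<Longrightarrow> y \<le> 1 \<Longrightarrow> 0 \<le> y' \<Longrightarrow> y' \<le> 1 \<Longrightarrow> \<bar>g' y - g' y'\<bar> \<le> C * \<bar>y - y'\<bar>"
    and C0: "0 \<le> C" and c1: "0 < c1"
    and g'_bounds: "\<And>y. 0 \<le> y \<Longrightarrow> y \<le> 1 \<Longrightarrow> c1 \<le> \<bar>g' y\<bar> \<and> \<bar>g' y\<bar> \<le> c2"
    and dim: "\<And>\<delta>. 0 < \<delta> \<Longrightarrow> \<exists>\<kappa>>0. \<exists>l1. \<forall>l\<ge>l1. measure N {x. exp (- \<kappa> * real l) ^ 3 < pr l (dig b l x)} \<le> \<delta>"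
begin

definition cf :: "real \<Rightarrow> nat \<Rightarrow> complex" where
  "cf \<xi> n = (\<integral>x. ee (\<xi> * real a ^ n * g x) \<partial>N)"

text \<open>Frequencies are rounded down to multiples of \<theta> so that only finitely many occur,
  as \<open>conditional_fourier_approx\<close> requires; \<open>g'\<close> is sampled at the left
  end of the cell \<open>c\<close>.\<close>

definition idx :: "nat \<Rightarrow> real \<Rightarrow> real \<Rightarrow> nat \<Rightarrow> nat" where
  "idx l \<theta> w c = nat \<lfloor>w * \<bar>g' (real c / real b ^ l)\<bar> / \<theta>\<rfloor>"

text \<open>Squared, so that sums over the grid fall under \<open>good_ft_energy\<close>; normalised
  to lie in [0, 1]; and a function of one block \<open>c\<close> and the suffix \<open>z\<close>
  only, the shape that \<open>decoupling\<close> accepts.\<close>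

definition phi :: "real \<Rightarrow> nat \<Rightarrow> nat \<Rightarrow> real \<Rightarrow> real \<Rightarrow> nat \<Rightarrow> nat \<Rightarrow> real" where
  "phi \<tau> L l \<theta> w c z = (norm (good_ft \<tau> L l z (real (idx l \<theta> w c) * \<theta>)) / pr L z)\<^sup>2"

lemma phi_nonneg: "0 \<le> phi \<tau> L l \<theta> w c z" by (simp add: phi_def)

lemma norm_good_ft_quot_le: "norm (good_ft \<tau> L l z \<omega>) / pr L z \<le> 1"
  using norm_good_ft_le[of \<tau> L l z \<omega>] pr_nonneg[of L z] by (cases "pr L z = 0") (auto simp: divide_le_eq less_le)

lemma phi_le_1: "phi \<tau> L l \<theta> w c z \<le> 1"
  unfolding phi_def using norm_good_ft_quot_le[of \<tau> L l z] by (intro power_le_one) auto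

text \<open>The errors, in order: the Taylor remainder; reading \<open>g'\<close> off
  \<open>l\<close> digits and rounding the frequency; shortening the past from \<open>K\<close> to
  \<open>L\<close> digits; the part that is not good; and
  \<open>t \<le> \<delta> + t\<^sup>2 / \<delta>\<close>, which passes from the conditional
  transform to its square \<open>phi\<close>.\<close>

lemma coefficient_bound:
  assumes LK: "L \<le> K" and lk: "l \<le> k" and kK: "k \<le> K" and w: "0 < w" "\<xi> * real a ^ n = w * real b ^ k"
    and \<theta>: "0 < \<theta>" and \<delta>: "0 < \<delta>"
    and dev: "\<And>i. i < M \<Longrightarrow> (\<Sum>I<b^K. deviation L K (real i * \<theta>) I) \<le> \<eta>"
    and M: "\<And>c. c < b ^ l \<Longrightarrow> idx l \<theta> w c < M"
  shows "norm (cf \<xi> n) \<le> 2 * pi * w * C / real b ^ k + 2 * pi * (w * C / real b ^ l + \<theta>) + real M * \<eta>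
    + measure N {x. \<not> good \<tau> L l (dig b (L + l) x)} + \<delta>
    + (\<integral>x. phi \<tau> L l \<theta> w (dig b K x div b ^ (k - l) mod b ^ l) (dig b K x mod b ^ L) \<partial>N) / \<delta>"
proof -
  define y where "y I = real (I mod b ^ k) / real b ^ k" for I
  define c where "c I = I div b ^ (k - l) mod b ^ l" for I
  define \<gamma> where "\<gamma> I = real (idx l \<theta> w (c I)) * \<theta>" for I
  define z where "z I = I mod b ^ L" for I
  define ex where "ex Z = measure N {x. dig b L x = Z \<and> \<not> good \<tau> L l (dig b (L + l) x)}" for Z
  define dv where "dv I \<omega> = deviation L K \<omega> I" for I \<omega>
  define E0 where "E0 = 2 * pi * (w * C / real b ^ l + \<theta>)"
  define P where "P I = norm (good_ft \<tau> L l (z I) (\<gamma> I)) / pr L (z I)" for I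
  have c_less: "c I < b ^ l" for I by (simp add: c_def)
  have z_less: "z I < b ^ L" for I by (simp add: z_def)
  have ex_le: "ex Z \<le> pr L Z" for Z
    unfolding ex_def pr_def by (intro finite_measure_mono) (auto simp: sets_N)
  have freq: "norm (cell_ft K I (w * g' (y I))) \<le> norm (cell_ft K I (\<gamma> I)) + E0 * pr K I" for I
  proof -
    have y01: "0 \<le> y I" "y I \<le> 1" by (auto simp: y_def divide_le_eq intro!: less_imp_le)
    have c01: "0 \<le> real (c I) / real b ^ l" "real (c I) / real b ^ l \<le> 1"
      using c_less[of I] by (auto simp: divide_le_eq simp flip: of_nat_power)
    \<comment> \<open>The block \<open>c I\<close> consists of the leading \<open>l\<close> of the
      last \<open>k\<close> digits, so \<open>c I / b ^ l\<close> is \<open>y I\<close> truncated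
      after \<open>l\<close> digits.\<close>
    have cmod: "c I = (I mod b ^ k) div b ^ (k - l)"
    proof -
      have "c I = (I mod b ^ k) div b ^ (k - l) mod b ^ l"
        unfolding c_def using mod_power_div_mod[of b "k - l" l k I] lk by simp
      also have "(I mod b ^ k) div b ^ (k - l) < b ^ l"
      proof (rule less_mult_imp_div_less)
        have "I mod b ^ k < b ^ k" by simp
        also have "b ^ k = b ^ l * b ^ (k - l)" using lk by (simp flip: power_add)
        finally show "I mod b ^ k < b ^ l * b ^ (k - l)" .
      qed
      then have "(I mod b ^ k) div b ^ (k - l) mod b ^ l = (I mod b ^ k) div b ^ (k - l)" by simp
      finally show ?thesis .
    qed
    have near: "\<bar>y I - real (c I) / real b ^ l\<bar> \<le> 1 / real b ^ l"
    proof -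
      have bk: "real b ^ k = real b ^ l * real b ^ (k - l)" using lk by (simp flip: power_add)
      have "I mod b ^ k = c I * b ^ (k - l) + (I mod b ^ k) mod b ^ (k - l)"
        unfolding cmod by (rule div_mult_mod_eq[symmetric])
      then have "real (I mod b ^ k) = real (c I) * real b ^ (k - l) + real ((I mod b ^ k) mod b ^ (k - l))"
        by (metis of_nat_add of_nat_mult of_nat_power)
      then have "y I = real (c I) / real b ^ l + real ((I mod b ^ k) mod b ^ (k - l)) / real b ^ k"
        unfolding y_def bk by (simp add: add_divide_distrib)
      moreover have "real ((I mod b ^ k) mod b ^ (k - l)) / real b ^ k \<le> real b ^ (k - l) / real b ^ k"
      proof (rule divide_right_mono)
        have "(I mod b ^ k) mod b ^ (k - l) \<le> b ^ (k - l)" by (intro less_imp_le) simp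
        then show "real ((I mod b ^ k) mod b ^ (k - l)) \<le> real b ^ (k - l)" by (metis of_nat_le_iff of_nat_power)
      qed simp
      moreover have "real b ^ (k - l) / real b ^ k = 1 / real b ^ l" unfolding bk by simp
      moreover have "0 \<le> real ((I mod b ^ k) mod b ^ (k - l)) / real b ^ k" by simp
      ultimately show ?thesis by linarith
    qed
    have 1: "\<bar>\<bar>w * g' (y I)\<bar> - w * \<bar>g' (real (c I) / real b ^ l)\<bar>\<bar> \<le> w * C / real b ^ l"
    proof -
      have "\<bar>\<bar>w * g' (y I)\<bar> - w * \<bar>g' (real (c I) / real b ^ l)\<bar>\<bar> = w * \<bar>\<bar>g' (y I)\<bar> - \<bar>g' (real (c I) / real b ^ l)\<bar>\<bar>"
        using w by (simp add: abs_mult flip: right_diff_distrib)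
      also have "\<dots> \<le> w * (C * \<bar>y I - real (c I) / real b ^ l\<bar>)"
        using lip[OF y01 c01] w by (intro mult_left_mono) linarith+
      also have "\<dots> \<le> w * (C * (1 / real b ^ l))"
        using near w C0 by (intro mult_left_mono) auto
      finally show ?thesis by simp
    qed
    have 2: "\<bar>w * \<bar>g' (real (c I) / real b ^ l)\<bar> - \<gamma> I\<bar> \<le> \<theta>"
    proof -
      define u where "u = w * \<bar>g' (real (c I) / real b ^ l)\<bar> / \<theta>"
      have "0 \<le> u" unfolding u_def using w \<theta> by simp
      then have "real (idx l \<theta> w (c I)) \<le> u" "u < real (idx l \<theta> w (c I)) + 1"
        unfolding idx_def u_def[symmetric] by (auto simp: of_nat_floor)
      then have "\<bar>u - real (idx l \<theta> w (c I))\<bar> * \<theta> \<le> 1 * \<theta>" using \<theta> by (intro mult_right_mono) auto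
      also have "\<bar>u - real (idx l \<theta> w (c I))\<bar> * \<theta> = \<bar>u * \<theta> - \<gamma> I\<bar>"
        unfolding \<gamma>_def using \<theta> by (simp add: left_diff_distrib[symmetric] abs_mult)
      finally show ?thesis using \<theta> by (simp add: u_def)
    qed
    have "norm (cell_ft K I (w * g' (y I))) = norm (cell_ft K I \<bar>w * g' (y I)\<bar>)" by (rule norm_cell_ft_abs[symmetric])
    also have "\<dots> \<le> norm (cell_ft K I (\<gamma> I)) + norm (cell_ft K I \<bar>w * g' (y I)\<bar> - cell_ft K I (\<gamma> I))"
      by (rule norm_triangle_sub)
    also have "norm (cell_ft K I \<bar>w * g' (y I)\<bar> - cell_ft K I (\<gamma> I)) \<le> 2 * pi * \<bar>\<bar>w * g' (y I)\<bar> - \<gamma> I\<bar> * pr K I"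
      by (rule norm_cell_ft_diff_le)
    also have "\<dots> \<le> E0 * pr K I"
      unfolding E0_def using 1 2 by (intro mult_right_mono mult_left_mono) auto
    finally show ?thesis by simp
  qed
  have cond: "norm (cell_ft K I (\<gamma> I)) \<le> dv I (\<gamma> I) + pr K I * P I + pr K I * (ex (z I) / pr L (z I))" for I
  proof -
    have "norm (cell_ft K I (\<gamma> I)) \<le> dv I (\<gamma> I) + norm (pr K I * (cell_ft L (z I) (\<gamma> I) / pr L (z I)))"
      unfolding dv_def deviation_def z_def[symmetric] using norm_triangle_sub[of "cell_ft K I (\<gamma> I)" "pr K I * (cell_ft L (z I) (\<gamma> I) / pr L (z I))"] by simp
    also have "norm (pr K I * (cell_ft L (z I) (\<gamma> I) / pr L (z I))) = pr K I * (norm (cell_ft L (z I) (\<gamma> I)) / pr L (z I))"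
      by (simp add: norm_mult norm_divide)
    also have "\<dots> \<le> pr K I * ((norm (good_ft \<tau> L l (z I) (\<gamma> I)) + ex (z I)) / pr L (z I))"
      unfolding ex_def by (intro mult_left_mono divide_right_mono norm_cell_ft_le_good_ft) auto
    finally show ?thesis by (simp add: P_def add_divide_distrib distrib_left)
  qed
  \<comment> \<open>The grid frequency varies with the cell, so the deviation is bounded by its sum
    over the whole grid; this is the origin of the factor \<open>M\<close>.\<close>
  have dvs: "(\<Sum>I<b^K. dv I (\<gamma> I)) \<le> real M * \<eta>"
  proof -
    have "(\<Sum>I<b^K. dv I (\<gamma> I)) \<le> (\<Sum>I<b^K. \<Sum>i<M. dv I (real i * \<theta>))"
      unfolding \<gamma>_def using M[OF c_less] by (intro sum_mono member_le_sum) (auto simp: dv_def deviation_def)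
    also have "\<dots> = (\<Sum>i<M. \<Sum>I<b^K. dv I (real i * \<theta>))" by (rule sum.swap)
    also have "\<dots> \<le> (\<Sum>i<M. \<eta>)" using dev by (intro sum_mono) (auto simp: dv_def)
    finally show ?thesis by simp
  qed
  have exs: "(\<Sum>I<b^K. pr K I * (ex (z I) / pr L (z I))) \<le> measure N {x. \<not> good \<tau> L l (dig b (L + l) x)}"
  proof -
    have "(\<Sum>I<b^K. pr K I * (ex (z I) / pr L (z I))) = (\<integral>x. ex (z (dig b K x)) / pr L (z (dig b K x)) \<partial>N)"
      by (rule integral_dig[of "\<lambda>I. ex (z I) / pr L (z I)", symmetric])
    also have "\<dots> = (\<integral>x. (\<lambda>Z. ex Z / pr L Z) (dig b L (real b ^ (K - L) * x)) \<partial>N)"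
      by (simp add: z_def dig_suffix[OF LK])
    also have "\<dots> = (\<Sum>Z<b^L. pr L Z * (ex Z / pr L Z))" by (rule integral_dig_shift)
    also have "\<dots> \<le> (\<Sum>Z<b^L. ex Z)" by (intro sum_mono) (auto simp: ex_def)
    also have "\<dots> = measure N (\<Union>Z\<in>{..<b^L}. {x. dig b L x = Z \<and> \<not> good \<tau> L l (dig b (L + l) x)})"
    proof -
      have [measurable]: "{x. dig b L x = Z \<and> \<not> good \<tau> L l (dig b (L + l) x)} \<in> sets N" for Z by measurable
      show ?thesis unfolding ex_def
        by (intro finite_measure_finite_Union[symmetric]) (auto simp: disjoint_family_on_def)
    qed
    also have "(\<Union>Z\<in>{..<b^L}. {x. dig b L x = Z \<and> \<not> good \<tau> L l (dig b (L + l) x)}) = {x. \<not> good \<tau> L l (dig b (L + l) x)}"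
      using dig_less[of b L] by auto
    finally show ?thesis .
  qed
  have Ps: "(\<Sum>I<b^K. pr K I * P I) \<le> \<delta> + (\<integral>x. phi \<tau> L l \<theta> w (c (dig b K x)) (z (dig b K x)) \<partial>N) / \<delta>"
  proof -
    have "(\<Sum>I<b^K. pr K I * P I) \<le> (\<Sum>I<b^K. pr K I * \<delta> + pr K I * phi \<tau> L l \<theta> w (c I) (z I) / \<delta>)"
    proof (rule sum_mono)
      fix I
      have "0 \<le> P I" by (simp add: P_def)
      have "0 \<le> (P I - \<delta>)\<^sup>2" by simp
      then have "P I * \<delta> * 2 \<le> \<delta>\<^sup>2 + (P I)\<^sup>2" by (simp add: power2_diff algebra_simps)
      moreover have "0 \<le> P I * \<delta>" using \<open>0 \<le> P I\<close> \<delta> by simp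
      ultimately have "P I * \<delta> \<le> \<delta>\<^sup>2 + (P I)\<^sup>2" by linarith
      then have "P I \<le> (\<delta>\<^sup>2 + (P I)\<^sup>2) / \<delta>" using \<delta> by (simp add: le_divide_eq)
      also have "\<dots> = \<delta> + phi \<tau> L l \<theta> w (c I) (z I) / \<delta>"
        using \<delta> by (simp add: add_divide_distrib power2_eq_square phi_def P_def \<gamma>_def)
      finally have "pr K I * P I \<le> pr K I * (\<delta> + phi \<tau> L l \<theta> w (c I) (z I) / \<delta>)" by (intro mult_left_mono) auto
      then show "pr K I * P I \<le> pr K I * \<delta> + pr K I * phi \<tau> L l \<theta> w (c I) (z I) / \<delta>" by (simp add: distrib_left)
    qed
    also have "\<dots> = \<delta> + (\<Sum>I<b^K. pr K I * phi \<tau> L l \<theta> w (c I) (z I)) / \<delta>"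
      by (simp only: sum.distrib sum_distrib_right[symmetric] sum_divide_distrib[symmetric] sum_pr mult_1_left)
    also have "(\<Sum>I<b^K. pr K I * phi \<tau> L l \<theta> w (c I) (z I)) = (\<integral>x. phi \<tau> L l \<theta> w (c (dig b K x)) (z (dig b K x)) \<partial>N)"
      by (rule integral_dig[of "\<lambda>I. phi \<tau> L l \<theta> w (c I) (z I)", symmetric])
    finally show ?thesis .
  qed
  have A: "\<xi> * real a ^ n / real b ^ k = w" using w(2) by simp
  have main: "norm (cf \<xi> n) \<le> (\<Sum>I<b^K. norm (cell_ft K I (w * g' (y I)))) + 2 * pi * \<bar>\<xi> * real a ^ n\<bar> * C / real b ^ (2 * k)"
    unfolding cf_def y_def using affine_cells[OF taylor meas_g kK C0, of "\<xi> * real a ^ n"] by (simp only: A)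
  have abs: "\<bar>\<xi> * real a ^ n\<bar> = w * real b ^ k" unfolding w(2) using w(1) by simp
  define Bk where "Bk = real b ^ k"
  have "Bk \<noteq> 0" "real b ^ (2 * k) = Bk * Bk" by (simp_all add: Bk_def mult_2 power_add)
  then have err: "2 * pi * \<bar>\<xi> * real a ^ n\<bar> * C / real b ^ (2 * k) = 2 * pi * w * C / real b ^ k"
    unfolding abs by (simp flip: Bk_def)
  have "(\<Sum>I<b^K. norm (cell_ft K I (w * g' (y I)))) \<le>
      (\<Sum>I<b^K. (dv I (\<gamma> I) + pr K I * P I + pr K I * (ex (z I) / pr L (z I))) + pr K I * E0)"
  proof (rule sum_mono)
    fix I
    show "norm (cell_ft K I (w * g' (y I))) \<le> (dv I (\<gamma> I) + pr K I * P I + pr K I * (ex (z I) / pr L (z I))) + pr K I * E0"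
      using freq[of I] cond[of I] mult.commute[of "pr K I" E0] by linarith
  qed
  then have "(\<Sum>I<b^K. norm (cell_ft K I (w * g' (y I)))) \<le> (\<Sum>I<b^K. dv I (\<gamma> I)) + (\<Sum>I<b^K. pr K I * P I) + (\<Sum>I<b^K. pr K I * (ex (z I) / pr L (z I))) + E0"
    by (simp only: sum.distrib sum_distrib_right[symmetric] sum_pr mult_1_left)
  then show ?thesis using main dvs exs Ps unfolding err E0_def c_def z_def by linarith
qed

text \<open>With \<open>c\<close> and \<open>z\<close> fixed, time enters only through the grid
  index. Grouping times by index, each index occurs at most \<open>V\<close> times, and what remains
  is the sum of squares over the grid.\<close>

lemma sum_phi_le:
  fixes J :: nat
  assumes \<theta>: "0 < \<theta>" "\<theta> \<le> 1/7" and z: "z < b ^ L" and M: "\<And>j. j < J \<Longrightarrow> idx l \<theta> (w j) c < M"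
    and V: "\<And>i. real (card {j. j < J \<and> idx l \<theta> (w j) c = i}) \<le> V"
  shows "(\<Sum>j<J. phi \<tau> L l \<theta> (w j) c z) \<le> V * (\<tau>\<^sup>2 * (3 * real M + 2 * real b ^ l / \<theta> * (1 + real l * ln (real b))))"
proof -
  let ?Q = "\<lambda>i. (norm (good_ft \<tau> L l z (real i * \<theta>)) / pr L z)\<^sup>2"
  have V0: "0 \<le> V" using V[of 0] of_nat_0_le_iff order_trans by blast
  define S where "S = 3 * real M + 2 * real b ^ l / \<theta> * (1 + real l * ln (real b))"
  have S0: "0 \<le> S" unfolding S_def using \<theta> b2 by (auto intro!: add_nonneg_nonneg mult_nonneg_nonneg divide_nonneg_nonneg)
  have "(\<Sum>j<J. phi \<tau> L l \<theta> (w j) c z) = (\<Sum>j<J. \<Sum>i<M. if idx l \<theta> (w j) c = i then ?Q i else 0)"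
    using M by (intro sum.cong) (auto simp: phi_def)
  also have "\<dots> = (\<Sum>i<M. \<Sum>j<J. if idx l \<theta> (w j) c = i then ?Q i else 0)" by (rule sum.swap)
  also have "\<dots> = (\<Sum>i<M. real (card {j. j < J \<and> idx l \<theta> (w j) c = i}) * ?Q i)"
  proof (rule sum.cong[OF refl])
    fix i
    have "(\<Sum>j<J. if idx l \<theta> (w j) c = i then ?Q i else 0) = (\<Sum>j\<in>{j. j < J \<and> idx l \<theta> (w j) c = i}. ?Q i)"
      using sum.inter_filter[of "{..<J}" "\<lambda>_. ?Q i" "\<lambda>j. idx l \<theta> (w j) c = i"] by simp
    then show "(\<Sum>j<J. if idx l \<theta> (w j) c = i then ?Q i else 0) = real (card {j. j < J \<and> idx l \<theta> (w j) c = i}) * ?Q i" by simp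
  qed
  also have "\<dots> \<le> (\<Sum>i<M. V * ?Q i)" using V by (intro sum_mono mult_right_mono) auto
  also have "\<dots> = V * ((\<Sum>i<M. (norm (good_ft \<tau> L l z (real i * \<theta>)))\<^sup>2) / (pr L z)\<^sup>2)"
    by (simp add: sum_distrib_left sum_divide_distrib power_divide)
  also have "\<dots> \<le> V * (\<tau>\<^sup>2 * S)"
  proof (rule mult_left_mono[OF _ V0])
    have "(\<Sum>i<M. (norm (good_ft \<tau> L l z (real i * \<theta>)))\<^sup>2) \<le> \<tau>\<^sup>2 * (pr L z)\<^sup>2 * S"
      unfolding S_def by (rule good_ft_energy[OF \<theta> z])
    then show "(\<Sum>i<M. (norm (good_ft \<tau> L l z (real i * \<theta>)))\<^sup>2) / (pr L z)\<^sup>2 \<le> \<tau>\<^sup>2 * S"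
      using S0 by (cases "pr L z = 0") (auto simp: divide_le_eq mult_ac)
  qed
  finally show ?thesis by (simp add: S_def)
qed

end

text \<open>Convexity: on [0, 1] the function \<open>exp (\<beta> * p)\<close> lies below its
  chord.\<close>

lemma exp_mult_minus_one_le:
  fixes \<beta> p :: real assumes "0 \<le> p" "p \<le> 1"
  shows "exp (\<beta> * p) - 1 \<le> exp \<beta> * p"
proof -
  have "exp ((1 - p) *\<^sub>R 0 + p *\<^sub>R \<beta>) \<le> (1 - p) * exp 0 + p * exp \<beta>"
    using assms by (intro convex_onD[OF exp_convex]) auto
  then show ?thesis using assms by (simp add: algebra_simps)
qed

lemma eventually_le_linear: "0 < d \<Longrightarrow> eventually (\<lambda>l::nat. c \<le> d * real l) sequentially" for c d :: real
proof -
  assume "0 < d"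
  then have "filterlim (\<lambda>l::nat. d * real l) at_top sequentially" by real_asymp
  then show ?thesis by (simp add: filterlim_at_top)
qed

lemma eventually_le_exponential: "0 < d \<Longrightarrow> 1 < b \<Longrightarrow> eventually (\<lambda>l::nat. c \<le> d * b ^ l) sequentially" for b c d :: real
proof -
  assume "0 < d" "1 < b"
  then have "filterlim (\<lambda>l::nat. d * b ^ l) at_top sequentially" by real_asymp
  then show ?thesis by (simp add: filterlim_at_top)
qed

lemma eventually_exp_decay:
  fixes \<kappa> D m :: real
  assumes "0 < \<kappa>"
  shows "eventually (\<lambda>l::nat. exp (- \<kappa> * real l) * (D * (1 + real l * m)) \<le> 1) sequentially"
proof -
  have "((\<lambda>l::nat. D * exp (- \<kappa> * real l) + D * m * (real l * exp (- \<kappa> * real l))) \<longlongrightarrow> D * 0 + D * m * 0) sequentially"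
    by (intro tendsto_intros; use assms in real_asymp)
  then have "eventually (\<lambda>l::nat. D * exp (- \<kappa> * real l) + D * m * (real l * exp (- \<kappa> * real l)) < 1) sequentially"
    by (intro order_tendstoD(2)) auto
  then show ?thesis by eventually_elim (simp add: algebra_simps)
qed

lemma greatest_power_below:
  fixes x X r :: real
  assumes "0 < x" "x \<le> X" "1 < r"
  obtains j :: nat where "x * r ^ j \<le> X" "X / r < x * r ^ j"
proof -
  obtain m :: nat where "X / x < r ^ m" using assms real_arch_pow by blast
  then have ex: "\<exists>m. X < x * r ^ m" using assms by (auto simp: divide_less_eq mult.commute)
  define m0 where "m0 = (LEAST m. X < x * r ^ m)"
  have m0: "X < x * r ^ m0" unfolding m0_def using ex by (rule LeastI_ex)
  then have "m0 \<noteq> 0" using assms by (cases "m0 = 0") auto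
  then obtain j where j: "m0 = Suc j" by (cases m0) auto
  have "\<not> X < x * r ^ j" using not_less_Least[of j "\<lambda>m. X < x * r ^ m"] j unfolding m0_def by simp
  moreover have "X / r < x * r ^ j" using m0 assms unfolding j by (simp add: divide_less_eq mult_ac)
  ultimately show thesis by (intro that[of j]) auto
qed

section \<open>Rotation phases, choice of scales, and decay along progressions\<close>

context smooth_image
begin

abbreviation "\<alpha> \<equiv> log (real b) (real a)"

lemma \<alpha>_pos: "0 < \<alpha>" using a2 b2 by simp

text \<open>Separates a power of \<open>a\<close> into a scale \<open>b ^ k\<close>, absorbed by the
  digit shift, and a bounded factor governed by the orbit of the rotation by \<alpha>.\<close>

lemma a_power_split: "real a ^ n = real b powr frac (real n * \<alpha>) * real b ^ nat \<lfloor>real n * \<alpha>\<rfloor>"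
proof -
  have "real b powr (real n * \<alpha>) = (real b powr \<alpha>) powr real n" by (simp only: powr_powr mult.commute)
  also have "real b powr \<alpha> = real a" using a2 b2 by simp
  also have "real a powr real n = real a ^ n" using a2 by (intro powr_realpow) simp
  finally have "real a ^ n = real b powr (real n * \<alpha>)" ..
  also have "real n * \<alpha> = frac (real n * \<alpha>) + real (nat \<lfloor>real n * \<alpha>\<rfloor>)"
    using \<alpha>_pos by (simp add: frac_def)
  also have "real b powr \<dots> = real b powr frac (real n * \<alpha>) * real b ^ nat \<lfloor>real n * \<alpha>\<rfloor>"
    by (simp add: powr_add powr_realpow)
  finally show ?thesis .
qed

lemma ln_b_pos: "0 < ln (real b)" using b2 by simp

lemma cell_unit: "c < b ^ l \<Longrightarrow> 0 \<le> real c / real b ^ l \<and> real c / real b ^ l \<le> 1"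
  by (auto simp: divide_le_eq simp flip: of_nat_power)

text \<open>Times with the same index are visits of the rotation by \<open>d * \<alpha>\<close> to a
  set of phases \<open>t \<ge> 0\<close> on which \<open>\<xi> * b powr t * G / \<theta>\<close>
  varies by less than 1. Its slope there is at least \<open>\<xi> * c1 * ln b / \<theta>\<close>, so
  the set has diameter below the reciprocal of this. The threshold \<open>J0\<close> does not depend
  on the starting time.\<close>

lemma idx_visits:
  assumes \<xi>: "0 < \<xi>" and \<theta>: "0 < \<theta>" and v: "\<theta> / (\<xi> * c1 * ln (real b)) \<le> 1/4" and d: "0 < d"
  obtains J0 where "\<And>J n0 c i. J0 \<le> J \<Longrightarrow> c < b ^ l \<Longrightarrow>
    real (card {j. j < J \<and> idx l \<theta> (\<xi> * real b powr frac (real (n0 + j * d) * \<alpha>)) c = i}) \<le> 8 * (\<theta> / (\<xi> * c1 * ln (real b))) * real J"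
proof -
  let ?v = "\<theta> / (\<xi> * c1 * ln (real b))"
  have v0: "0 < ?v" using \<xi> \<theta> c1 ln_b_pos by simp
  have irr': "real d * \<alpha> \<notin> \<rat>"
  proof
    assume "real d * \<alpha> \<in> \<rat>"
    then have "real d * \<alpha> / real d \<in> \<rat>" by (intro Rats_divide) auto
    then show False using irr d by simp
  qed
  show thesis
  proof (rule irrational_rotation_visits[OF irr' v0 v], rule that)
    fix J0 J :: nat and n0 c i
    assume J0: "\<And>J s A. J0 \<le> J \<Longrightarrow> (\<And>t t'. t \<in> A \<Longrightarrow> t' \<in> A \<Longrightarrow> \<bar>t - t'\<bar> < ?v) \<Longrightarrow>
        real (card {j. j < J \<and> frac (s + real j * (real d * \<alpha>)) \<in> A}) \<le> 8 * ?v * real J"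
      and J: "J0 \<le> J" and c: "c < b ^ l"
    define G where "G = \<bar>g' (real c / real b ^ l)\<bar>"
    have G: "c1 \<le> G" unfolding G_def using g'_bounds cell_unit[OF c] by blast
    define A where "A = {t. 0 \<le> t \<and> nat \<lfloor>\<xi> * real b powr t * G / \<theta>\<rfloor> = i}"
    have lt: "t' - t < ?v" if "t \<in> A" "t' \<in> A" "t \<le> t'" for t t'
    proof -
      have pos: "0 \<le> \<xi> * real b powr t * G / \<theta>" for t using \<xi> G c1 \<theta> by simp
      have "\<bar>\<xi> * real b powr t' * G / \<theta> - \<xi> * real b powr t * G / \<theta>\<bar> < 1"
        using that pos[of t] pos[of t'] unfolding A_def by (auto simp: nat_eq_iff) linarith+
      then have "\<xi> * G / \<theta> * (real b powr t' - real b powr t) < 1" by (simp add: algebra_simps diff_divide_distrib)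
      moreover have "(t' - t) * ln (real b) \<le> real b powr t' - real b powr t"
      proof -
        have "(t' - t) * ln (real b) \<le> exp ((t' - t) * ln (real b)) - 1"
          using exp_ge_add_one_self[of "(t' - t) * ln (real b)"] by linarith
        also have "\<dots> = 1 * (real b powr (t' - t) - 1)" by (simp add: powr_def)
        also have "\<dots> \<le> real b powr t * (real b powr (t' - t) - 1)"
          using that b2 by (intro mult_right_mono) (auto simp: A_def ge_one_powr_ge_zero)
        also have "\<dots> = real b powr t' - real b powr t" by (simp add: algebra_simps flip: powr_add)
        finally show ?thesis .
      qed
      moreover have "0 \<le> (t' - t) * ln (real b)"
        using that by (intro mult_nonneg_nonneg less_imp_le[OF ln_b_pos]) simp
      moreover have "\<xi> * c1 / \<theta> * ((t' - t) * ln (real b)) \<le> \<xi> * G / \<theta> * (real b powr t' - real b powr t)"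
        using \<xi> \<theta> c1 G calculation(2,3) by (intro mult_mono divide_right_mono mult_left_mono) auto
      ultimately have "\<xi> * c1 / \<theta> * ((t' - t) * ln (real b)) < 1" by linarith
      then have "(t' - t) * (\<xi> * c1 * ln (real b)) < \<theta>" using \<theta> by (simp add: field_simps)
      moreover have "0 < \<xi> * c1 * ln (real b)" using \<xi> c1 ln_b_pos by (intro mult_pos_pos)
      ultimately show ?thesis by (simp only: pos_less_divide_eq)
    qed
    have diam: "\<bar>t - t'\<bar> < ?v" if "t \<in> A" "t' \<in> A" for t t'
      using lt[of t t'] lt[of t' t] that by (cases "t \<le> t'") auto
    have arg: "real (n0 + j * d) * \<alpha> = real n0 * \<alpha> + real j * (real d * \<alpha>)" for j by (simp add: algebra_simps)
    have "{j. j < J \<and> idx l \<theta> (\<xi> * real b powr frac (real (n0 + j * d) * \<alpha>)) c = i} =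
      {j. j < J \<and> frac (real n0 * \<alpha> + real j * (real d * \<alpha>)) \<in> A}"
      unfolding idx_def A_def G_def arg by auto
    then show "real (card {j. j < J \<and> idx l \<theta> (\<xi> * real b powr frac (real (n0 + j * d) * \<alpha>)) c = i}) \<le> 8 * ?v * real J"
      using J0[OF J, of A "real n0 * \<alpha>"] diam by simp
  qed
qed

text \<open>
  The last \<open>L\<close> digits determine the conditional measure up to a small error, and the first \<open>l\<close> digits
  of the current point determine \<open>g'\<close>. Decoupled from each other, they leave the rotation
  \<open>frac (n * \<alpha>)\<close> free to average out the conditional Fourier transform.
\<close>
lemma progression_bound:
  assumes \<xi>0: "0 < \<xi>0" and \<delta>: "0 < \<delta>" "\<delta> \<le> 1"
  shows "\<exists>N0 d J0. 0 < d \<and> (\<forall>J\<ge>J0. \<forall>n0\<in>{N0..<N0+d}. norm (\<Sum>j<J. cf \<xi>0 (n0 + j * d)) \<le> 9 * \<delta> * real J)"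
proof -
  define B where "B = real b"
  have B: "1 < B" "0 < B" "0 < ln B" using b2 by (auto simp: B_def)
  obtain \<kappa> l1 where \<kappa>: "0 < \<kappa>" and l1: "\<And>l. l1 \<le> l \<Longrightarrow> measure N {x. exp (- \<kappa> * real l) ^ 3 < pr l (dig b l x)} \<le> \<delta>"
    using dim[OF \<delta>(1)] by blast
  obtain h where h: "0 \<le> h" "\<And>n. h * real n \<le> ent n" and
    rate: "\<And>\<epsilon>. 0 < \<epsilon> \<Longrightarrow> \<exists>l0>0. \<forall>r>0. ent (r * l0) \<le> (h + \<epsilon>) * real (r * l0)"
    by (rule ent_rate) blast
  \<comment> \<open>Then \<open>2 * \<epsilon> * l / (\<kappa> * l) = \<delta>\<^sup>2\<close> in
    the exceptional mass, and an entropy gap \<open>\<epsilon> * l\<close> per step uses half of the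
    allowance \<open>\<delta>\<^sup>2 * \<kappa> * l\<close>.\<close>
  define \<epsilon> where "\<epsilon> = \<delta>\<^sup>2 * \<kappa> / 2"
  have \<epsilon>: "0 < \<epsilon>" unfolding \<epsilon>_def using \<delta> \<kappa> by simp
  obtain l0 where l0: "0 < l0" "\<And>r. 0 < r \<Longrightarrow> ent (r * l0) \<le> (h + \<epsilon>) * real (r * l0)"
    using rate[OF \<epsilon>] by blast
  \<comment> \<open>As \<open>2 * pi \<le> 7\<close>, rounding to the grid costs at most \<delta>;
    moreover \<open>\<theta> \<le> 1/7\<close> is the condition of
    \<open>norm_sum_ee_le\<close>.\<close>
  define \<theta> where "\<theta> = \<delta> / 7"
  have \<theta>: "0 < \<theta>" "\<theta> \<le> 1/7" unfolding \<theta>_def using \<delta> by auto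
  \<comment> \<open>With \<open>w \<le> \<xi> * B\<close> and
    \<open>\<xi> \<le> \<rho> * B ^ l\<close>, reading \<open>g'\<close> off \<open>l\<close> digits
    costs at most \<open>7 * \<rho> * B * C \<le> \<delta>\<close>.\<close>
  define \<rho> where "\<rho> = \<delta> / (7 * B * (C + 1))"
  have \<rho>: "0 < \<rho>" unfolding \<rho>_def using \<delta> B C0 by simp
  have c2: "0 < c2" using g'_bounds[of 0] c1 by simp
  \<comment> \<open>Chosen so that
    \<open>8 * v * S \<le> \<tau>\<^sup>2 * D * (1 + l * ln B)\<close> in the estimate
    \<open>vS\<close> below, uniformly in \<open>l\<close>.\<close>
  define D where "D = 8 * (3 * (B * c2 / (c1 * ln B) + 1) + 2 * (real a / (\<rho> * c1 * ln B)))"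
  have "eventually (\<lambda>l::nat. l \<ge> l1 \<and> 1 \<le> l \<and> 2 * (1 + (1 + \<alpha>) * ln B) \<le> \<delta>\<^sup>2 * \<kappa> * real l \<and> 1 \<le> \<delta> * \<kappa> * real l \<and>
     \<xi>0 \<le> \<rho> * B ^ l \<and> 4 * \<theta> * real a \<le> \<rho> * c1 * ln B * B ^ l \<and> exp (- \<kappa> * real l) * (D * (1 + real l * ln B)) \<le> 1) sequentially"
    using \<delta> \<kappa> \<rho> B c1
    by (intro eventually_conj eventually_ge_at_top eventually_le_linear eventually_le_exponential eventually_exp_decay) auto
  then obtain l2 where l2: "\<And>l. l2 \<le> l \<Longrightarrow> l \<ge> l1 \<and> 1 \<le> l \<and> 2 * (1 + (1 + \<alpha>) * ln B) \<le> \<delta>\<^sup>2 * \<kappa> * real l \<and> 1 \<le> \<delta> * \<kappa> * real l \<and>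
     \<xi>0 \<le> \<rho> * B ^ l \<and> 4 * \<theta> * real a \<le> \<rho> * c1 * ln B * B ^ l \<and> exp (- \<kappa> * real l) * (D * (1 + real l * ln B)) \<le> 1"
    unfolding eventually_sequentially by blast
  \<comment> \<open>A multiple of \<open>l0\<close>, for the entropy rate, that is at least
    \<open>l2\<close>.\<close>
  define l where "l = Suc l2 * l0"
  have "l2 \<le> l" unfolding l_def using l0(1) by (metis Suc_leD le_trans mult.commute mult_le_mono1 nat_mult_1 One_nat_def Suc_leI)
  note l = l2[OF this]
  have l_pos: "0 < real l" using l by simp
  have ent_l: "ent l \<le> (h + \<epsilon>) * real l" unfolding l_def by (rule l0(2)) simp
  define \<tau> where "\<tau> = exp (- \<kappa> * real l)"
  have \<tau>: "0 < \<tau>" "\<tau> < 1" "- ln \<tau> = \<kappa> * real l" unfolding \<tau>_def using \<kappa> l_pos by auto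
  \<comment> \<open>Makes \<xi> comparable to \<open>B ^ l\<close> from both sides. The upper bound
    controls the truncation of \<open>g'\<close>; the lower bound makes \<open>v\<close> of order
    \<open>B ^ - l\<close>, which cancels the factor \<open>b ^ l\<close> of
    \<open>good_ft_energy\<close>.\<close>
  obtain j0 where j0: "\<xi>0 * real a ^ j0 \<le> \<rho> * B ^ l" "\<rho> * B ^ l / real a < \<xi>0 * real a ^ j0"
    using greatest_power_below[of \<xi>0 "\<rho> * B ^ l" "real a"] \<xi>0 l a2 by auto
  define \<xi> where "\<xi> = \<xi>0 * real a ^ j0"
  have \<xi>: "0 < \<xi>" "\<xi> \<le> \<rho> * B ^ l" "\<rho> * B ^ l / real a < \<xi>" unfolding \<xi>_def using \<xi>0 j0 a2 by auto
  have cf_shift: "cf \<xi>0 (n + j0) = cf \<xi> n" for n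
    unfolding cf_def \<xi>_def by (simp add: power_add mult_ac)
  define M where "M = nat \<lfloor>\<xi> * B * c2 / \<theta>\<rfloor> + 1"
  have M0: "0 < real M" by (simp add: M_def)
  define v where "v = \<theta> / (\<xi> * c1 * ln B)"
  have v0: "0 < v" unfolding v_def using \<theta> \<xi> c1 B by simp
  have v: "v \<le> 1/4"
  proof -
    have "4 * \<theta> * real a \<le> (\<rho> * B ^ l) * (c1 * ln B)" using l by (simp add: mult_ac)
    also have "\<dots> \<le> (\<xi> * real a) * (c1 * ln B)"
      using \<xi>(3) a2 c1 B by (intro mult_right_mono) (auto simp: divide_less_eq)
    finally have "(4 * \<theta>) * real a \<le> (\<xi> * c1 * ln B) * real a" by (simp add: mult_ac)
    then have "4 * \<theta> \<le> \<xi> * c1 * ln B" using a2 by simp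
    then show ?thesis unfolding v_def using \<xi> c1 B by (simp add: divide_le_eq)
  qed
  \<comment> \<open>The tolerance is \<open>\<delta> / M\<close> because the deviation is paid once
    per grid frequency; \<open>M\<close> is already fixed, so \<open>L\<close> may depend on
    it.\<close>
  have "finite ((\<lambda>i. real i * \<theta>) ` {..<M})" "0 < \<delta> / real M" using \<delta> M0 by auto
  then obtain L1 where L1: "\<And>L K \<omega>. L1 \<le> L \<Longrightarrow> L \<le> K \<Longrightarrow> \<omega> \<in> (\<lambda>i. real i * \<theta>) ` {..<M} \<Longrightarrow>
    (\<Sum>i<b^K. deviation L K \<omega> i) \<le> \<delta> / real M"
    by (rule conditional_fourier_approx) blast
  obtain L where L: "L1 \<le> L" "(h - \<epsilon>) * real l \<le> ent (L + l) - ent L"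
    using ent_increment[OF h(2), of l \<epsilon> L1] l \<epsilon> by auto
  have bad: "measure N {x. \<not> good \<tau> L l (dig b (L + l) x)} \<le> 3 * \<delta>"
  proof -
    have "measure N {x. \<not> good \<tau> L l (dig b (L + l) x)} = measure N {x. \<tau>\<^sup>2 * pr L (dig b L x) < pr (L + l) (dig b (L + l) x)}"
      by (intro arg_cong[where f = "measure N"]) (auto simp: good_def dig_add_div)
    also have "\<dots> \<le> measure N {x. \<tau> ^ 3 < pr l (dig b l x)} + (2 * \<epsilon> * real l + 1) / (- ln \<tau>)"
      by (rule exceptional_blocks[OF \<tau>(1,2) ent_l L(2)])
    also have "measure N {x. \<tau> ^ 3 < pr l (dig b l x)} \<le> \<delta>" unfolding \<tau>_def using l1 l by blast
    also have "(2 * \<epsilon> * real l + 1) / (- ln \<tau>) = \<delta>\<^sup>2 + 1 / (\<kappa> * real l)"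
      unfolding \<tau>(3) \<epsilon>_def using \<kappa> l_pos by (simp add: field_simps)
    also have "1 / (\<kappa> * real l) \<le> \<delta>" using l \<kappa> l_pos by (simp add: divide_le_eq mult_ac)
    also have "\<delta>\<^sup>2 \<le> \<delta>" using \<delta> by (simp add: power2_eq_square mult_left_le)
    finally show ?thesis by simp
  qed
  \<comment> \<open>The least step for which the exponents advance by at least \<open>l\<close>, so
    that blocks are disjoint. The excess \<open>d * \<alpha> - l\<close> is at most \<alpha>, so the
    number of digits left uncovered per step stays bounded as \<open>l\<close> grows.\<close>
  define d where "d = nat \<lceil>real l / \<alpha>\<rceil>"
  have d: "0 < d" "real l \<le> real d * \<alpha>" "real d * \<alpha> \<le> real l + \<alpha>"
  proof -
    have "0 < real l / \<alpha>" using l_pos \<alpha>_pos by simp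
    then show "0 < d" unfolding d_def by simp
    have "real l / \<alpha> \<le> real d" "real d \<le> real l / \<alpha> + 1" unfolding d_def using \<open>0 < real l / \<alpha>\<close> by linarith+
    then show "real l \<le> real d * \<alpha>" "real d * \<alpha> \<le> real l + \<alpha>" using \<alpha>_pos by (auto simp: field_simps)
  qed
  \<comment> \<open>From this time on the exponent is at least \<open>L + l\<close>, so the block of
    leading digits stays clear of the last \<open>L\<close>.\<close>
  define N0 where "N0 = nat \<lceil>(real L + real l + 1) / \<alpha>\<rceil>"
  have N0: "real L + real l + 1 \<le> real N0 * \<alpha>"
  proof -
    have "(real L + real l + 1) / \<alpha> \<le> real N0" unfolding N0_def by linarith
    then show ?thesis using \<alpha>_pos by (simp add: divide_le_eq)
  qed
  obtain Jv where Jv: "\<And>J n0 c i. Jv \<le> J \<Longrightarrow> c < b ^ l \<Longrightarrow>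
    real (card {j. j < J \<and> idx l \<theta> (\<xi> * B powr frac (real (n0 + j * d) * \<alpha>)) c = i}) \<le> 8 * v * real J"
    unfolding B_def v_def by (rule idx_visits[OF \<xi>(1) \<theta>(1) v[unfolded v_def B_def] d(1)]) blast
  \<comment> \<open>The second entry makes the initial \<open>N0 * \<alpha>\<close> digits at most
    one per step.\<close>
  define J0 where "J0 = max Jv (nat \<lceil>real N0 * \<alpha>\<rceil>) + 1"
  have final: "norm (\<Sum>j<J. cf \<xi> (n0 + j * d)) \<le> 9 * \<delta> * real J" if J: "J0 \<le> J" and n0: "N0 \<le> n0" "n0 < N0 + d" for J n0
  proof -
    define w where "w j = \<xi> * B powr frac (real (n0 + j * d) * \<alpha>)" for j
    define k where "k j = nat \<lfloor>real (n0 + j * d) * \<alpha>\<rfloor>" for j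
    \<comment> \<open>The exponents increase, so the last one is a level common to all
      \<open>J\<close> times.\<close>
    define K where "K = k (J - 1)"
    have J1: "1 \<le> J" "Jv \<le> J" "real N0 * \<alpha> \<le> real J" using J unfolding J0_def by linarith+
    have w: "\<xi> \<le> w j" "w j \<le> \<xi> * B" "0 < w j" for j
    proof -
      have "1 \<le> B powr frac (real (n0 + j * d) * \<alpha>)" using B by (intro ge_one_powr_ge_zero) auto
      moreover have "B powr frac (real (n0 + j * d) * \<alpha>) \<le> B powr 1"
        using B frac_lt_1[of "real (n0 + j * d) * \<alpha>"] by (intro powr_mono) auto
      ultimately have "\<xi> * 1 \<le> w j" "w j \<le> \<xi> * B" unfolding w_def using \<xi> B by (intro mult_left_mono; simp)+
      then show "\<xi> \<le> w j" "w j \<le> \<xi> * B" "0 < w j" using \<xi> by auto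
    qed
    have wk: "\<xi> * real a ^ (n0 + j * d) = w j * real b ^ k j" for j
      unfolding w_def k_def B_def using a_power_split[of "n0 + j * d"] by simp
    have k_ge: "L + l \<le> k j" for j
    proof -
      have "real N0 * \<alpha> \<le> real (n0 + j * d) * \<alpha>" using n0 \<alpha>_pos by (intro mult_right_mono of_nat_mono) auto
      then have "real (L + l) \<le> real (n0 + j * d) * \<alpha>" using N0 by simp
      then show ?thesis unfolding k_def by (simp add: le_nat_floor)
    qed
    have k_step: "k j + l \<le> k (Suc j)" for j
    proof -
      have "real (k j) \<le> real (n0 + j * d) * \<alpha>" unfolding k_def using \<alpha>_pos by (simp add: of_nat_floor)
      moreover have "real (n0 + Suc j * d) * \<alpha> = real (n0 + j * d) * \<alpha> + real d * \<alpha>" by (simp add: algebra_simps)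
      ultimately have "real (k j + l) \<le> real (n0 + Suc j * d) * \<alpha>" using d(2) by simp
      then show ?thesis unfolding k_def[of "Suc j"] by (rule le_nat_floor)
    qed
    have k_le: "k j \<le> K" if "j < J" for j
    proof -
      have "k j \<le> k i" if "j \<le> i" for i using that
      proof (induction rule: dec_induct)
        case (step i) then show ?case using k_step[of i] by linarith
      qed simp
      then show ?thesis unfolding K_def using that by simp
    qed
    have LK: "L \<le> K" using k_ge[of "J - 1"] unfolding K_def by linarith
    have Kle: "real K \<le> real J * (1 + real l + \<alpha>)"
    proof -
      have "real K \<le> real (n0 + (J - 1) * d) * \<alpha>" unfolding K_def k_def using \<alpha>_pos by (simp add: of_nat_floor)
      also have "\<dots> \<le> real (N0 + J * d) * \<alpha>"
      proof (intro mult_right_mono of_nat_mono)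
        have "n0 + (J - 1) * d \<le> N0 + d + (J - 1) * d" using n0 by simp
        also have "\<dots> = N0 + J * d" using J1 by (cases J) auto
        finally show "n0 + (J - 1) * d \<le> N0 + J * d" .
      qed (use \<alpha>_pos in simp)
      also have "\<dots> = real N0 * \<alpha> + real J * (real d * \<alpha>)" by (simp add: algebra_simps)
      also have "\<dots> \<le> real J + real J * (real l + \<alpha>)" using J1 d by (intro add_mono mult_left_mono) auto
      finally show ?thesis by (simp add: algebra_simps)
    qed
    have idxM: "idx l \<theta> (w j) c < M" if "c < b ^ l" for j c
    proof -
      have "w j * \<bar>g' (real c / real b ^ l)\<bar> / \<theta> \<le> (\<xi> * B) * c2 / \<theta>"
        using w[of j] g'_bounds cell_unit[OF that] \<theta> \<xi> B by (intro divide_right_mono mult_mono) auto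
      then have "idx l \<theta> (w j) c \<le> nat \<lfloor>\<xi> * B * c2 / \<theta>\<rfloor>" unfolding idx_def by (intro nat_mono floor_mono)
      then show ?thesis unfolding M_def by simp
    qed
    define S where "S = \<tau>\<^sup>2 * (3 * real M + 2 * real b ^ l / \<theta> * (1 + real l * ln (real b)))"
    have phis: "(\<Sum>j<J. phi \<tau> L l \<theta> (w j) c z) \<le> 8 * v * real J * S" if "c < b ^ l" "z < b ^ L" for c z
      unfolding S_def
    proof (rule sum_phi_le[OF \<theta> that(2)])
      show "idx l \<theta> (w j) c < M" for j using idxM that by blast
      show "real (card {j. j < J \<and> idx l \<theta> (w j) c = i}) \<le> 8 * v * real J" for i
        unfolding w_def using Jv[OF J1(2) that(1)] .
    qed
    \<comment> \<open>Since \<open>exp \<beta> = 1 / \<tau>\<close>, the amplification consumes one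
      of the two factors \<tau> in \<open>S\<close>; the other one beats
      \<open>D * (1 + l * ln B)\<close>.\<close>
    define \<beta> where "\<beta> = \<kappa> * real l"
    have \<beta>: "0 < \<beta>" "exp \<beta> * \<tau>\<^sup>2 = \<tau>" unfolding \<beta>_def \<tau>_def using \<kappa> l_pos by (auto simp: power2_eq_square simp flip: exp_add)
    have vS: "exp \<beta> * (8 * v * S) \<le> 1"
    proof -
      have vM: "v * real M \<le> B * c2 / (c1 * ln B) + 1"
      proof -
        have "real M \<le> \<xi> * B * c2 / \<theta> + 1" unfolding M_def using \<xi> B c2 \<theta> by (simp add: of_nat_floor)
        then have "v * real M \<le> v * (\<xi> * B * c2 / \<theta> + 1)" using v0 by (intro mult_left_mono) auto
        also have "\<dots> = B * c2 / (c1 * ln B) + v" unfolding v_def using \<xi> \<theta> c1 B by (simp add: field_simps)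
        finally show ?thesis using v by simp
      qed
      have vB: "v * (B ^ l / \<theta>) \<le> real a / (\<rho> * c1 * ln B)"
      proof -
        have "v * (B ^ l / \<theta>) = B ^ l / (\<xi> * (c1 * ln B))" unfolding v_def using \<theta> by (simp add: mult_ac)
        also have "\<dots> \<le> B ^ l / ((\<rho> * B ^ l / real a) * (c1 * ln B))"
          using \<xi> \<rho> B c1 a2 by (intro divide_left_mono mult_right_mono mult_pos_pos divide_pos_pos) auto
        also have "\<dots> = real a / (\<rho> * c1 * ln B)" using B a2 \<rho> c1 by (simp add: field_simps)
        finally show ?thesis .
      qed
      define m where "m = 1 + real l * ln B"
      have m: "1 \<le> m" unfolding m_def using B by simp
      have "8 * v * S = \<tau>\<^sup>2 * (8 * (3 * (v * real M) + 2 * (v * (B ^ l / \<theta>)) * m))"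
        unfolding S_def m_def B_def by (simp add: algebra_simps)
      also have "\<dots> \<le> \<tau>\<^sup>2 * (8 * (3 * (B * c2 / (c1 * ln B) + 1) * m + 2 * (real a / (\<rho> * c1 * ln B)) * m))"
      proof (intro mult_left_mono add_mono)
        have "3 * (v * real M) \<le> 3 * (B * c2 / (c1 * ln B) + 1) * 1" using vM by simp
        also have "\<dots> \<le> 3 * (B * c2 / (c1 * ln B) + 1) * m" using m B c1 c2 by (intro mult_left_mono) auto
        finally show "3 * (v * real M) \<le> 3 * (B * c2 / (c1 * ln B) + 1) * m" .
        show "2 * (v * (B ^ l / \<theta>)) * m \<le> 2 * (real a / (\<rho> * c1 * ln B)) * m" using vB m by (intro mult_right_mono mult_left_mono) auto
      qed auto
      also have "\<dots> = \<tau>\<^sup>2 * (D * m)" unfolding D_def by (simp only: distrib_left distrib_right mult.assoc)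
      finally have "exp \<beta> * (8 * v * S) \<le> exp \<beta> * (\<tau>\<^sup>2 * (D * m))" by (intro mult_left_mono) auto
      also have "\<dots> = \<tau> * (D * m)" using \<beta>(2) by (simp only: mult.assoc[symmetric])
      also have "\<dots> \<le> 1" unfolding \<tau>_def m_def using l by blast
      finally show ?thesis .
    qed
    let ?c = "\<lambda>j x. dig b K x div b ^ (k j - l) mod b ^ l" and ?z = "\<lambda>x. dig b K x mod b ^ L"
    let ?I = "\<lambda>j. \<integral>x. phi \<tau> L l \<theta> (w j) (?c j x) (?z x) \<partial>N"
    have dec: "(\<Sum>j<J. \<integral>x. \<beta> * phi \<tau> L l \<theta> (w j) (?c j x) (?z x) \<partial>N) \<le>
        real J + real J * ent l + (real K - real J * real l) * ln (real b) - ent K"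
    proof (rule decoupling)
      show "k j - l + l \<le> k (Suc j) - l" for j using k_ge[of j] k_step[of j] by linarith
      show "L \<le> k j - l" for j using k_ge[of j] by linarith
      show "k j - l + l \<le> K" if "j < J" for j using k_le[OF that] k_ge[of j] by linarith
      show "L \<le> K" by (rule LK)
      fix z assume z: "z < b ^ L"
      have "(\<Sum>j<J. \<Sum>c<b^l. pr l c * (exp (\<beta> * phi \<tau> L l \<theta> (w j) c z) - 1)) \<le>
        (\<Sum>j<J. \<Sum>c<b^l. pr l c * (exp \<beta> * phi \<tau> L l \<theta> (w j) c z))"
        by (intro sum_mono mult_left_mono exp_mult_minus_one_le phi_nonneg phi_le_1) auto
      also have "\<dots> = (\<Sum>c<b^l. \<Sum>j<J. pr l c * (exp \<beta> * phi \<tau> L l \<theta> (w j) c z))" by (rule sum.swap)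
      also have "\<dots> = (\<Sum>c<b^l. pr l c * (exp \<beta> * (\<Sum>j<J. phi \<tau> L l \<theta> (w j) c z)))"
        by (simp only: sum_distrib_left)
      also have "\<dots> \<le> (\<Sum>c<b^l. pr l c * (exp \<beta> * (8 * v * real J * S)))"
        using phis z by (intro sum_mono mult_left_mono) auto
      also have "\<dots> = exp \<beta> * (8 * v * real J * S)"
        by (simp only: sum_distrib_right[symmetric] sum_pr mult_1_left)
      also have "\<dots> = exp \<beta> * (8 * v * S) * real J" by (simp only: mult_ac)
      also have "\<dots> \<le> 1 * real J" using vS by (intro mult_right_mono) auto
      finally show "(\<Sum>j<J. \<Sum>c<b^l. pr l c * (exp (\<beta> * phi \<tau> L l \<theta> (w j) c z) - 1)) \<le> real J" by simp
    qed
    have Is: "(\<Sum>j<J. ?I j) \<le> \<delta>\<^sup>2 * real J"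
    proof -
      have JK: "real J * real l \<le> real K"
      proof -
        have "i * l \<le> k i" for i
        proof (induction i)
          case (Suc i) then show ?case using k_step[of i] by simp
        qed simp
        from this[of "J - 1"] have "(J - 1) * l \<le> K" unfolding K_def .
        have ki: "i * l + (L + l) \<le> k i" for i
        proof (induction i)
          case 0 then show ?case using k_ge[of 0] by simp
        next
          case (Suc i) then show ?case using k_step[of i] by simp
        qed
        from ki[of "J - 1"] have "(J - 1) * l + l \<le> K" unfolding K_def by linarith
        then have "J * l \<le> K" using J1 by (cases J) auto
        then show ?thesis by (metis of_nat_le_iff of_nat_mult)
      qed
      have "\<beta> * (\<Sum>j<J. ?I j) = (\<Sum>j<J. \<integral>x. \<beta> * phi \<tau> L l \<theta> (w j) (?c j x) (?z x) \<partial>N)"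
        by (simp add: sum_distrib_left)
      also note dec
      \<comment> \<open>Upper rate \<open>h + \<epsilon>\<close> for each block against the lower
        rate \<open>h\<close> for all \<open>K \<ge> J * l\<close> digits: the main terms cancel,
        leaving \<open>\<epsilon> * l\<close> plus a constant per step.\<close>
      also have "real J + real J * ent l + (real K - real J * real l) * ln (real b) - ent K \<le>
        real J + real J * ((h + \<epsilon>) * real l) + (real J * (1 + \<alpha>)) * ln B - h * (real J * real l)"
      proof -
        have "real J * ent l \<le> real J * ((h + \<epsilon>) * real l)" using ent_l by (intro mult_left_mono) auto
        moreover have "(real K - real J * real l) * ln (real b) \<le> (real J * (1 + \<alpha>)) * ln B"
          unfolding B_def using Kle b2 by (intro mult_right_mono) (auto simp: algebra_simps)
        moreover have "h * (real J * real l) \<le> h * real K" using JK h(1) by (intro mult_left_mono) auto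
        ultimately show ?thesis using h(2)[of K] by linarith
      qed
      also have "\<dots> = real J * (1 + (1 + \<alpha>) * ln B + \<epsilon> * real l)" by (simp add: algebra_simps)
      also have "\<dots> \<le> real J * (\<delta>\<^sup>2 * \<beta>)"
      proof (intro mult_left_mono)
        have "\<epsilon> * real l = \<delta>\<^sup>2 * \<kappa> * real l / 2" unfolding \<epsilon>_def by simp
        moreover have "2 * (1 + (1 + \<alpha>) * ln B) \<le> \<delta>\<^sup>2 * \<kappa> * real l" using l by blast
        moreover have "x + y \<le> z" if "y = z / 2" "2 * x \<le> z" for x y z :: real using that by argo
        ultimately have "1 + (1 + \<alpha>) * ln B + \<epsilon> * real l \<le> \<delta>\<^sup>2 * \<kappa> * real l" by blast
        then show "1 + (1 + \<alpha>) * ln B + \<epsilon> * real l \<le> \<delta>\<^sup>2 * \<beta>" unfolding \<beta>_def by (simp add: mult.assoc)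
      qed simp
      finally have "\<beta> * (\<Sum>j<J. ?I j) \<le> \<beta> * (\<delta>\<^sup>2 * real J)" by (simp add: mult_ac)
      then show ?thesis using \<beta>(1) by simp
    qed
    \<comment> \<open>The 8 consists of one \<delta> each for the Taylor remainder, the truncation
      of \<open>g'\<close>, the grid, the deviation and the splitting into squares, and three for
      the cells that are not good. The averaged \<open>phi\<close> later adds the ninth.\<close>
    have coeff: "norm (cf \<xi> (n0 + j * d)) \<le> 8 * \<delta> + ?I j / \<delta>" if "j < J" for j
    proof -
      have lk: "l \<le> k j" using k_ge[of j] by linarith
      have 1: "norm (cf \<xi> (n0 + j * d)) \<le> 2 * pi * w j * C / real b ^ k j + 2 * pi * (w j * C / real b ^ l + \<theta>) + real M * (\<delta> / real M)
        + measure N {x. \<not> good \<tau> L l (dig b (L + l) x)} + \<delta> + ?I j / \<delta>"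
      proof (rule coefficient_bound[OF LK lk k_le[OF that] w(3) wk \<theta>(1) \<delta>(1)])
        show "idx l \<theta> (w j) c < M" if "c < b ^ l" for c using idxM that by blast
        show "(\<Sum>I<b^K. deviation L K (real i * \<theta>) I) \<le> \<delta> / real M" if "i < M" for i
          using L1[OF L(1) LK, of "real i * \<theta>"] that by blast
      qed
      have pi8: "2 * pi \<le> 7" using pi_approx by simp
      have 2: "2 * pi * (w j * C / real b ^ l) \<le> \<delta>"
      proof -
        have "w j * C / real b ^ l \<le> (\<rho> * B ^ l * B) * C / B ^ l"
        proof -
          have "w j \<le> \<rho> * B ^ l * B" using w(2)[of j] \<xi>(2) B by (meson mult_right_mono less_imp_le order_trans)
          then show ?thesis unfolding B_def[symmetric] using C0 B by (intro divide_right_mono mult_right_mono) auto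
        qed
        also have "\<dots> = \<rho> * B * C" using B by simp
        also have "\<dots> \<le> \<delta> / 7"
        proof -
          have "\<rho> * B * C = \<delta> / 7 * (C / (C + 1))" unfolding \<rho>_def using B by simp
          also have "\<dots> \<le> \<delta> / 7 * 1" using \<delta> C0 by (intro mult_left_mono) (auto simp: divide_le_eq)
          finally show ?thesis by simp
        qed
        finally have "2 * pi * (w j * C / real b ^ l) \<le> 7 * (\<delta> / 7)"
          using pi8 w(3)[of j] C0 by (intro mult_mono) auto
        then show ?thesis by simp
      qed
      have 3: "2 * pi * w j * C / real b ^ k j \<le> \<delta>"
      proof -
        have "real b ^ l \<le> real b ^ k j" using lk b2 by (intro power_increasing) auto
        then have "2 * pi * w j * C / real b ^ k j \<le> 2 * pi * w j * C / real b ^ l"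
          using w(3)[of j] C0 by (intro divide_left_mono) auto
        also have "\<dots> = 2 * pi * (w j * C / real b ^ l)" by simp
        finally show ?thesis using 2 by linarith
      qed
      have 4: "2 * pi * \<theta> \<le> \<delta>"
        using mult_right_mono[OF pi8, of \<theta>] \<theta>(1) unfolding \<theta>_def by simp
      have 5: "real M * (\<delta> / real M) = \<delta>" using M0 by simp
      have 6: "2 * pi * (w j * C / real b ^ l + \<theta>) = 2 * pi * (w j * C / real b ^ l) + 2 * pi * \<theta>" by (simp add: distrib_left)
      show ?thesis using 1 2 3 4 bad unfolding 5 6 by linarith
    qed
    have "norm (\<Sum>j<J. cf \<xi> (n0 + j * d)) \<le> (\<Sum>j<J. 8 * \<delta> + ?I j / \<delta>)"
      using coeff by (intro order_trans[OF norm_sum] sum_mono) auto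
    also have "\<dots> = real J * (8 * \<delta>) + (\<Sum>j<J. ?I j) / \<delta>"
      by (simp add: sum.distrib sum_divide_distrib)
    also have "\<dots> \<le> real J * (8 * \<delta>) + (\<delta>\<^sup>2 * real J) / \<delta>"
      using Is \<delta> by (intro add_left_mono divide_right_mono) auto
    also have "\<dots> = 9 * \<delta> * real J" using \<delta> by (simp add: power2_eq_square)
    finally show ?thesis .
  qed
  show ?thesis
  proof (intro exI conjI allI impI ballI)
    show "0 < d" by (rule d(1))
    fix J n0 assume J: "J0 \<le> J" and n0: "n0 \<in> {N0 + j0..<N0 + j0 + d}"
    have "(\<Sum>j<J. cf \<xi>0 (n0 + j * d)) = (\<Sum>j<J. cf \<xi> ((n0 - j0) + j * d))"
    proof (rule sum.cong[OF refl])
      fix j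
      have "n0 + j * d = ((n0 - j0) + j * d) + j0" using n0 by auto
      then show "cf \<xi>0 (n0 + j * d) = cf \<xi> ((n0 - j0) + j * d)" by (simp only: cf_shift)
    qed
    then show "norm (\<Sum>j<J. cf \<xi>0 (n0 + j * d)) \<le> 9 * \<delta> * real J"
      using final[OF J, of "n0 - j0"] n0 by auto
  qed
qed

lemma norm_cf_le_1: "norm (cf \<xi> n) \<le> 1"
proof -
  have "norm (cf \<xi> n) \<le> (\<integral>x. norm (ee (\<xi> * real a ^ n * g x)) \<partial>N)"
    unfolding cf_def by (rule integral_norm_bound)
  then show ?thesis using prob_space by simp
qed

lemma cesaro_cf: "0 < \<xi> \<Longrightarrow> (\<lambda>n. (\<Sum>i<n. cf \<xi> i) / of_nat n) \<longlonglongrightarrow> 0"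
proof (rule cesaro_of_progressions)
  fix \<delta> :: real assume "0 < \<xi>" "0 < \<delta>"
  then have *: "0 < min 1 (\<delta> / 9)" "min 1 (\<delta> / 9) \<le> 1" by auto
  from progression_bound[OF \<open>0 < \<xi>\<close> this] obtain N0 d J0 where d: "0 < d" and
    bd: "\<And>J n0. J0 \<le> J \<Longrightarrow> n0 \<in> {N0..<N0+d} \<Longrightarrow> norm (\<Sum>j<J. cf \<xi> (n0 + j * d)) \<le> 9 * min 1 (\<delta> / 9) * real J"
    by blast
  have "9 * min 1 (\<delta> / 9) * real J \<le> \<delta> * real J" for J by (intro mult_right_mono) auto
  then show "\<exists>N0 q J0. 0 < q \<and> (\<forall>J\<ge>J0. \<forall>n0\<in>{N0..<N0+q}. norm (\<Sum>j<J. cf \<xi> (n0 + j * q)) \<le> \<delta> * real J)"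
    using d bd order_trans by blast
qed (rule norm_cf_le_1)

end

section \<open>Local dimension\<close>

lemma real_prob_spaceD:
  assumes "borel_prob_on_unit_interval \<mu>"
  shows "prob_space \<mu>" "space \<mu> = {0..1}" "sets \<mu> = sets (restrict_space borel {0..1})"
    "f \<in> borel_measurable borel \<Longrightarrow> f \<in> borel_measurable \<mu>"
proof -
  show p: "prob_space \<mu>" and s: "sets \<mu> = sets (restrict_space borel {0..1})"
    using assms by (auto simp: borel_prob_on_unit_interval_def)
  show "space \<mu> = {0..1}" using sets_eq_imp_space_eq[OF s] by (simp add: space_restrict_space)
  show "f \<in> borel_measurable \<mu>" if "f \<in> borel_measurable borel"
    using measurable_restrict_space1[OF that] measurable_cong_sets[OF s refl] by blast
qed

lemma emeasure_extend_to_real: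
  assumes "borel_prob_on_unit_interval \<mu>" "A \<in> sets borel"
  shows "emeasure (extend_to_real \<mu>) A = emeasure \<mu> (A \<inter> {0..1})"
proof -
  have "(\<lambda>x. x) \<in> borel_measurable \<mu>" by (rule real_prob_spaceD(4)[OF assms(1)]) simp
  then show ?thesis
    unfolding extend_to_real_def using assms(2) real_prob_spaceD(2)[OF assms(1)] by (subst emeasure_distr) auto
qed

lemma AE_extend_to_real:
  assumes \<mu>: "borel_prob_on_unit_interval \<mu>" and P: "AE x in \<mu>. P x"
  shows "AE x in extend_to_real \<mu>. 0 \<le> x \<and> x \<le> 1 \<and> P x"
proof -
  obtain A where A: "{x \<in> space \<mu>. \<not> P x} \<subseteq> A" "emeasure \<mu> A = 0" "A \<in> sets \<mu>"
    using P by (rule AE_E)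
  then obtain A' where A': "A = A' \<inter> {0..1}" "A' \<in> sets borel"
    unfolding real_prob_spaceD(3)[OF \<mu>] by (auto simp: sets_restrict_space)
  have "emeasure (extend_to_real \<mu>) (A \<union> - {0..1}) = emeasure \<mu> ((A \<union> - {0..1}) \<inter> {0..1})"
    using A' by (intro emeasure_extend_to_real[OF \<mu>]) auto
  also have "(A \<union> - {0..1}) \<inter> {0..1} = A" using A' by auto
  finally show ?thesis
    using A A' real_prob_spaceD(2)[OF \<mu>]
    by (intro AE_I[of _ _ "A \<union> - {0..1}"]) (auto simp: extend_to_real_def)
qed

lemma digit_system_extend_to_real:
  assumes \<mu>: "borel_prob_on_unit_interval \<mu>" and T: "invariant_measure \<mu> (times_mod1 (int b))" and b: "2 \<le> b"
  shows "digit_system (extend_to_real \<mu>) b"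
proof -
  note p = real_prob_spaceD[OF \<mu>]
  let ?N = "extend_to_real \<mu>" and ?T = "\<lambda>x. frac (real b * x)"
  have times: "times_mod1 (int b) = ?T" by (auto simp: times_mod1_def)
  have T1: "?T \<in> measurable \<mu> \<mu>" "distr \<mu> \<mu> ?T = \<mu>" using T by (auto simp: invariant_measure_def times)
  have id: "(\<lambda>x. x) \<in> borel_measurable \<mu>" by (rule p(4)) simp
  have sets: "sets ?N = sets borel" by (simp add: extend_to_real_def)
  have prob: "prob_space ?N" unfolding extend_to_real_def by (rule prob_space.prob_space_distr[OF p(1) id])
  have inv: "distr ?N borel ?T = ?N"
  proof -
    have "distr ?N borel ?T = distr \<mu> borel (?T \<circ> (\<lambda>x. x))"
      unfolding extend_to_real_def by (rule distr_distr) (auto intro: id)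
    also have "\<dots> = distr \<mu> borel ((\<lambda>x. x) \<circ> ?T)" by (simp add: o_def)
    also have "\<dots> = distr (distr \<mu> \<mu> ?T) borel (\<lambda>x. x)" by (rule distr_distr[symmetric]) (auto intro: id T1)
    finally show ?thesis by (simp add: T1 extend_to_real_def)
  qed
  \<comment> \<open>The endpoint 1 is the only point of [0, 1] not fixed by \<open>frac\<close>. It
    is never a value of \<open>frac\<close>, so invariance forces it to be null.\<close>
  have "emeasure ?N {1} = emeasure (distr ?N borel ?T) {1}" by (simp only: inv)
  also have "\<dots> = emeasure ?N (?T -` {1} \<inter> space ?N)"
    by (rule emeasure_distr) (auto simp: sets cong: measurable_cong_sets)
  also have "?T -` {1} = {}" using frac_lt_1 by (auto simp: less_le)
  finally have "emeasure ?N {1} = 0" by simp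
  then have one: "AE x in ?N. x \<noteq> 1" by (intro AE_I[of _ _ "{1}"]) (auto simp: sets)
  have unit: "AE x in ?N. frac x = x"
    using AE_extend_to_real[OF \<mu>, of "\<lambda>_. True"] one by (auto simp: frac_eq less_le)
  show ?thesis
    using prob sets b unit inv by (intro digit_system.intro digit_system_axioms.intro) auto
qed

lemma intermediate_dimension_extend_to_real:
  assumes \<mu>: "borel_prob_on_unit_interval \<mu>" and d: "intermediate_dimension \<mu>"
  shows "AE x in extend_to_real \<mu>. \<exists>D. ((\<lambda>r. ln (measure (extend_to_real \<mu>) (ball x r)) / ln r) \<longlongrightarrow> D) (at_right 0) \<and> 0 < D \<and> D < 1"
proof -
  have "measure \<mu> (ball x r \<inter> space \<mu>) = measure (extend_to_real \<mu>) (ball x r)" for x r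
    using emeasure_extend_to_real[OF \<mu>, of "ball x r"] real_prob_spaceD(2)[OF \<mu>] by (simp add: measure_def)
  then have "AE x in \<mu>. \<exists>D. ((\<lambda>r. ln (measure (extend_to_real \<mu>) (ball x r)) / ln r) \<longlongrightarrow> D) (at_right 0) \<and> 0 < D \<and> D < 1"
    using d by (simp add: intermediate_dimension_def has_local_dimension_def)
  from AE_extend_to_real[OF \<mu> this] show ?thesis by auto
qed

lemma (in prob_space) AE_increasing_union:
  assumes V: "\<And>n. V n \<in> sets M" "incseq V" and AE: "AE x in M. \<exists>n. x \<in> V n" and "0 < \<epsilon>"
  obtains n0 where "\<And>n. n0 \<le> n \<Longrightarrow> 1 - \<epsilon> < measure M (V n)"
proof -
  have "(\<lambda>n. measure M (V n)) \<longlonglongrightarrow> measure M (\<Union>n. V n)"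
    using V by (intro finite_Lim_measure_incseq) auto
  moreover have "measure M (\<Union>n. V n) = 1"
    using AE V by (intro prob_eq_1[THEN iffD2]) auto
  ultimately have "eventually (\<lambda>n. 1 - \<epsilon> < measure M (V n)) sequentially"
    using assms(4) by (intro order_tendstoD(1)) auto
  then show thesis using that unfolding eventually_sequentially by blast
qed

section \<open>From local dimension to uniform bounds on cells\<close>

lemma measurable_measure_ball:
  fixes N :: "real measure"
  assumes "prob_space N" and [measurable_cong]: "sets N = sets borel"
  shows "(\<lambda>x. measure N (ball x r)) \<in> borel_measurable borel"
proof -
  interpret prob_space N by fact
  have "{p \<in> space (borel \<Otimes>\<^sub>M N). dist (fst p) (snd p) < r} \<in> sets (borel \<Otimes>\<^sub>M N)"
    by measurable
  from measurable_emeasure_Pair[OF this]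
  have "(\<lambda>x. emeasure N (Pair x -` {p \<in> space (borel \<Otimes>\<^sub>M N). dist (fst p) (snd p) < r})) \<in> borel_measurable borel" .
  moreover have "Pair x -` {p \<in> space (borel \<Otimes>\<^sub>M N). dist (fst p) (snd p) < r} = ball x r" for x
    using sets_eq_imp_space_eq[OF assms(2)] by (auto simp: space_pair_measure)
  ultimately show ?thesis unfolding measure_def by simp
qed

lemma filterlim_inverse_at_right:
  assumes "filterlim f at_top F"
  shows "filterlim (\<lambda>n. 1 / f n :: real) (at_right 0) F"
  using filterlim_compose[OF filterlim_inverse_at_right_top assms] by (simp add: inverse_eq_divide)

text \<open>The sets \<open>V n\<close>, on which balls of radius \<open>b ^ - l\<close> decay at
  rate \<open>1 / (n + 1)\<close> from level \<open>n + 1\<close> on, exhaust almost every point, so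
  a single \<open>n\<close> serves up to mass \<delta>. Up to a null set, a level-\<open>l\<close>
  cell lies in the ball of radius \<open>b ^ - l\<close> about each of its points.\<close>

lemma (in digit_system) small_cells:
  assumes dim: "AE x in N. \<exists>D. ((\<lambda>r. ln (measure N (ball x r)) / ln r) \<longlongrightarrow> D) (at_right 0) \<and> 0 < D"
    and "0 < \<delta>"
  shows "\<exists>\<kappa>>0. \<exists>l1. \<forall>l\<ge>l1. measure N {x. exp (- \<kappa> * real l) ^ 3 < pr l (dig b l x)} \<le> \<delta>"
proof -
  let ?m = "\<lambda>l x. measure N (ball x (1 / real b ^ l))"
  have [measurable]: "?m l \<in> borel_measurable borel" for l
    by (intro measurable_measure_ball sets_N) unfold_locales
  define V where "V n = {x. \<forall>l\<ge>Suc n. ?m l x \<le> exp (- (real l / real (Suc n)))}" for n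
  have [measurable]: "V n \<in> sets N" for n unfolding V_def by measurable
  have "incseq V"
  proof (rule incseq_SucI, safe)
    fix n x assume x: "x \<in> V n"
    have "?m l x \<le> exp (- (real l / real (Suc (Suc n))))" if "l \<ge> Suc (Suc n)" for l
    proof -
      have "?m l x \<le> exp (- (real l / real (Suc n)))" using x that by (auto simp: V_def)
      also have "\<dots> \<le> exp (- (real l / real (Suc (Suc n))))" by (simp add: frac_le)
      finally show ?thesis .
    qed
    then show "x \<in> V (Suc n)" by (simp add: V_def)
  qed
  moreover have "AE x in N. \<exists>n. x \<in> V n"
    using dim
  proof eventually_elim
    case (elim x)
    then obtain D where D: "((\<lambda>r. ln (measure N (ball x r)) / ln r) \<longlongrightarrow> D) (at_right 0)" "0 < D" by blast
    have "filterlim (\<lambda>l::nat. 1 / real b ^ l) (at_right 0) sequentially"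
    proof -
      have "filterlim (\<lambda>l::nat. 1 / c ^ l) (at_right 0) sequentially" if "1 < c" for c :: real
        using that by real_asymp
      from this[of "real b"] show ?thesis using b2 by simp
    qed
    from filterlim_compose[OF D(1) this]
    have "eventually (\<lambda>l. D / 2 < ln (?m l x) / ln (1 / real b ^ l)) sequentially"
      using D(2) by (intro order_tendstoD(1)) auto
    then obtain l1 where l1: "\<And>l. l1 \<le> l \<Longrightarrow> D / 2 < ln (?m l x) / ln (1 / real b ^ l)"
      unfolding eventually_sequentially by blast
    have lnb: "0 < ln (real b)" using b2 by simp
    define n where "n = l1 + nat \<lceil>2 / (D * ln (real b))\<rceil>"
    have n: "1 / real (Suc n) \<le> D * ln (real b) / 2"
    proof -
      have "2 / (D * ln (real b)) \<le> real (Suc n)" unfolding n_def by linarith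
      then show ?thesis using D(2) lnb by (simp add: field_simps)
    qed
    have "?m l x \<le> exp (- (real l / real (Suc n)))" if "Suc n \<le> l" for l
    proof (cases "?m l x = 0")
      case False
      then have m: "0 < ?m l x" using measure_nonneg[of N "ball x (1 / real b ^ l)"] by linarith
      have "l1 \<le> l" "0 < real l" using that unfolding n_def by auto
      have "D / 2 < ln (?m l x) / (- (real l * ln (real b)))"
        using l1[OF \<open>l1 \<le> l\<close>] by (simp add: ln_div ln_realpow)
      then have "ln (?m l x) < D / 2 * (- (real l * ln (real b)))"
        using \<open>0 < real l\<close> lnb by (subst (asm) neg_less_divide_eq) (auto simp: mult_pos_pos)
      also have "\<dots> = - (real l * (D * ln (real b) / 2))" by simp
      also have "\<dots> \<le> - (real l * (1 / real (Suc n)))" using n by (intro le_imp_neg_le mult_left_mono) auto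
      finally have "ln (?m l x) \<le> - (real l / real (Suc n))" by simp
      then show ?thesis using m by (metis exp_le_cancel_iff exp_ln)
    qed simp
    then have "x \<in> V n" by (auto simp: V_def)
    then show ?case by blast
  qed
  ultimately obtain n0 where n0: "\<And>n. n0 \<le> n \<Longrightarrow> 1 - \<delta> < measure N (V n)"
    using AE_increasing_union[of V \<delta>] \<open>0 < \<delta>\<close> by (metis \<open>\<And>n. V n \<in> sets N\<close>)
  \<comment> \<open>The 3 absorbs the cube in the statement.\<close>
  let ?\<kappa> = "1 / (3 * real (Suc n0))"
  have "measure N {x. exp (- ?\<kappa> * real l) ^ 3 < pr l (dig b l x)} \<le> \<delta>" if "Suc n0 \<le> l" for l
  proof -
    have ex: "exp (- ?\<kappa> * real l) ^ 3 = exp (- (real l / real (Suc n0)))"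
    proof -
      have "3 * (- ?\<kappa> * real l) = - (real l / real (Suc n0))" by (simp add: field_simps del: of_nat_Suc)
      then show ?thesis using exp_of_nat_mult[of 3 "- ?\<kappa> * real l"] by simp
    qed
    have cell: "AE x in N. pr l (dig b l x) \<le> ?m l x"
      using AE_unit
    proof eventually_elim
      case (elim x)
      show ?case unfolding pr_def
      proof (rule finite_measure_mono_AE)
        show "AE y in N. y \<in> {y. dig b l y = dig b l x} \<longrightarrow> y \<in> ball x (1 / real b ^ l)"
          using AE_unit
        proof eventually_elim
          case (elim y)
          show ?case
          proof (clarsimp simp: dist_real_def)
            assume "dig b l y = dig b l x"
            then have "x - y = (frac (real b ^ l * x) - frac (real b ^ l * y)) / real b ^ l"
              using frac_eq_dig[of b x l] frac_eq_dig[of b y l] elim \<open>frac x = x\<close> by (simp add: add_divide_distrib diff_divide_distrib)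
            moreover have "\<bar>frac (real b ^ l * x) - frac (real b ^ l * y)\<bar> < 1"
              using frac_ge_0[of "real b ^ l * x"] frac_lt_1[of "real b ^ l * x"] frac_ge_0[of "real b ^ l * y"] frac_lt_1[of "real b ^ l * y"] by linarith
            ultimately show "\<bar>x - y\<bar> < 1 / real b ^ l" by (simp add: abs_divide divide_strict_right_mono)
          qed
        qed
      qed (simp add: sets_N)
    qed
    have "measure N {x. exp (- ?\<kappa> * real l) ^ 3 < pr l (dig b l x)} \<le> measure N (space N - V n0)"
    proof (rule finite_measure_mono_AE)
      show "AE x in N. x \<in> {x. exp (- ?\<kappa> * real l) ^ 3 < pr l (dig b l x)} \<longrightarrow> x \<in> space N - V n0"
        using cell unfolding ex
      proof eventually_elim
        case (elim x) then show ?case using that by (force simp: V_def)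
      qed
    qed measurable
    also have "\<dots> = 1 - measure N (V n0)" by (intro prob_compl) measurable
    finally show ?thesis using n0[of n0] by simp
  qed
  then show ?thesis by (intro exI[of _ ?\<kappa>] conjI exI[of _ "Suc n0"]) auto
qed

text \<open>For most points the ball of radius \<open>1 / (8 * q)\<close> has mass at least
  \<open>(8 * q) powr (- s)\<close> with a common \<open>s < 1\<close>. Such a ball is covered by
  three neighbouring cells of length \<open>1 / (8 * q)\<close>, and total mass 1 leaves room for at
  most \<open>3 * (8 * q) powr s\<close> heavy triples, which is o(\<open>q\<close>).
  \<open>U\<close> consists of the midpoints of the middle cells; half a cell is
  \<open>1 / (16 * q)\<close>, the radius on which \<open>kernel q\<close> is large.\<close>

lemma few_cells:
  fixes M :: "real measure"
  assumes "prob_space M" and sets_M [measurable_cong]: "sets M = sets borel"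
    and unit: "AE x in M. 0 \<le> x \<and> x \<le> 1"
    and dim: "AE x in M. \<exists>D. ((\<lambda>r. ln (measure M (ball x r)) / ln r) \<longlongrightarrow> D) (at_right 0) \<and> 0 < D \<and> D < 1"
    and \<epsilon>: "0 < \<epsilon>"
  obtains q :: nat and U :: "real set" where "0 < q" "finite U" "real (card U) \<le> \<epsilon> * real q"
    "1 - \<epsilon> \<le> measure M {x. \<exists>u\<in>U. \<bar>x - u\<bar> \<le> 1 / (16 * real q)}"
proof -
  interpret prob_space M by fact
  have space_M: "space M = UNIV" using sets_eq_imp_space_eq[OF sets_M] by simp
  let ?m = "\<lambda>q x. measure M (ball x (1 / (8 * real q)))"
  have [measurable]: "?m q \<in> borel_measurable borel" for q
    by (intro measurable_measure_ball sets_M) unfold_locales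
  define V where "V n = {x. \<forall>q\<ge>Suc n. (1 / (8 * real q)) powr (1 - 1 / real (Suc n)) \<le> ?m q x}" for n
  have [measurable]: "V n \<in> sets M" for n unfolding V_def by measurable
  have "incseq V"
  proof (rule incseq_SucI, safe)
    fix n x assume x: "x \<in> V n"
    have "(1 / (8 * real q)) powr (1 - 1 / real (Suc (Suc n))) \<le> ?m q x" if "q \<ge> Suc (Suc n)" for q
    proof -
      have "(1 / (8 * real q)) powr (1 - 1 / real (Suc (Suc n))) \<le> (1 / (8 * real q)) powr (1 - 1 / real (Suc n))"
        using that by (intro powr_mono') (auto simp: frac_le)
      also have "\<dots> \<le> ?m q x" using x that by (auto simp: V_def)
      finally show ?thesis .
    qed
    then show "x \<in> V (Suc n)" by (simp add: V_def)
  qed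
  moreover have "AE x in M. \<exists>n. x \<in> V n"
    using dim
  proof eventually_elim
    case (elim x)
    then obtain D where D: "((\<lambda>r. ln (measure M (ball x r)) / ln r) \<longlongrightarrow> D) (at_right 0)" "0 < D" "D < 1" by blast
    have "filterlim (\<lambda>q::nat. 1 / (8 * real q)) (at_right 0) sequentially"
      by (intro filterlim_inverse_at_right) real_asymp
    note lim = filterlim_compose[OF D(1) this]
    \<comment> \<open>The lower bound 0 excludes null balls, for which \<open>ln 0 = 0\<close> would
      make the quotient 0.\<close>
    have "eventually (\<lambda>q. 0 < ln (?m q x) / ln (1 / (8 * real q)) \<and> ln (?m q x) / ln (1 / (8 * real q)) < (1 + D) / 2) sequentially"
      using D by (intro eventually_conj order_tendstoD[OF lim]) auto
    then obtain q1 where q1: "\<And>q. q1 \<le> q \<Longrightarrow> 0 < ln (?m q x) / ln (1 / (8 * real q)) \<and> ln (?m q x) / ln (1 / (8 * real q)) < (1 + D) / 2"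
      unfolding eventually_sequentially by blast
    define n where "n = q1 + nat \<lceil>2 / (1 - D)\<rceil>"
    have n: "(1 + D) / 2 \<le> 1 - 1 / real (Suc n)"
    proof -
      have "2 / (1 - D) \<le> real (Suc n)" unfolding n_def by linarith
      then have "1 / real (Suc n) \<le> (1 - D) / 2" using D(3) by (simp add: field_simps)
      then show ?thesis by (simp add: field_simps)
    qed
    have "(1 / (8 * real q)) powr (1 - 1 / real (Suc n)) \<le> ?m q x" if "Suc n \<le> q" for q
    proof -
      have "q1 \<le> q" "0 < real q" using that unfolding n_def by auto
      have neg: "ln (1 / (8 * real q)) < 0" using that by (subst ln_less_zero_iff) auto
      have "?m q x \<noteq> 0" using q1[OF \<open>q1 \<le> q\<close>] by auto
      then have m: "0 < ?m q x" using measure_nonneg[of M "ball x (1 / (8 * real q))"] by linarith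
      have "(1 - 1 / real (Suc n)) * ln (1 / (8 * real q)) \<le> (1 + D) / 2 * ln (1 / (8 * real q))"
        using n neg by (intro mult_right_mono_neg) auto
      also have "\<dots> < ln (?m q x)" using q1[OF \<open>q1 \<le> q\<close>] neg by (simp add: neg_divide_less_eq)
      finally have "exp ((1 - 1 / real (Suc n)) * ln (1 / (8 * real q))) \<le> exp (ln (?m q x))" by simp
      then show ?thesis using m \<open>0 < real q\<close> by (simp add: powr_def)
    qed
    then have "x \<in> V n" by (auto simp: V_def)
    then show ?case by blast
  qed
  ultimately obtain n where n: "1 - \<epsilon> < measure M (V n)"
    using AE_increasing_union[of V \<epsilon>] \<epsilon> by (metis \<open>\<And>n. V n \<in> sets M\<close> order_refl)
  define s where "s = 1 - 1 / real (Suc n)"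
  have "((\<lambda>q::nat. 3 * (8 * real q) powr s / real q) \<longlongrightarrow> 0) sequentially"
  proof -
    have "0 \<le> s" "s < 1" by (auto simp: s_def)
    then show ?thesis by real_asymp
  qed
  then have "eventually (\<lambda>q. 3 * (8 * real q) powr s / real q < \<epsilon> \<and> Suc n \<le> q) sequentially"
    using \<epsilon> by (intro eventually_conj eventually_ge_at_top order_tendstoD(2)) auto
  then obtain q where q: "3 * (8 * real q) powr s / real q < \<epsilon>" "Suc n \<le> q"
    unfolding eventually_sequentially by blast
  have q0: "0 < real q" using q by simp
  let ?R = "8 * real q"
  define cell where "cell i = {y. \<lfloor>?R * y\<rfloor> = i}" for i :: int
  have [measurable]: "cell i \<in> sets M" for i unfolding cell_def by measurable
  define I where "I = {0..int (8 * q)}"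
  define W where "W = {i \<in> I. ?R powr (- s) \<le> measure M (cell (i - 1)) + measure M (cell i) + measure M (cell (i + 1))}"
  have cells: "(\<Sum>i\<in>I. measure M (cell (i + k))) \<le> 1" for k
  proof -
    have "(\<Sum>i\<in>I. measure M (cell (i + k))) = measure M (\<Union>i\<in>I. cell (i + k))"
      by (intro finite_measure_finite_Union[symmetric]) (auto simp: I_def disjoint_family_on_def cell_def)
    then show ?thesis by simp
  qed
  have finW: "finite W" by (rule finite_subset[of _ I]) (auto simp: W_def I_def)
  have "real (card W) * ?R powr (- s) = (\<Sum>i\<in>W. ?R powr (- s))" by simp
  also have "\<dots> \<le> (\<Sum>i\<in>W. measure M (cell (i - 1)) + measure M (cell i) + measure M (cell (i + 1)))"
    by (intro sum_mono) (simp add: W_def)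
  also have "\<dots> \<le> (\<Sum>i\<in>I. measure M (cell (i - 1)) + measure M (cell i) + measure M (cell (i + 1)))"
    by (intro sum_mono2) (auto simp: W_def I_def)
  also have "\<dots> \<le> 3" using cells[of "-1"] cells[of 0] cells[of 1] by (simp add: sum.distrib)
  finally have "real (card W) * ?R powr (- s) \<le> 3" .
  then have "real (card W) \<le> 3 * ?R powr s" using q0 by (simp add: powr_minus field_simps)
  also have "\<dots> \<le> \<epsilon> * real q" using q q0 by (simp add: divide_less_eq)
  finally have cardW: "real (card W) \<le> \<epsilon> * real q" .
  let ?u = "\<lambda>i::int. (of_int i + 1/2) / ?R"
  show thesis
  proof (rule that[of q "?u ` W"])
    show "0 < q" using q0 by simp
    show "finite (?u ` W)" using finW by simp
    show "real (card (?u ` W)) \<le> \<epsilon> * real q" using cardW card_image_le[OF finW, of ?u] by linarith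
    have "measure M (V n) \<le> measure M {x. \<exists>u\<in>?u ` W. \<bar>x - u\<bar> \<le> 1 / (16 * real q)}"
    proof (rule finite_measure_mono_AE)
      show "AE x in M. x \<in> V n \<longrightarrow> x \<in> {x. \<exists>u\<in>?u ` W. \<bar>x - u\<bar> \<le> 1 / (16 * real q)}"
        using unit
      proof eventually_elim
        case (elim x)
        show ?case
        proof (intro impI)
          assume x: "x \<in> V n"
          define i where "i = \<lfloor>?R * x\<rfloor>"
          have i: "of_int i \<le> ?R * x" "?R * x < of_int i + 1" unfolding i_def by linarith+
          have "i \<in> I"
          proof -
            have "0 \<le> ?R * x" "?R * x \<le> ?R * 1" using elim q0 by (auto intro!: mult_left_mono)
            then show ?thesis unfolding i_def I_def by (auto simp: le_floor_iff floor_le_iff)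
          qed
          have ball: "ball x (1 / ?R) \<subseteq> (cell (i - 1) \<union> cell i) \<union> cell (i + 1)"
          proof
            fix y assume "y \<in> ball x (1 / ?R)"
            then have "\<bar>x - y\<bar> * ?R < 1" using q0 by (simp add: dist_real_def field_simps)
            moreover have "?R * x - ?R * y = (x - y) * ?R" by (simp add: algebra_simps)
            ultimately have "\<bar>?R * x - ?R * y\<bar> < 1" using q0 by (simp add: abs_mult)
            then have "i - 1 \<le> \<lfloor>?R * y\<rfloor>" "\<lfloor>?R * y\<rfloor> \<le> i + 1" using i by linarith+
            then show "y \<in> (cell (i - 1) \<union> cell i) \<union> cell (i + 1)" unfolding cell_def by auto
          qed
          have "?R powr (- s) = (1 / ?R) powr s" using q0 by (simp add: powr_minus_divide powr_divide)
          also have "\<dots> \<le> measure M (ball x (1 / ?R))" using x q(2) unfolding V_def s_def by auto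
          also have "\<dots> \<le> measure M ((cell (i - 1) \<union> cell i) \<union> cell (i + 1))"
            by (intro finite_measure_mono ball) measurable
          also have "\<dots> \<le> measure M (cell (i - 1) \<union> cell i) + measure M (cell (i + 1))"
            by (intro measure_Un_le) measurable
          also have "measure M (cell (i - 1) \<union> cell i) \<le> measure M (cell (i - 1)) + measure M (cell i)"
            by (intro measure_Un_le) measurable
          finally have "i \<in> W" using \<open>i \<in> I\<close> by (simp add: W_def)
          moreover have "\<bar>x - ?u i\<bar> \<le> 1 / (16 * real q)"
          proof -
            have "x - ?u i = (?R * x - of_int i - 1/2) / ?R" using q0 by (simp add: field_simps)
            moreover have "\<bar>?R * x - of_int i - 1/2\<bar> \<le> 1/2" using i by linarith
            ultimately have "\<bar>x - ?u i\<bar> = \<bar>?R * x - of_int i - 1/2\<bar> / ?R" by (simp add: abs_divide)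
            also have "\<dots> \<le> (1/2) / ?R" using \<open>\<bar>?R * x - of_int i - 1/2\<bar> \<le> 1/2\<close> by (intro divide_right_mono) auto
            finally show ?thesis by simp
          qed
          ultimately show "x \<in> {x. \<exists>u\<in>?u ` W. \<bar>x - u\<bar> \<le> 1 / (16 * real q)}" by blast
        qed
      qed
      have "{x. \<exists>u\<in>?u ` W. \<bar>x - u\<bar> \<le> 1 / (16 * real q)} = (\<Union>u\<in>?u ` W. {x. \<bar>x - u\<bar> \<le> 1 / (16 * real q)})" by auto
      also have "\<dots> \<in> sets M" using finW by (intro sets.finite_UN) auto
      finally show "{x. \<exists>u\<in>?u ` W. \<bar>x - u\<bar> \<le> 1 / (16 * real q)} \<in> sets M" .
    qed
    then show "1 - \<epsilon> \<le> measure M {x. \<exists>u\<in>?u ` W. \<bar>x - u\<bar> \<le> 1 / (16 * real q)}" using n by linarith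
  qed
qed

text \<open>Take sets \<open>E k\<close> for the tolerances \<open>(1/2) ^ k\<close>. By
  Borel-Cantelli, \<open>N\<close>-almost every point lies in only finitely many of them, whereas
  the points lying in only finitely many form an \<open>M\<close>-null set.\<close>

lemma mutually_singularI:
  assumes "sets M = sets N" "finite_measure M" "finite_measure N"
    and ex: "\<And>\<epsilon>. 0 < \<epsilon> \<Longrightarrow> \<exists>E\<in>sets M. measure M (space M - E) \<le> \<epsilon> \<and> measure N E \<le> \<epsilon>"
  shows "mutually_singular M N"
proof -
  interpret M: finite_measure M by fact
  interpret N: finite_measure N by fact
  have sp: "space M = space N" using assms(1) by (rule sets_eq_imp_space_eq)
  have "\<forall>k::nat. \<exists>E. E \<in> sets M \<and> measure M (space M - E) \<le> (1/2) ^ k \<and> measure N E \<le> (1/2) ^ k"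
    using ex[of "(1/2) ^ _"] by (auto simp: Bex_def)
  then obtain E :: "nat \<Rightarrow> 'a set" where E: "\<And>k. E k \<in> sets M" "\<And>k. measure M (space M - E k) \<le> (1/2) ^ k" "\<And>k. measure N (E k) \<le> (1/2) ^ k"
    by metis
  define A where "A = {x \<in> space M. \<not> (\<exists>\<^sub>F k in sequentially. x \<in> E k)}"
  have Anon: "A = (\<Union>n. \<Inter>k\<in>{n..}. space M - E k)"
    by (auto simp: A_def not_frequently eventually_sequentially)
  have A_sets: "A \<in> sets M" unfolding Anon using E(1) by (intro sets.countable_UN sets.countable_INT' ) auto
  have "AE x in N. \<forall>\<^sub>F k in sequentially. x \<in> space N - E k"
  proof (rule borel_cantelli_AE1)
    show "E k \<in> sets N" for k using E(1) assms(1) by simp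
    show "emeasure N (E k) < \<infinity>" for k by (simp add: less_top[symmetric])
    show "summable (\<lambda>k. measure N (E k))"
      by (rule summable_comparison_test'[of "\<lambda>k. (1/2 :: real) ^ k" 0]) (auto simp: E(3))
  qed
  then have "AE x in N. x \<notin> space N - A"
    by eventually_elim (auto simp: A_def sp not_frequently elim: eventually_mono)
  then have NA: "emeasure N (space N - A) = 0"
    using A_sets assms(1) by (intro AE_iff_measurable[THEN iffD1, of "space N - A"]) auto
  have "emeasure M (\<Inter>k\<in>{n..}. space M - E k) = 0" for n
  proof -
    have "measure M (\<Inter>k\<in>{n..}. space M - E k) \<le> (1/2) ^ j" if "n \<le> j" for j
    proof -
      have "measure M (\<Inter>k\<in>{n..}. space M - E k) \<le> measure M (space M - E j)"
        using that E(1) by (intro M.finite_measure_mono) auto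
      then show ?thesis using E(2)[of j] by linarith
    qed
    then have "eventually (\<lambda>j. measure M (\<Inter>k\<in>{n..}. space M - E k) \<le> (1/2) ^ j) sequentially"
      by (auto simp: eventually_sequentially)
    moreover have "((\<lambda>j. (1/2 :: real) ^ j) \<longlongrightarrow> 0) sequentially" by (intro LIMSEQ_realpow_zero) auto
    ultimately have "measure M (\<Inter>k\<in>{n..}. space M - E k) \<le> 0"
      by (intro tendsto_lowerbound) auto
    then show ?thesis by (simp add: M.emeasure_eq_measure measure_le_0_iff)
  qed
  then have "emeasure M A = 0"
    unfolding Anon using E(1) by (intro emeasure_UN_eq_0) (auto intro!: sets.countable_INT')
  then show ?thesis using A_sets NA assms(1) by (auto simp: mutually_singular_def)
qed

section \<open>Singularity\<close>

text \<open>The Fejer kernel, scaled to the value 1 at 0; for \<open>q > 0\<close> its mean over a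
  period is \<open>1 / q\<close>.\<close>

definition kernel :: "nat \<Rightarrow> real \<Rightarrow> real" where
  "kernel q t = (norm (\<Sum>r<q. ee (real r * t)) / real q)\<^sup>2"

lemma kernel_eq_sum:
  "complex_of_real (kernel q t) = (\<Sum>r<q. \<Sum>r'<q. ee ((real r - real r') * t)) / (of_nat q)\<^sup>2"
proof -
  have "ee ((real r - real r') * t) = ee (real r * t) * cnj (ee (real r' * t))" for r r'
    by (simp add: left_diff_distrib ee_add[of _ "- _", simplified] ee_minus)
  then have "(\<Sum>r<q. \<Sum>r'<q. ee ((real r - real r') * t)) = (\<Sum>r<q. ee (real r * t)) * cnj (\<Sum>r<q. ee (real r * t))"
    by (simp add: sum_product)
  also have "\<dots> = complex_of_real ((norm (\<Sum>r<q. ee (real r * t)))\<^sup>2)"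
    by (rule complex_norm_square[symmetric])
  finally show ?thesis by (simp add: kernel_def power_divide)
qed

lemma kernel_nonneg: "0 \<le> kernel q t" by (simp add: kernel_def)

lemma kernel_le_1: "kernel q t \<le> 1"
proof -
  have "norm (\<Sum>r<q. ee (real r * t)) \<le> real q"
    using norm_sum[of "\<lambda>r. ee (real r * t)" "{..<q}"] by simp
  then have "norm (\<Sum>r<q. ee (real r * t)) / real q \<le> 1" by (cases "q = 0") (auto simp: divide_le_eq)
  then show ?thesis unfolding kernel_def by (intro power_le_one) auto
qed

lemma measurable_kernel [measurable]: "kernel q \<in> borel_measurable borel"
  unfolding kernel_def[abs_def] by measurable

lemma kernel_frac: "kernel q (frac t - u) = kernel q (t - u)"
proof -
  have "ee (real r * (frac t - u)) = ee (real r * (t - u))" for r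
  proof -
    have "real r * (t - u) = real r * (frac t - u) + of_int (int r * \<lfloor>t\<rfloor>)"
      by (simp add: frac_def algebra_simps)
    then show ?thesis by (simp only: ee_add_int)
  qed
  then show ?thesis by (simp add: kernel_def)
qed

text \<open>All phases \<open>r * t\<close> stay within 1/16 of a turn, so every summand has real
  part at least 1/2 and no cancellation occurs.\<close>

lemma kernel_ge:
  assumes "0 < q" "\<bar>t\<bar> \<le> 1 / (16 * real q)"
  shows "1/4 \<le> kernel q t"
proof -
  have "1/2 \<le> Re (ee (real r * t))" if "r < q" for r
  proof -
    have "\<bar>real r * t\<bar> \<le> real q * (1 / (16 * real q))"
      unfolding abs_mult using that assms by (intro mult_mono) auto
    also have "\<dots> = 1/16" using assms by simp
    finally have "\<bar>2 * pi * (real r * t)\<bar> \<le> 2 * pi * (1/16)" by (simp add: abs_mult)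
    also have "\<dots> \<le> pi / 3" by simp
    finally have "cos (pi / 3) \<le> cos \<bar>2 * pi * (real r * t)\<bar>" by (intro cos_monotone_0_pi_le) auto
    then show ?thesis by (simp add: ee_def cos_60)
  qed
  then have "(\<Sum>r<q. 1/2) \<le> (\<Sum>r<q. Re (ee (real r * t)))" by (intro sum_mono) auto
  then have "real q / 2 \<le> Re (\<Sum>r<q. ee (real r * t))" by simp
  also have "\<dots> \<le> norm (\<Sum>r<q. ee (real r * t))" by (rule complex_Re_le_cmod)
  finally have "1/2 \<le> norm (\<Sum>r<q. ee (real r * t)) / real q" using assms by (simp add: field_simps)
  then have "(1/2)\<^sup>2 \<le> kernel q t" unfolding kernel_def by (intro power_mono) auto
  then show ?thesis by (simp add: power2_eq_square)
qed

section \<open>Averages of the kernel along the powers of \<open>a\<close>\<close>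

context smooth_image
begin

lemma cf_minus: "cf (- \<xi>) n = cnj (cf \<xi> n)"
proof -
  have "cf (- \<xi>) n = (\<integral>x. cnj (ee (\<xi> * real a ^ n * g x)) \<partial>N)"
    unfolding cf_def by (intro Bochner_Integration.integral_cong) (auto simp: ee_minus)
  then show ?thesis by (simp add: cf_def)
qed

lemma cesaro_cf_nonzero:
  assumes "\<xi> \<noteq> 0"
  shows "(\<lambda>n. (\<Sum>i<n. cf \<xi> i) / of_nat n) \<longlonglongrightarrow> 0"
proof (cases "0 < \<xi>")
  case False
  then have "(\<lambda>n. cnj ((\<Sum>i<n. cf (- \<xi>) i) / of_nat n)) \<longlonglongrightarrow> cnj 0"
    using assms by (intro tendsto_cnj cesaro_cf) auto
  then show ?thesis by (simp add: cf_minus)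
qed (rule cesaro_cf)

lemma cf_0: "cf 0 n = 1"
  using prob_space by (simp add: cf_def)

text \<open>Expanding the square gives the frequencies \<open>r - r'\<close>. The off-diagonal ones
  average to 0 by \<open>cesaro_cf_nonzero\<close>, and the \<open>q\<close> diagonal terms over
  \<open>q\<^sup>2\<close> give the limit.\<close>

lemma integral_kernel:
  assumes "0 < q"
  shows "(\<lambda>n. (\<Sum>i<n. \<integral>x. kernel q (real a ^ i * g x - u) \<partial>N) / real n) \<longlonglongrightarrow> 1 / real q"
proof -
  define I where "I i = (\<integral>x. kernel q (real a ^ i * g x - u) \<partial>N)" for i
  define \<xi> where "\<xi> r r' = real r - real r'" for r r' :: nat
  have I: "complex_of_real (I i) = (\<Sum>r<q. \<Sum>r'<q. ee (- \<xi> r r' * u) * cf (\<xi> r r') i) / (of_nat q)\<^sup>2" for i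
  proof -
    have int: "integrable N (\<lambda>x. ee (- \<xi> r r' * u) * ee (\<xi> r r' * real a ^ i * g x))" for r r'
      by (rule integrable_bounded[where C = 1]) (simp_all add: norm_mult)
    have "complex_of_real (I i) = (\<integral>x. complex_of_real (kernel q (real a ^ i * g x - u)) \<partial>N)"
      unfolding I_def by simp
    also have "\<dots> = (\<integral>x. (\<Sum>r<q. \<Sum>r'<q. ee (- \<xi> r r' * u) * ee (\<xi> r r' * real a ^ i * g x)) / (of_nat q)\<^sup>2 \<partial>N)"
    proof (intro Bochner_Integration.integral_cong refl)
      fix x
      have "\<xi> r r' * (real a ^ i * g x - u) = - \<xi> r r' * u + \<xi> r r' * real a ^ i * g x" for r r'
        by (simp add: algebra_simps)
      then show "complex_of_real (kernel q (real a ^ i * g x - u)) = (\<Sum>r<q. \<Sum>r'<q. ee (- \<xi> r r' * u) * ee (\<xi> r r' * real a ^ i * g x)) / (of_nat q)\<^sup>2"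
        unfolding kernel_eq_sum \<xi>_def[symmetric] by (simp only: ee_add)
    qed
    also have "\<dots> = (\<Sum>r<q. \<Sum>r'<q. (\<integral>x. ee (- \<xi> r r' * u) * ee (\<xi> r r' * real a ^ i * g x) \<partial>N)) / (of_nat q)\<^sup>2"
      using int by (simp add: Bochner_Integration.integral_sum Bochner_Integration.integrable_sum)
    finally show ?thesis by (simp add: cf_def)
  qed
  have lim: "(\<lambda>n. (\<Sum>i<n. cf (\<xi> r r') i) / of_nat n) \<longlonglongrightarrow> (if r = r' then 1 else 0)" for r r'
  proof (cases "r = r'")
    case True
    have "(\<lambda>n. (\<Sum>i<n. cf (\<xi> r r') i) / of_nat n) = (\<lambda>n. if n = 0 then 0 else 1)"
      using True by (auto simp: \<xi>_def cf_0)
    moreover have "(\<lambda>n::nat. if n = 0 then 0 else 1 :: complex) \<longlonglongrightarrow> 1"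
      by (rule tendsto_eventually) (auto simp: eventually_sequentially intro: exI[of _ 1])
    ultimately show ?thesis using True by simp
  next
    case False
    then show ?thesis using cesaro_cf_nonzero[of "\<xi> r r'"] by (simp add: \<xi>_def)
  qed
  have "(\<lambda>n. (\<Sum>r<q. \<Sum>r'<q. ee (- \<xi> r r' * u) * ((\<Sum>i<n. cf (\<xi> r r') i) / of_nat n)) / (of_nat q)\<^sup>2) \<longlonglongrightarrow>
     (\<Sum>r<q. \<Sum>r'<q. ee (- \<xi> r r' * u) * (if r = r' then 1 else 0)) / (of_nat q)\<^sup>2"
    using assms by (intro tendsto_intros lim) auto
  also have "(\<Sum>r<q. \<Sum>r'<q. ee (- \<xi> r r' * u) * (if r = r' then 1 else 0)) = of_nat q"
  proof -
    have "(\<Sum>r'<q. ee (- \<xi> r r' * u) * (if r = r' then 1 else 0)) = 1" if "r < q" for r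
    proof -
      have "(\<Sum>r'<q. ee (- \<xi> r r' * u) * (if r = r' then 1 else 0)) = (\<Sum>r'<q. if r' = r then 1 else 0)"
        by (intro sum.cong) (auto simp: \<xi>_def)
      then show ?thesis using that by simp
    qed
    then show ?thesis by simp
  qed
  also have "(\<lambda>n. (\<Sum>r<q. \<Sum>r'<q. ee (- \<xi> r r' * u) * ((\<Sum>i<n. cf (\<xi> r r') i) / of_nat n)) / (of_nat q)\<^sup>2) =
     (\<lambda>n. complex_of_real ((\<Sum>i<n. I i) / real n))"
  proof
    fix n
    have "complex_of_real (\<Sum>i<n. I i) = (\<Sum>i<n. \<Sum>r<q. \<Sum>r'<q. ee (- \<xi> r r' * u) * cf (\<xi> r r') i) / (of_nat q)\<^sup>2"
      by (simp add: I sum_divide_distrib)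
    also have "(\<Sum>i<n. \<Sum>r<q. \<Sum>r'<q. ee (- \<xi> r r' * u) * cf (\<xi> r r') i) = (\<Sum>r<q. \<Sum>i<n. \<Sum>r'<q. ee (- \<xi> r r' * u) * cf (\<xi> r r') i)"
      by (rule sum.swap)
    also have "\<dots> = (\<Sum>r<q. \<Sum>r'<q. \<Sum>i<n. ee (- \<xi> r r' * u) * cf (\<xi> r r') i)"
      by (intro sum.cong refl sum.swap)
    also have "\<dots> = (\<Sum>r<q. \<Sum>r'<q. ee (- \<xi> r r' * u) * (\<Sum>i<n. cf (\<xi> r r') i))"
      by (simp only: sum_distrib_left)
    finally have eq: "complex_of_real (\<Sum>i<n. I i) = (\<Sum>r<q. \<Sum>r'<q. ee (- \<xi> r r' * u) * (\<Sum>i<n. cf (\<xi> r r') i)) / (of_nat q)\<^sup>2" .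
    have "(\<Sum>r<q. \<Sum>r'<q. ee (- \<xi> r r' * u) * ((\<Sum>i<n. cf (\<xi> r r') i) / of_nat n)) =
        (\<Sum>r<q. \<Sum>r'<q. ee (- \<xi> r r' * u) * (\<Sum>i<n. cf (\<xi> r r') i)) / of_nat n"
      by (simp only: times_divide_eq_right sum_divide_distrib[symmetric])
    then show "(\<Sum>r<q. \<Sum>r'<q. ee (- \<xi> r r' * u) * ((\<Sum>i<n. cf (\<xi> r r') i) / of_nat n)) / (of_nat q)\<^sup>2 = complex_of_real ((\<Sum>i<n. I i) / real n)"
      by (simp only: of_real_divide of_real_of_nat_eq eq) (simp only: divide_divide_eq_left mult.commute)
  qed
  also have "of_nat q / (of_nat q)\<^sup>2 = complex_of_real (1 / real q)"
    using assms by (simp add: power2_eq_square)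
  finally show ?thesis unfolding I_def by (simp only: tendsto_of_real_iff)
qed

text \<open>The time averages of the integrals tend to \<open>card U / q \<le> \<epsilon>\<close>,
  so some single time has integral at most \<open>2 * \<epsilon>\<close>; Markov's inequality at
  level 1/4 yields the factor 8.\<close>

lemma rarely_near_few_points:
  assumes q: "0 < q" and U: "finite U" "real (card U) \<le> \<epsilon> * real q" and \<epsilon>: "0 < \<epsilon>"
  obtains n where "measure N {y. 1/4 \<le> (\<Sum>u\<in>U. kernel q (real a ^ n * g y - u))} \<le> 8 * \<epsilon>"
proof -
  define \<Phi> where "\<Phi> n y = (\<Sum>u\<in>U. kernel q (real a ^ n * g y - u))" for n y
  have [measurable]: "\<Phi> n \<in> borel_measurable borel" for n unfolding \<Phi>_def by measurable
  have ik: "integrable N (\<lambda>y. kernel q (real a ^ n * g y - u))" for n u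
    using kernel_nonneg kernel_le_1 by (intro integrable_bounded[where C = 1]) auto
  have "(\<lambda>n. \<Sum>u\<in>U. (\<Sum>i<n. \<integral>x. kernel q (real a ^ i * g x - u) \<partial>N) / real n) \<longlonglongrightarrow> (\<Sum>u\<in>U. 1 / real q)"
    by (intro tendsto_sum integral_kernel q)
  also have "(\<lambda>n. \<Sum>u\<in>U. (\<Sum>i<n. \<integral>x. kernel q (real a ^ i * g x - u) \<partial>N) / real n) = (\<lambda>n. (\<Sum>i<n. \<integral>x. \<Phi> i x \<partial>N) / real n)"
  proof
    fix n
    have "(\<Sum>i<n. \<integral>x. \<Phi> i x \<partial>N) = (\<Sum>i<n. \<Sum>u\<in>U. \<integral>x. kernel q (real a ^ i * g x - u) \<partial>N)"
      unfolding \<Phi>_def using ik by (intro sum.cong refl Bochner_Integration.integral_sum)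
    also have "\<dots> = (\<Sum>u\<in>U. \<Sum>i<n. \<integral>x. kernel q (real a ^ i * g x - u) \<partial>N)" by (rule sum.swap)
    finally show "(\<Sum>u\<in>U. (\<Sum>i<n. \<integral>x. kernel q (real a ^ i * g x - u) \<partial>N) / real n) = (\<Sum>i<n. \<integral>x. \<Phi> i x \<partial>N) / real n"
      by (simp add: sum_divide_distrib)
  qed
  finally have lim: "(\<lambda>n. (\<Sum>i<n. \<integral>x. \<Phi> i x \<partial>N) / real n) \<longlonglongrightarrow> (\<Sum>u\<in>U. 1 / real q)" .
  have "(\<Sum>u\<in>U. 1 / real q) < 2 * \<epsilon>"
  proof -
    have "(\<Sum>u\<in>U. 1 / real q) \<le> \<epsilon>" using U q by (simp add: divide_le_eq)
    then show ?thesis using \<epsilon> by linarith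
  qed
  from order_tendstoD(2)[OF lim this] obtain n1 where n1: "\<And>n. n1 \<le> n \<Longrightarrow> (\<Sum>i<n. \<integral>x. \<Phi> i x \<partial>N) / real n < 2 * \<epsilon>"
    unfolding eventually_sequentially by blast
  have less: "(\<Sum>i<Suc n1. \<integral>x. \<Phi> i x \<partial>N) < 2 * \<epsilon> * real (Suc n1)"
    using n1[of "Suc n1"] by (simp add: divide_less_eq del: sum.lessThan_Suc of_nat_Suc)
  have "\<exists>n. (\<integral>x. \<Phi> n x \<partial>N) \<le> 2 * \<epsilon>"
  proof (rule ccontr)
    assume "\<not> (\<exists>n. (\<integral>x. \<Phi> n x \<partial>N) \<le> 2 * \<epsilon>)"
    then have "(\<Sum>i<Suc n1. 2 * \<epsilon>) \<le> (\<Sum>i<Suc n1. \<integral>x. \<Phi> i x \<partial>N)"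
      by (intro sum_mono) (auto simp: not_le intro: less_imp_le)
    then show False using less by (simp add: mult_ac del: sum.lessThan_Suc of_nat_Suc)
  qed
  then obtain n where n: "(\<integral>x. \<Phi> n x \<partial>N) \<le> 2 * \<epsilon>" by blast
  have nn: "0 \<le> \<Phi> n y" for y unfolding \<Phi>_def by (intro sum_nonneg kernel_nonneg)
  have "integrable N (\<Phi> n)" unfolding \<Phi>_def using ik by (intro Bochner_Integration.integrable_sum)
  then have "measure N {y \<in> space N. 1/4 \<le> \<Phi> n y} \<le> (\<integral>x. \<Phi> n x \<partial>N) / (1/4)"
    by (intro integral_Markov_inequality_measure[where A = "{}"]) (auto simp: nn)
  also have "\<dots> \<le> 8 * \<epsilon>" using n by simp
  finally show thesis using that[of n] by (simp add: \<Phi>_def)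
qed

end

text \<open>The chain rule for \<open>f\<close> composed with its inverse keeps \<open>g'\<close>
  away from 0, and compactness of [0, 1] makes the bounds uniform. \<open>C\<close> bounds the
  second derivative of the inverse; the mean value theorem lets the Lipschitz constant of
  \<open>g'\<close> serve in the Taylor estimate as well.\<close>

lemma diff2_inverse_estimates:
  assumes "f \<in> diff2"
  obtains g' C c1 c2 where "0 \<le> C" "0 < c1"
    "\<And>y h. 0 \<le> y \<Longrightarrow> 0 \<le> h \<Longrightarrow> y + h \<le> 1 \<Longrightarrow> \<bar>inv f (y + h) - inv f y - g' y * h\<bar> \<le> C * h\<^sup>2"
    "\<And>y y'. 0 \<le> y \<Longrightarrow> y \<le> 1 \<Longrightarrow> 0 \<le> y' \<Longrightarrow> y' \<le> 1 \<Longrightarrow> \<bar>g' y - g' y'\<bar> \<le> C * \<bar>y - y'\<bar>"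
    "\<And>y. 0 \<le> y \<Longrightarrow> y \<le> 1 \<Longrightarrow> c1 \<le> \<bar>g' y\<bar> \<and> \<bar>g' y\<bar> \<le> c2"
    "inv f \<in> borel_measurable borel" "f \<in> borel_measurable borel" "\<And>x. inv f (f x) = x"
proof -
  define g where "g = inv f"
  have bij: "bij f" and "C2_differentiable f" "C2_differentiable g"
    using assms by (auto simp: diff2_def g_def)
  then obtain f' g' where f': "\<And>x. (f has_real_derivative f' x) (at x)"
    and g': "\<And>x. (g has_real_derivative g' x) (at x)" and C1: "g' C1_differentiable_on UNIV"
    by (auto simp: C2_differentiable_def)
  obtain D where D: "\<And>x. (g' has_vector_derivative D x) (at x)" "continuous_on UNIV D"
    using C1 by (auto simp: C1_differentiable_on_def)
  have inv1: "g (f x) = x" for x using bij by (simp add: g_def bij_is_inj)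
  have inv2: "f (g x) = x" for x using bij by (simp add: g_def bij_is_surj surj_f_inv_f)
  have ne: "g' y \<noteq> 0" for y
  proof
    assume "g' y = 0"
    have "((\<lambda>x. f (g x)) has_real_derivative f' (g y) * g' y) (at y)"
      by (rule DERIV_chain2[OF f' g'])
    moreover have "((\<lambda>x. f (g x)) has_real_derivative 1) (at y)" by (simp add: inv2)
    ultimately have "f' (g y) * g' y = 1" by (rule DERIV_unique)
    then show False using \<open>g' y = 0\<close> by simp
  qed
  have Dr: "(g' has_real_derivative D x) (at x)" for x
    using D(1) by (simp add: has_real_derivative_iff_has_vector_derivative)
  have cont_g': "continuous_on UNIV g'"
    using Dr by (meson DERIV_isCont continuous_at_imp_continuous_on)
  have "bounded (D ` {0..1})"
    using D(2) by (intro compact_imp_bounded compact_continuous_image continuous_on_subset[OF D(2)]) auto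
  then obtain C where "\<forall>y\<in>D ` {0..1}. norm y \<le> C" unfolding bounded_iff by blast
  then have C: "\<And>x. x \<in> {0..1} \<Longrightarrow> \<bar>D x\<bar> \<le> C" by auto
  have C0: "0 \<le> C" using C[of 0] by simp
  have lip: "\<bar>g' y - g' y'\<bar> \<le> C * \<bar>y - y'\<bar>" if "0 \<le> y" "y \<le> 1" "0 \<le> y'" "y' \<le> 1" for y y'
    using that field_differentiable_bound[of "{0..1}" g' D C y y'] Dr C
    by (auto intro: DERIV_subset)
  have taylor: "\<bar>g (y + h) - g y - g' y * h\<bar> \<le> C * h\<^sup>2" if "0 \<le> y" "0 \<le> h" "y + h \<le> 1" for y h
  proof (cases "h = 0")
    case False
    then have "y < y + h" using that by simp
    then obtain z where z: "y < z" "z < y + h" "g (y + h) - g y = (y + h - y) * g' z"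
      using MVT2[of y "y + h" g g'] g' by blast
    have "g (y + h) - g y - g' y * h = h * (g' z - g' y)" using z(3) by (simp add: algebra_simps)
    then have "\<bar>g (y + h) - g y - g' y * h\<bar> = h * \<bar>g' z - g' y\<bar>" using that by (simp add: abs_mult)
    also have "\<dots> \<le> h * (C * \<bar>z - y\<bar>)" using that z by (intro mult_left_mono lip) auto
    also have "\<dots> \<le> h * (C * h)" using that z C0 by (intro mult_left_mono) auto
    finally show ?thesis by (simp add: power2_eq_square mult_ac)
  qed simp
  have cont: "continuous_on {0..1} (\<lambda>y. \<bar>g' y\<bar>)"
    by (intro continuous_intros continuous_on_subset[OF cont_g']) auto
  obtain y1 where y1: "y1 \<in> {0..1}" "\<forall>y\<in>{0..1}. \<bar>g' y1\<bar> \<le> \<bar>g' y\<bar>"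
    using continuous_attains_inf[OF _ _ cont] by auto
  obtain y2 where y2: "\<forall>y\<in>{0..1}. \<bar>g' y\<bar> \<le> \<bar>g' y2\<bar>"
    using continuous_attains_sup[OF _ _ cont] by auto
  have meas: "f \<in> borel_measurable borel" "g \<in> borel_measurable borel"
    using f' g' by (auto intro!: borel_measurable_continuous_onI continuous_at_imp_continuous_on DERIV_isCont)
  show thesis
    by (rule that[of C "\<bar>g' y1\<bar>" g' "\<bar>g' y2\<bar>", folded g_def])
      (use C0 ne taylor lip y1 y2 meas inv1 in auto)
qed

theorem theorem1p4:
  fixes a b :: int and \<mu> \<nu> :: "real measure"
  assumes "2 \<le> a" and "2 \<le> b" and "\<not> power_equiv a b"
    and "borel_prob_on_unit_interval \<mu>" and "borel_prob_on_unit_interval \<nu>"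
    and "intermediate_dimension \<mu>" and "intermediate_dimension \<nu>"
    and "ergodic_measure \<mu> (times_mod1 a)"
    and "ergodic_measure \<nu> (times_mod1 b)"
  shows "\<forall>f\<in>diff2. mutually_singular (distr \<mu> borel f) (extend_to_real \<nu>)"
proof
  fix f assume f: "f \<in> diff2"
  define a' b' where "a' = nat a" and "b' = nat b"
  have ab: "a = int a'" "b = int b'" "2 \<le> a'" "2 \<le> b'" using assms(1,2) by (auto simp: a'_def b'_def)
  let ?M = "extend_to_real \<mu>" and ?N = "extend_to_real \<nu>" and ?g = "inv f"
  have sysM: "digit_system ?M a'" and sysN: "digit_system ?N b'"
    using assms(4,5,8,9) ab by (auto intro!: digit_system_extend_to_real simp: ergodic_measure_def)
  interpret M: digit_system ?M a' by (rule sysM)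
  interpret N: digit_system ?N b' by (rule sysN)
  have dimM: "AE x in ?M. \<exists>D. ((\<lambda>r. ln (measure ?M (ball x r)) / ln r) \<longlongrightarrow> D) (at_right 0) \<and> 0 < D \<and> D < 1"
    by (rule intermediate_dimension_extend_to_real[OF assms(4,6)])
  have dimN: "AE x in ?N. \<exists>D. ((\<lambda>r. ln (measure ?N (ball x r)) / ln r) \<longlongrightarrow> D) (at_right 0) \<and> 0 < D"
    using intermediate_dimension_extend_to_real[OF assms(5,7)] by eventually_elim blast
  show "mutually_singular (distr \<mu> borel f) (extend_to_real \<nu>)"
  proof (rule diff2_inverse_estimates[OF f])
    fix g' C c1 c2 assume g: "0 \<le> C" "0 < c1"
      "\<And>y h. 0 \<le> y \<Longrightarrow> 0 \<le> h \<Longrightarrow> y + h \<le> 1 \<Longrightarrow> \<bar>?g (y + h) - ?g y - g' y * h\<bar> \<le> C * h\<^sup>2"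
      "\<And>y y'. 0 \<le> y \<Longrightarrow> y \<le> 1 \<Longrightarrow> 0 \<le> y' \<Longrightarrow> y' \<le> 1 \<Longrightarrow> \<bar>g' y - g' y'\<bar> \<le> C * \<bar>y - y'\<bar>"
      "\<And>y. 0 \<le> y \<Longrightarrow> y \<le> 1 \<Longrightarrow> c1 \<le> \<bar>g' y\<bar> \<and> \<bar>g' y\<bar> \<le> c2"
      and meas [measurable]: "?g \<in> borel_measurable borel" "f \<in> borel_measurable borel" and gf: "\<And>x. ?g (f x) = x"
    interpret S: smooth_image ?N b' a' ?g g' C c1 c2
    proof (intro smooth_image.intro smooth_image_axioms.intro)
      show "digit_system ?N b'" by (rule sysN)
      show "2 \<le> a'" by (rule ab(3))
      have "\<not> power_equiv (int a') (int b')" using assms(3) unfolding ab(1,2) .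
      then show "log (real b') (real a') \<notin> \<rat>" by (rule log_irrational[OF ab(3,4)])
      show "\<exists>\<kappa>>0. \<exists>l1. \<forall>l\<ge>l1. measure ?N {x. exp (- \<kappa> * real l) ^ 3 < N.pr l (dig b' l x)} \<le> \<delta>" if "0 < \<delta>" for \<delta>
        by (rule N.small_cells[OF dimN that])
    qed (fact g meas)+
    have distr_f: "distr \<mu> borel f = distr ?M borel f"
    proof -
      have "(\<lambda>x. x) \<in> borel_measurable \<mu>" by (rule real_prob_spaceD(4)[OF assms(4)]) simp
      then have "distr ?M borel f = distr \<mu> borel (f \<circ> (\<lambda>x. x))"
        unfolding extend_to_real_def by (intro distr_distr) auto
      then show ?thesis by (simp add: o_def)
    qed
    have fM: "f \<in> measurable ?M borel" by (simp add: extend_to_real_def)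
    interpret fM: prob_space "distr ?M borel f" by (rule M.prob_space_distr[OF fM])
    show "mutually_singular (distr \<mu> borel f) (extend_to_real \<nu>)"
      unfolding distr_f
    proof (rule mutually_singularI)
      show "sets (distr ?M borel f) = sets ?N" by (simp add: N.sets_N)
      show "finite_measure (distr ?M borel f)" "finite_measure ?N" by unfold_locales
      fix \<epsilon> :: real assume "0 < \<epsilon>"
      \<comment> \<open>Compensates the factor 8 in \<open>rarely_near_few_points\<close>.\<close>
      then have \<epsilon>: "0 < \<epsilon> / 8" by simp
      have unit: "AE x in ?M. 0 \<le> x \<and> x \<le> 1"
        using M.AE_unit by eventually_elim (metis frac_ge_0 frac_lt_1 less_imp_le)
      obtain q U where q: "0 < q" and U: "finite U" "real (card U) \<le> \<epsilon> / 8 * real q" and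
        near: "1 - \<epsilon> / 8 \<le> measure ?M {x. \<exists>u\<in>U. \<bar>x - u\<bar> \<le> 1 / (16 * real q)}"
        by (rule few_cells[OF M.prob_space_axioms M.sets_N unit dimM \<epsilon>]) blast
      let ?S = "{x. \<exists>u\<in>U. \<bar>x - u\<bar> \<le> 1 / (16 * real q)}"
      define \<Phi> where "\<Phi> x = (\<Sum>u\<in>U. kernel q (x - u))" for x
      have [measurable]: "\<Phi> \<in> borel_measurable borel" unfolding \<Phi>_def by measurable
      obtain n where n: "measure ?N {y. 1/4 \<le> \<Phi> (real a' ^ n * ?g y)} \<le> 8 * (\<epsilon> / 8)"
        unfolding \<Phi>_def by (rule S.rarely_near_few_points[OF q U \<epsilon>]) blast
      let ?E = "{y. 1/4 \<le> \<Phi> (real a' ^ n * ?g y)}"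
      have E [measurable]: "?E \<in> sets borel" by measurable
      have "measure (distr ?M borel f) (UNIV - ?E) = measure ?M {x. \<not> 1/4 \<le> \<Phi> (real a' ^ n * x)}"
        by (subst measure_distr[OF fM]) (auto intro!: arg_cong[where f = "measure ?M"] simp: gf)
      \<comment> \<open>\<Phi> has period 1, so it sees only the orbit under the map, and invariance
        removes \<open>a' ^ n\<close>: the time \<open>n\<close>, chosen for the second measure
        alone, costs nothing on this side.\<close>
      also have "\<dots> = measure ?M {x. \<not> 1/4 \<le> \<Phi> (frac (real a' ^ n * x))}"
        by (simp add: \<Phi>_def kernel_frac)
      also have "\<dots> = measure (distr ?M borel (\<lambda>x. frac (real a' ^ n * x))) {x. \<not> 1/4 \<le> \<Phi> x}"
        by (subst measure_distr) (auto intro!: arg_cong[where f = "measure ?M"] simp: extend_to_real_def)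
      also have "\<dots> = measure ?M {x. \<not> 1/4 \<le> \<Phi> x}" by (simp only: M.invariant_pow)
      also have "\<dots> \<le> measure ?M (UNIV - ?S)"
      proof (rule M.finite_measure_mono)
        show "{x. \<not> 1/4 \<le> \<Phi> x} \<subseteq> UNIV - ?S"
        proof safe
          fix x u assume u: "u \<in> U" "\<bar>x - u\<bar> \<le> 1 / (16 * real q)" and "\<not> 1/4 \<le> \<Phi> x"
          have "1/4 \<le> kernel q (x - u)" using kernel_ge[OF q u(2)] .
          also have "\<dots> \<le> \<Phi> x" unfolding \<Phi>_def
            using u(1) U(1) by (intro member_le_sum) (auto simp: kernel_nonneg)
          finally show False using \<open>\<not> 1/4 \<le> \<Phi> x\<close> by simp
        qed simp
        show "UNIV - ?S \<in> sets ?M"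
        proof -
          have "?S = (\<Union>u\<in>U. {x. \<bar>x - u\<bar> \<le> 1 / (16 * real q)})" by auto
          also have "\<dots> \<in> sets borel" using U(1) by (intro sets.finite_UN) auto
          finally show ?thesis by (auto simp: M.sets_N)
        qed
      qed
      also have "\<dots> = 1 - measure ?M ?S"
      proof -
        have "?S = (\<Union>u\<in>U. {x. \<bar>x - u\<bar> \<le> 1 / (16 * real q)})" by auto
        also have "\<dots> \<in> sets ?M" using U(1) by (intro sets.finite_UN) (auto simp: M.sets_N)
        finally show ?thesis using M.prob_compl by simp
      qed
      also have "\<dots> \<le> \<epsilon>" using near \<open>0 < \<epsilon>\<close> by simp
      finally show "\<exists>E\<in>sets (distr ?M borel f). measure (distr ?M borel f) (space (distr ?M borel f) - E) \<le> \<epsilon> \<and> measure ?N E \<le> \<epsilon>"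
        using n by (intro bexI[of _ ?E]) auto
    qed
  qed
qed

end
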